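(* Let $P$ be a finitely presented group and let $Q\leqslant P$ be a finitely generated subgroup. Then for each real number $\lambda>0$ and every integer $k\ge2$ there exist a torsion-free group $F$ with a finite $C'(\lambda)$ small cancellation presentation, an automorphism $\sigma\in \mathrm{Aut}(F)$ and an epimorphism $\psi:F\to P$ such that: - $\ker\psi$ is generated by $k$ elements; - the order of $\sigma$ is $k$; - $\psi(\mathrm{Fix}(\sigma))=Q$, where $\mathrm{Fix}(\sigma):=\{h\in F\mid\sigma(h)=h\}$ is the subgroup of fixed points of $\sigma$; - $\sigma$ induces the identity automorphism of $P$, i.e., $\sigma(\ker\psi)=\ker\psi$ and $\psi(\sigma(f))=\psi(f)$ for all $f\in F$.
   Context: A finite presentation $\langle Z\,\|\,\mathcal{R}\rangle$ satisfies the classical (metric) small cancellation condition $C'(\lambda)$ if the words in $\mathcal{R}$ are cyclically reduced and, denoting by $\mathcal{R}^*$ the set of all cyclic permutations of words from $\mathcal{R}^{\pm1}$, for any common initial subword $B$ of two distinct elements of $\mathcal{R}^*$ (a piece) and any $R\in\mathcal{R}^*$ having $B$ as an initial subword, one has $\|B\|<\lambda\|R\|$, where $\|\cdot\|$ denotes word length. *)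

theory Defs
  imports "HOL-Algebra.Algebra" "HOL-Library.Sublist"
begin

section \<open>Words\<close>

text \<open>The letter \<open>(x, True)\<close> stands for the generator \<open>x\<close>, and \<open>(x, False)\<close> for its
  formal inverse.\<close>

type_synonym 'a letter = "'a \<times> bool"
type_synonym 'a word = "'a letter list"

definition inv_letter :: "'a letter \<Rightarrow> 'a letter" where
  "inv_letter a = (fst a, \<not> snd a)"

definition inv_word :: "'a word \<Rightarrow> 'a word" where
  "inv_word w = rev (map inv_letter w)"

definition words_over :: "'a set \<Rightarrow> 'a word set" where
  "words_over Z = lists (Z \<times> UNIV)"

definition reduced :: "'a word \<Rightarrow> bool" where
  "reduced w \<longleftrightarrow> successively (\<lambda>a b. b \<noteq> inv_letter a) w"

definition cyclically_reduced :: "'a word \<Rightarrow> bool" where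
  "cyclically_reduced w \<longleftrightarrow> reduced w \<and> (w \<noteq> [] \<longrightarrow> hd w \<noteq> inv_letter (last w))"

section \<open>Free groups and group presentations\<close>

text \<open>For reduced \<open>w\<close>, \<open>push a w\<close> is the reduced form of \<open>a # w\<close>. The free group consists
  of the reduced words, so the relators of a presentation are required to be reduced.\<close>

fun push :: "'a letter \<Rightarrow> 'a word \<Rightarrow> 'a word" where
  "push a [] = [a]"
| "push a (b # w) = (if b = inv_letter a then w else a # b # w)"

definition reduce :: "'a word \<Rightarrow> 'a word" where
  "reduce w = foldr push w []"

definition free_group :: "'a set \<Rightarrow> 'a word monoid" where
  "free_group Z =
     \<lparr>carrier = {w \<in> words_over Z. reduced w},
      monoid.mult = (\<lambda>u v. reduce (u @ v)),
      one = []\<rparr>"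

definition normal_closure :: "('a, 'b) monoid_scheme \<Rightarrow> 'a set \<Rightarrow> 'a set" where
  "normal_closure G S = \<Inter>{N. N \<lhd> G \<and> S \<subseteq> N}"

definition presented_group :: "'a set \<Rightarrow> 'a word set \<Rightarrow> 'a word set monoid" where
  "presented_group Z R = free_group Z Mod normal_closure (free_group Z) R"

definition finite_presentation :: "'a set \<Rightarrow> 'a word set \<Rightarrow> bool" where
  "finite_presentation Z R \<longleftrightarrow> finite Z \<and> finite R \<and> R \<subseteq> carrier (free_group Z)"

text \<open>Taking the generators to be natural numbers loses nothing, since a finite set of
  generators can be renamed.\<close>

definition finitely_presented :: "('g, 'b) monoid_scheme \<Rightarrow> bool" where
  "finitely_presented G \<longleftrightarrow>
     (\<exists>(Z :: nat set) R. finite_presentation Z R \<and> presented_group Z R \<cong> G)"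

section \<open>Metric small cancellation\<close>

definition symmetrized :: "'a word set \<Rightarrow> 'a word set" where
  "symmetrized R = {rotate n r | n r. r \<in> R \<union> inv_word ` R}"

text \<open>Distinctness of the two elements is distinctness as words; the empty word may be a piece.\<close>

definition piece :: "'a word set \<Rightarrow> 'a word \<Rightarrow> bool" where
  "piece R B \<longleftrightarrow>
     (\<exists>R\<^sub>1 \<in> symmetrized R. \<exists>R\<^sub>2 \<in> symmetrized R. R\<^sub>1 \<noteq> R\<^sub>2 \<and> prefix B R\<^sub>1 \<and> prefix B R\<^sub>2)"

definition metric_small_cancellation :: "real \<Rightarrow> 'a word set \<Rightarrow> bool" where
  "metric_small_cancellation c R \<longleftrightarrow>
     (\<forall>r \<in> R. cyclically_reduced r) \<and>
     (\<forall>B. piece R B \<longrightarrow>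
        (\<forall>r \<in> symmetrized R. prefix B r \<longrightarrow> real (length B) < c * real (length r)))"

definition has_finite_small_cancellation_presentation ::
    "real \<Rightarrow> ('g, 'b) monoid_scheme \<Rightarrow> bool" where
  "has_finite_small_cancellation_presentation c G \<longleftrightarrow>
     (\<exists>(Z :: nat set) R. finite_presentation Z R \<and> metric_small_cancellation c R \<and>
        presented_group Z R \<cong> G)"

section \<open>Group-theoretic notions\<close>

definition torsion_free :: "('g, 'b) monoid_scheme \<Rightarrow> bool" where
  "torsion_free G \<longleftrightarrow>
     (\<forall>x \<in> carrier G. \<forall>n :: nat. 0 < n \<longrightarrow> x [^]\<^bsub>G\<^esub> n = \<one>\<^bsub>G\<^esub> \<longrightarrow> x = \<one>\<^bsub>G\<^esub>)"

definition fixed_subgroup :: "('g, 'b) monoid_scheme \<Rightarrow> ('g \<Rightarrow> 'g) \<Rightarrow> 'g set" where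
  "fixed_subgroup G \<sigma> = {h \<in> carrier G. \<sigma> h = h}"

section \<open>The constructions above are groups\<close>

lemma inv_letter_inv_letter [simp]: "inv_letter (inv_letter a) = a"
  by (simp add: inv_letter_def)

lemma inv_letter_neq [simp]: "inv_letter a \<noteq> a" "a \<noteq> inv_letter a"
  by (auto simp: inv_letter_def prod_eq_iff)

lemma inv_letter_mem [simp]: "inv_letter a \<in> Z \<times> UNIV \<longleftrightarrow> a \<in> Z \<times> UNIV"
  by (cases a) (simp add: inv_letter_def)

lemma reduced_Nil [simp]: "reduced []"
  by (simp add: reduced_def)

lemma reduced_Cons:
  "reduced (a # w) \<longleftrightarrow> reduced w \<and> (w \<noteq> [] \<longrightarrow> hd w \<noteq> inv_letter a)"
  by (cases w) (auto simp: reduced_def)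

lemma reduced_push: "reduced w \<Longrightarrow> reduced (push a w)"
  by (cases w) (auto simp: reduced_Cons)

lemma reduced_foldr_push: "reduced w \<Longrightarrow> reduced (foldr push u w)"
  by (induction u) (auto simp: reduced_push)

lemma push_push_inv: "reduced w \<Longrightarrow> push a (push (inv_letter a) w) = w"
proof (cases w)
  case (Cons b v)
  assume "reduced w"
  then show ?thesis using Cons by (cases v) (auto simp: reduced_Cons)
qed simp

lemma foldr_push_push:
  assumes "reduced x"
  shows "foldr push (push a u) x = push a (foldr push u x)"
proof (cases u)
  case (Cons b v)
  then show ?thesis
    using push_push_inv[OF reduced_foldr_push[OF assms], of a v] by auto
qed simp

lemma foldr_push_reduce:
  assumes "reduced x"
  shows "foldr push (reduce u) x = foldr push u x"
  using assms by (induction u) (auto simp: reduce_def foldr_push_push)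

lemma reduce_append: "reduce (u @ v) = foldr push u (reduce v)"
  by (simp add: reduce_def)

lemma reduced_reduce: "reduced (reduce w)"
  by (simp add: reduce_def reduced_foldr_push)

lemma reduce_reduced: "reduced w \<Longrightarrow> reduce w = w"
proof (induction w)
  case (Cons a w)
  then have "push a w = a # w"
    by (cases w) (auto simp: reduced_Cons)
  then show ?case using Cons by (simp add: reduce_def reduced_Cons)
qed (simp add: reduce_def)

lemma reduce_reduce_append: "reduce (reduce u @ v) = reduce (u @ v)"
  by (simp add: reduce_append foldr_push_reduce reduced_reduce)

lemma reduce_append_reduce: "reduce (u @ reduce v) = reduce (u @ v)"
  by (simp add: reduce_append reduce_reduced reduced_reduce)

lemma push_words_over:
  "a \<in> Z \<times> UNIV \<Longrightarrow> w \<in> words_over Z \<Longrightarrow> push a w \<in> words_over Z"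
  by (cases w) (auto simp: words_over_def)

lemma reduce_words_over: "w \<in> words_over Z \<Longrightarrow> reduce w \<in> words_over Z"
proof (induction w)
  case (Cons a w)
  then have "a \<in> Z \<times> UNIV" "w \<in> words_over Z" by (auto simp: words_over_def)
  then show ?case using Cons.IH push_words_over[of a Z "reduce w"] by (simp add: reduce_def)
qed (simp add: reduce_def)

lemma words_over_append [simp]:
  "u @ v \<in> words_over Z \<longleftrightarrow> u \<in> words_over Z \<and> v \<in> words_over Z"
  by (simp add: words_over_def)

lemma inv_word_words_over: "w \<in> words_over Z \<Longrightarrow> inv_word w \<in> words_over Z"
  by (force simp: words_over_def inv_word_def in_lists_conv_set inv_letter_def)

lemma reduce_inv_word_append:
  "reduced x \<Longrightarrow> foldr push (inv_word w) (foldr push w x) = x"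
proof (induction w)
  case (Cons a w)
  then show ?case
    using push_push_inv[OF reduced_foldr_push[OF Cons.prems], of "inv_letter a" w]
    by (simp add: inv_word_def)
qed (simp add: inv_word_def)

lemma group_free_group: "group (free_group Z)"
proof (rule groupI)
  show "\<exists>y\<in>carrier (free_group Z). y \<otimes>\<^bsub>free_group Z\<^esub> x = \<one>\<^bsub>free_group Z\<^esub>"
    if "x \<in> carrier (free_group Z)" for x
  proof (rule bexI[of _ "reduce (inv_word x)"])
    show "reduce (inv_word x) \<in> carrier (free_group Z)"
      using that
      by (simp add: free_group_def reduced_reduce reduce_words_over inv_word_words_over)
    show "reduce (inv_word x) \<otimes>\<^bsub>free_group Z\<^esub> x = \<one>\<^bsub>free_group Z\<^esub>"
      using reduce_inv_word_append[of "[]" x]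
      by (simp add: free_group_def reduce_append foldr_push_reduce reduced_reduce)
        (simp add: reduce_def)
  qed
next
  show "x \<otimes>\<^bsub>free_group Z\<^esub> y \<otimes>\<^bsub>free_group Z\<^esub> z =
      x \<otimes>\<^bsub>free_group Z\<^esub> (y \<otimes>\<^bsub>free_group Z\<^esub> z)" for x y z
    by (simp add: free_group_def reduce_reduce_append reduce_append_reduce)
qed (simp_all add: free_group_def reduced_reduce reduce_words_over reduce_reduced, simp add: words_over_def)

lemma inv_free_group:
  assumes "w \<in> carrier (free_group Z)"
  shows "inv\<^bsub>free_group Z\<^esub> w = reduce (inv_word w)"
proof (rule group.inv_equality[OF group_free_group])
  show "reduce (inv_word w) \<in> carrier (free_group Z)"
    using assms
    by (simp add: free_group_def reduced_reduce reduce_words_over inv_word_words_over)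
  show "reduce (inv_word w) \<otimes>\<^bsub>free_group Z\<^esub> w = \<one>\<^bsub>free_group Z\<^esub>"
    using reduce_inv_word_append[of "[]" w]
    by (simp add: free_group_def reduce_append foldr_push_reduce reduced_reduce)
      (simp add: reduce_def)
qed (use assms in auto)

lemma (in group) self_normal: "carrier G \<lhd> G"
  unfolding normal_inv_iff using subgroup_self by auto

lemma (in group) normal_closure_normal:
  assumes "S \<subseteq> carrier G"
  shows "normal_closure G S \<lhd> G"
proof -
  have ne: "{N. N \<lhd> G \<and> S \<subseteq> N} \<noteq> {}"
    using self_normal assms by blast
  have "subgroup (\<Inter>{N. N \<lhd> G \<and> S \<subseteq> N}) G"
    by (rule subgroups_Inter[OF _ ne]) (auto simp: normal_imp_subgroup)
  then show ?thesis
    unfolding normal_inv_iff normal_closure_def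
    by (auto simp: normal.inv_op_closed2)
qed

lemma group_presented_group:
  assumes "R \<subseteq> carrier (free_group Z)"
  shows "group (presented_group Z R)"
  unfolding presented_group_def
  using group.normal_closure_normal[OF group_free_group assms] by (rule normal.factorgroup_is_group)

end

theory Submission
  imports Defs
begin

text \<open>The group \<open>F\<close> is generated by letters \<open>t\<^sub>0, \<dots>, t\<^sub>k\<^sub>-\<^sub>1\<close>, by \<open>k\<close> copies \<open>x\<^sub>i\<^sub>,\<^sub>0, \<dots>, x\<^sub>i\<^sub>,\<^sub>k\<^sub>-\<^sub>1\<close> of every
  generator of \<open>P\<close> and by one letter \<open>y\<^sub>j\<close> for every generator of \<open>Q\<close>; the automorphism permutes the
  \<open>t\<close> and the copies cyclically and fixes the \<open>y\<close>. As in Rips' construction, short words that are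
  trivial in \<open>P\<close> are set equal to long positive words in the \<open>t\<close>. Hence the \<open>t\<close> generate a normal
  subgroup with quotient \<open>P\<close>, and pieces are short because the powers occurring in the long words have
  pairwise distinct exponents.

  Everything else follows from Greendlinger's lemma. If \<open>h\<close> is a shortest nontrivial torsion element,
  then \<open>h\<^sup>n\<close> contains most of a relator, which overlaps its own translate by \<open>h\<close> in more than a piece,
  so the relator is a proper power. If \<open>w\<close> is a shortest representative of a fixed point that neither
  begins nor ends with a \<open>y\<close>, then \<open>w\<^sup>-\<^sup>1 \<sigma>(w)\<close> is cyclically reduced and contains most of a relator \<open>r\<close>
  across a junction; comparing \<open>r\<close> with \<open>\<sigma>(r\<^sup>-\<^sup>1)\<close> there shows that they coincide, which is impossible
  since the letters \<open>t\<close> occur in \<open>r\<close> mostly with positive sign. So fixed points are words in the \<open>y\<close>.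

  Greendlinger's lemma is proved by curvature on planar maps, which are given by permutations of darts;
  planarity means that the Euler inequality holds, and this is preserved by the moves that build and
  reduce a diagram.\<close>

section \<open>Counting classes of generated equivalence relations\<close>

text \<open>Cutting and joining faces multiplies the face permutation by a transposition, so its
  effect on vertices and components becomes a count of cycles. Only one direction of Euler's formula
  has to survive, hence a single inequality is carried along and connectedness is never tracked. A
  positively curved cell has at most five inner arcs, so the boundary contains the fraction
  \<open>1 - 5 * c\<close> of a relator. With \<open>c \<le> 1/20\<close> this is three quarters: a
  geodesic absorbs at most one half, and what is left over exceeds a piece. The relators must be
  long compared with their largest exponent \<open>K\<close>, although larger exponents are needed
  to keep them distinct. The way out is to give every relator \<open>M\<close> blocks with exponents
  at least \<open>A\<close>: its length is at least \<open>M * (A + 1)\<close>, while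
  \<open>K\<close> exceeds \<open>A\<close> only by \<open>M\<close> times the number of relators up
  to symmetry. The powers in a tail are taken of one letter \<open>t\<close>, separated by its
  cyclic predecessor. This letter tells which translate of a relator is seen, so the same exponents
  can serve all translates.\<close>

definition eqcl :: "('d \<times> 'd) set \<Rightarrow> ('d \<times> 'd) set" where
  "eqcl S = (S \<union> S\<inverse>)\<^sup>*"

definition num_classes :: "'d set \<Rightarrow> ('d \<times> 'd) set \<Rightarrow> nat" where
  "num_classes D S = card ((\<lambda>x. eqcl S `` {x}) ` D)"

lemma eqcl_refl [simp, intro]: "(x, x) \<in> eqcl S"
  by (simp add: eqcl_def)

lemma eqcl_base [intro]: "(x, y) \<in> S \<Longrightarrow> (x, y) \<in> eqcl S"
  by (auto simp: eqcl_def)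

lemma eqcl_trans [trans]: "(x, y) \<in> eqcl S \<Longrightarrow> (y, z) \<in> eqcl S \<Longrightarrow> (x, z) \<in> eqcl S"
  by (auto simp: eqcl_def)

lemma eqcl_sym: "(x, y) \<in> eqcl S \<Longrightarrow> (y, x) \<in> eqcl S"
proof -
  have "sym (S \<union> S\<inverse>)"
    by (auto intro: symI)
  then show "(x, y) \<in> eqcl S \<Longrightarrow> (y, x) \<in> eqcl S"
    unfolding eqcl_def by (meson sym_rtrancl symD)
qed

lemma eqcl_induct [consumes 1, case_names refl step]:
  assumes "(a, b) \<in> eqcl S" and "P a"
    and "\<And>x y. P x \<Longrightarrow> (x, y) \<in> S \<or> (y, x) \<in> S \<Longrightarrow> P y"
  shows "P b"
  using assms(1) unfolding eqcl_def
  by (induction rule: rtrancl_induct) (use assms(2,3) in auto)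

text \<open>A map that respects the generating pairs up to equivalence respects all that they
  generate. Inclusions and retractions of sets of darts are both instances.\<close>

lemma eqcl_map:
  assumes "(a, b) \<in> eqcl S" and "\<And>x y. (x, y) \<in> S \<Longrightarrow> (\<rho> x, \<rho> y) \<in> eqcl S'"
  shows "(\<rho> a, \<rho> b) \<in> eqcl S'"
  using assms(1)
proof (induction rule: eqcl_induct)
  case (step x y)
  then have "(\<rho> x, \<rho> y) \<in> eqcl S'"
    using assms(2) eqcl_sym by metis
  then show ?case using step(1) eqcl_trans by metis
qed simp

lemma eqcl_mono:
  assumes "S \<subseteq> eqcl S'" and "(a, b) \<in> eqcl S"
  shows "(a, b) \<in> eqcl S'"
  using eqcl_map[OF assms(2), of "\<lambda>x. x"] assms(1) by auto

lemma eqcl_class_eq: "eqcl S `` {x} = eqcl S `` {y} \<longleftrightarrow> (x, y) \<in> eqcl S"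
  by (auto; meson eqcl_trans eqcl_sym eqcl_refl)

lemma eqcl_Image:
  assumes "S' \<subseteq> eqcl S"
  shows "eqcl S `` (eqcl S' `` {x}) = eqcl S `` {x}"
  using eqcl_mono[OF assms] by (auto intro: eqcl_trans)

lemma num_classes_mono:
  assumes "finite D" and "S' \<subseteq> eqcl S"
  shows "num_classes D S \<le> num_classes D S'"
proof -
  have "(\<lambda>x. eqcl S `` {x}) ` D = (\<lambda>K. eqcl S `` K) ` (\<lambda>x. eqcl S' `` {x}) ` D"
    unfolding image_image
    by (intro image_cong refl) (auto dest: eqcl_mono[OF assms(2)] intro: eqcl_trans)
  then show ?thesis
    unfolding num_classes_def by (metis assms(1) card_image_le finite_imageI)
qed

text \<open>The \<open>S\<close>-class of \<open>b\<close> is also reached from the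
  \<open>S'\<close>-class of \<open>a\<close>, so sending an \<open>S'\<close>-class to the
  \<open>S\<close>-class around it stays surjective after the class of \<open>b\<close> is left
  out.\<close>

lemma num_classes_strict_mono:
  assumes "finite D" and "S' \<subseteq> eqcl S" and "a \<in> D" "b \<in> D"
    and "(a, b) \<in> eqcl S" and "(a, b) \<notin> eqcl S'"
  shows "num_classes D S < num_classes D S'"
proof -
  let ?A = "(\<lambda>x. eqcl S' `` {x}) ` D"
  have "(\<lambda>x. eqcl S `` {x}) ` D \<subseteq> (\<lambda>K. eqcl S `` K) ` (?A - {eqcl S' `` {b}})"
  proof
    fix K assume "K \<in> (\<lambda>x. eqcl S `` {x}) ` D"
    then obtain x where x: "x \<in> D" "K = eqcl S `` {x}" by auto
    \<comment> \<open>A representative inside the \<open>S'\<close>-class of \<open>b\<close> is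
      exchanged for \<open>a\<close>, which lies in the same \<open>S\<close>-class.\<close>
    define z where "z = (if (x, b) \<in> eqcl S' then a else x)"
    have "z \<in> D" using x assms(3) by (simp add: z_def)
    have 1: "(z, b) \<notin> eqcl S'" using assms(6) by (simp add: z_def)
    have "(z, x) \<in> eqcl S"
      using assms(5) eqcl_mono[OF assms(2)] eqcl_trans[of a b S x] eqcl_sym[of x b S]
      by (auto simp: z_def)
    then have "K = eqcl S `` (eqcl S' `` {z})"
      unfolding x(2) eqcl_Image[OF assms(2)] by (simp add: eqcl_class_eq eqcl_sym)
    moreover have "eqcl S' `` {z} \<noteq> eqcl S' `` {b}"
      using 1 by (simp add: eqcl_class_eq)
    ultimately show "K \<in> (\<lambda>K. eqcl S `` K) ` (?A - {eqcl S' `` {b}})"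
      using \<open>z \<in> D\<close> by blast
  qed
  then have "num_classes D S \<le> card (?A - {eqcl S' `` {b}})"
    unfolding num_classes_def using assms(1) by (meson finite_Diff finite_imageI surj_card_le)
  also have "\<dots> < card ?A"
    using assms(1,4) by (intro card_Diff1_less) auto
  finally show ?thesis by (simp add: num_classes_def)
qed

lemma eqcl_insert:
  assumes "(x, y) \<in> eqcl (insert (a, b) S)"
  shows "(x, y) \<in> eqcl S \<or> ((x, a) \<in> eqcl S \<or> (x, b) \<in> eqcl S) \<and> ((y, a) \<in> eqcl S \<or> (y, b) \<in> eqcl S)"
  using assms
proof (induction rule: eqcl_induct)
  case (step y z)
  then consider "(y, z) \<in> eqcl S" | "y = a" "z = b" | "y = b" "z = a"
    by (auto intro: eqcl_sym)
  then show ?case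
    using step(1) by cases (auto intro: eqcl_trans eqcl_sym)
qed auto

text \<open>A single extra pair can identify only the classes of \<open>a\<close> and
  \<open>b\<close>, so passing to the larger classes is injective once the class of \<open>b\<close>
  is left out.\<close>

lemma num_classes_insert_le:
  assumes "finite D"
  shows "num_classes D S \<le> num_classes D (insert (a, b) S) + 1"
proof -
  let ?T = "insert (a, b) S"
  let ?A = "(\<lambda>x. eqcl S `` {x}) ` D"
  have sub: "(x, y) \<in> eqcl S \<Longrightarrow> (x, y) \<in> eqcl ?T" for x y
    by (rule eqcl_mono[of S]) auto
  have cl: "eqcl ?T `` (eqcl S `` {x}) = eqcl ?T `` {x}" for x
    by (auto intro: eqcl_trans sub)
  have "inj_on (\<lambda>K. eqcl ?T `` K) (?A - {eqcl S `` {b}})"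
  proof (rule inj_onI)
    fix K L assume K: "K \<in> ?A - {eqcl S `` {b}}" and L: "L \<in> ?A - {eqcl S `` {b}}"
      and eq: "eqcl ?T `` K = eqcl ?T `` L"
    from K L obtain x y where x: "K = eqcl S `` {x}" "x \<in> D" and y: "L = eqcl S `` {y}" "y \<in> D"
      by auto
    have "(x, y) \<in> eqcl ?T"
      using eq unfolding x y cl eqcl_class_eq .
    moreover have "(x, b) \<notin> eqcl S" "(y, b) \<notin> eqcl S"
      using K L unfolding x y by (auto simp: eqcl_class_eq)
    ultimately have "(x, y) \<in> eqcl S"
      using eqcl_insert[of x y a b S] by (auto intro: eqcl_trans eqcl_sym)
    then show "K = L" unfolding x y by (simp add: eqcl_class_eq)
  qed
  then have "card (?A - {eqcl S `` {b}}) = card ((\<lambda>K. eqcl ?T `` K) ` (?A - {eqcl S `` {b}}))"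
    by (simp add: card_image)
  also have "\<dots> \<le> num_classes D ?T"
    unfolding num_classes_def using assms by (intro card_mono) (auto simp: cl image_image)
  finally have "card (?A - {eqcl S `` {b}}) \<le> num_classes D ?T" .
  moreover have "card ?A \<le> card (?A - {eqcl S `` {b}}) + 1"
    using card_Diff1_le[of ?A] assms by (metis Suc_eq_plus1 card.infinite card_Diff_singleton_if diff_le_self le_diff_conv order_refl le_SucI One_nat_def)
  ultimately show ?thesis by (simp add: num_classes_def)
qed

text \<open>The counting device for removing darts: if each dart can be pushed into
  \<open>D'\<close> within its own class, compatibly with the generating pairs, no class is lost and
  none is split.\<close>

lemma num_classes_retract:
  assumes "D' \<subseteq> D" and "\<And>d. d \<in> D \<Longrightarrow> \<rho> d \<in> D'" and "\<And>d. d \<in> D' \<Longrightarrow> \<rho> d = d"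
    and "\<And>d. d \<in> D \<Longrightarrow> (d, \<rho> d) \<in> eqcl S" and "S' \<subseteq> eqcl S"
    and "\<And>a b. (a, b) \<in> S \<Longrightarrow> (\<rho> a, \<rho> b) \<in> eqcl S'"
  shows "num_classes D S = num_classes D' S'"
proof -
  have iff: "(x, y) \<in> eqcl S \<longleftrightarrow> (x, y) \<in> eqcl S'" if "x \<in> D'" "y \<in> D'" for x y
    using eqcl_map[of x y S \<rho> S'] eqcl_mono[OF assms(5), of x y] assms(3,6) that by auto
  have "bij_betw (\<lambda>K. eqcl S `` K) ((\<lambda>x. eqcl S' `` {x}) ` D') ((\<lambda>x. eqcl S `` {x}) ` D)"
  proof -
    have cl: "eqcl S `` (eqcl S' `` {x}) = eqcl S `` {x}" for x
      by (auto intro: eqcl_trans eqcl_mono[OF assms(5)])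
    have "inj_on (\<lambda>K. eqcl S `` K) ((\<lambda>x. eqcl S' `` {x}) ` D')"
      by (auto simp: inj_on_def cl eqcl_class_eq iff)
    moreover have "(\<lambda>x. eqcl S `` {x}) ` D' = (\<lambda>x. eqcl S `` {x}) ` D"
    proof
      show "(\<lambda>x. eqcl S `` {x}) ` D \<subseteq> (\<lambda>x. eqcl S `` {x}) ` D'"
      proof
        fix K assume "K \<in> (\<lambda>x. eqcl S `` {x}) ` D"
        then obtain x where x: "x \<in> D" "K = eqcl S `` {x}" by auto
        then have "K = eqcl S `` {\<rho> x}" using assms(4)[OF x(1)] by (simp add: eqcl_class_eq)
        then show "K \<in> (\<lambda>x. eqcl S `` {x}) ` D'" using assms(2)[OF x(1)] by auto
      qed
    qed (use assms(1) in auto)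
    ultimately show ?thesis
      by (simp add: bij_betw_def image_image cl)
  qed
  then show ?thesis
    unfolding num_classes_def by (metis bij_betw_same_card)
qed

lemma num_classes_insert_isolated:
  assumes "finite D" and "y \<notin> D" and "\<And>z. (y, z) \<in> S \<or> (z, y) \<in> S \<Longrightarrow> z = y"
  shows "num_classes (insert y D) S = num_classes D S + 1"
proof -
  have "z = y" if "(y, z) \<in> eqcl S" for z
    using that by (induction rule: eqcl_induct) (use assms(3) in auto)
  then have "eqcl S `` {y} \<notin> (\<lambda>x. eqcl S `` {x}) ` D"
    using assms(2) by (auto simp: eqcl_class_eq)
  then show ?thesis
    using assms(1) by (simp add: num_classes_def)
qed

subsection \<open>Permutations multiplied by a transposition\<close>

definition graph_on :: "'d set \<Rightarrow> ('d \<Rightarrow> 'd) \<Rightarrow> ('d \<times> 'd) set" where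
  "graph_on D p = {(x, p x) | x. x \<in> D}"

lemma graph_on_iff: "(x, y) \<in> graph_on D p \<longleftrightarrow> x \<in> D \<and> y = p x"
  by (auto simp: graph_on_def)

lemma funpow_mem: "bij_betw p D D \<Longrightarrow> x \<in> D \<Longrightarrow> (p ^^ n) x \<in> D"
  by (induction n) (auto simp: bij_betw_def)

lemma funpow_eqcl: "bij_betw p D D \<Longrightarrow> x \<in> D \<Longrightarrow> (x, (p ^^ n) x) \<in> eqcl (graph_on D p)"
proof (induction n)
  case (Suc n)
  have "((p ^^ n) x, (p ^^ Suc n) x) \<in> eqcl (graph_on D p)"
    using Suc.prems by (intro eqcl_base) (auto simp: graph_on_iff funpow_mem)
  with Suc show ?case by (meson eqcl_trans)
qed simp

lemma bij_betw_funpow_self: "bij_betw p D D \<Longrightarrow> bij_betw (p ^^ n) D D"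
proof (induction n)
  case (Suc n)
  then show ?case using bij_betw_trans[of "p ^^ n" D D p D] by (simp add: o_def)
qed (simp add: bij_betw_def)

lemma funpow_return:
  assumes "finite D" and "bij_betw p D D" and "x \<in> D"
  obtains n where "0 < n" "(p ^^ n) x = x"
proof -
  have "\<not> inj_on (\<lambda>n. (p ^^ n) x) {..card D}"
  proof
    assume "inj_on (\<lambda>n. (p ^^ n) x) {..card D}"
    then have "card {..card D} \<le> card D"
      using assms funpow_mem by (intro card_inj_on_le[of _ _ D]) auto
    then show False by simp
  qed
  then obtain i j where "i < j" "(p ^^ i) x = (p ^^ j) x"
    unfolding inj_on_def by (metis linorder_neqE_nat)
  then have "(p ^^ i) ((p ^^ (j - i)) x) = (p ^^ i) x"
    by (metis add_diff_inverse_nat comp_apply funpow_add not_less_iff_gr_or_eq)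
  moreover have "inj_on (p ^^ i) D"
    using assms(2) bij_betw_funpow_self bij_betw_def by blast
  ultimately have "(p ^^ (j - i)) x = x"
    using assms(2,3) by (meson funpow_mem inj_onD)
  then show thesis using that[of "j - i"] \<open>i < j\<close> by simp
qed

text \<open>A step against \<open>p\<close> is again a forward power, because on a finite set every
  point returns to itself.\<close>

lemma eqcl_graph_on_funpow:
  assumes "finite D" and "bij_betw p D D" and "x \<in> D" and "(x, y) \<in> eqcl (graph_on D p)"
  obtains n where "y = (p ^^ n) x"
proof -
  have "y \<in> D \<and> (\<exists>n. y = (p ^^ n) x)"
    using assms(4)
  proof (induction rule: eqcl_induct)
    case (step y z)
    then obtain n where n: "y = (p ^^ n) x" "y \<in> D" by auto
    from step(2) show ?case
    proof
      assume "(y, z) \<in> graph_on D p"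
      then have "z = (p ^^ Suc n) x" using n by (simp add: graph_on_iff)
      then show ?thesis using funpow_mem[OF assms(2,3)] by blast
    next
      assume "(z, y) \<in> graph_on D p"
      then have z: "z \<in> D" "y = p z" by (auto simp: graph_on_iff)
      obtain m where m: "0 < m" "(p ^^ m) z = z"
        using funpow_return[OF assms(1,2) z(1)] .
      then have "z = (p ^^ (m - 1)) (p z)"
        by (metis Suc_diff_1 comp_apply funpow_Suc_right)
      then have "z = (p ^^ (m - 1 + n)) x" using z n by (simp add: funpow_add)
      then show ?thesis using z by blast
    qed
  qed (use assms(3) in \<open>auto intro: exI[of _ 0]\<close>)
  then show thesis using that by blast
qed

lemma bij_betw_transpose:
  assumes "a \<in> D" "b \<in> D"
  shows "bij_betw (transpose a b) D D"
proof -
  have "transpose a b ` D = D"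
    using assms by (auto simp: transpose_def image_iff)
  then show ?thesis using inj_on_subset[OF inj_transpose] by (simp add: bij_betw_def)
qed

context
  fixes D :: "'d set" and p q :: "'d \<Rightarrow> 'd" and a b :: 'd
  assumes fin: "finite D" and bij: "bij_betw p D D" and ab: "a \<in> D" "b \<in> D" "a \<noteq> b"
    and q: "\<And>x. x \<in> D \<Longrightarrow> q x = p (transpose a b x)"
begin

lemma mult_transpose_bij: "bij_betw q D D"
proof -
  have "bij_betw (p \<circ> transpose a b) D D"
    using bij_betw_trans[OF bij_betw_transpose[OF ab(1,2)] bij] .
  then show ?thesis using q by (subst bij_betw_cong[of D q "p \<circ> transpose a b"]) auto
qed

text \<open>A transposition cuts a cycle through both points: \<open>q\<close> sends
  \<open>a\<close> to \<open>p b\<close>, so the arc of the \<open>p\<close>-cycle from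
  \<open>p b\<close> to \<open>a\<close> closes up and misses \<open>b\<close>.\<close>

lemma mult_transpose_separate:
  assumes "(a, b) \<in> eqcl (graph_on D p)"
  shows "(a, b) \<notin> eqcl (graph_on D q)"
proof
  assume "(a, b) \<in> eqcl (graph_on D q)"
  then obtain n where n: "b = (q ^^ n) a"
    using eqcl_graph_on_funpow[OF fin mult_transpose_bij ab(1)] by metis
  obtain j0 where j0: "a = (p ^^ j0) b"
    using eqcl_graph_on_funpow[OF fin bij ab(2) eqcl_sym[OF assms]] .
  define m where "m = (LEAST m. a = (p ^^ m) b)"
  have m: "a = (p ^^ m) b" unfolding m_def using j0 by (rule LeastI)
  have least: "a \<noteq> (p ^^ j) b" if "j < m" for j
    using that not_less_Least unfolding m_def by blast
  have "m \<noteq> 0" using m ab(3) by (metis funpow_0)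
  define C where "C = {(p ^^ j) b | j. 0 < j \<and> j \<le> m}"
  have "b \<notin> C"
  proof
    assume "b \<in> C"
    then obtain j where j: "0 < j" "j \<le> m" "b = (p ^^ j) b" by (auto simp: C_def)
    then have "a = (p ^^ (m - j)) b" using m
      by (metis comp_apply funpow_add le_add_diff_inverse2)
    then show False using least[of "m - j"] j \<open>m \<noteq> 0\<close> by simp
  qed
  have "q x \<in> C" if "x \<in> C" for x
  proof -
    obtain j where j: "0 < j" "j \<le> m" "x = (p ^^ j) b" using \<open>x \<in> C\<close> by (auto simp: C_def)
    have xD: "x \<in> D" using j funpow_mem[OF bij ab(2)] by blast
    have "x \<noteq> b" using \<open>b \<notin> C\<close> that by blast
    show ?thesis
    proof (cases "x = a")
      case True
      then have "q x = (p ^^ 1) b" using q[OF xD] by simp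
      then show ?thesis unfolding C_def using \<open>m \<noteq> 0\<close> by (intro CollectI exI[of _ 1]) auto
    next
      case False
      then have "q x = (p ^^ Suc j) b" using q[OF xD] \<open>x \<noteq> b\<close> j by simp
      moreover have "j < m" using False j m by (cases "j = m") auto
      ultimately show ?thesis unfolding C_def by (intro CollectI exI[of _ "Suc j"]) auto
    qed
  qed
  moreover have "a \<in> C" unfolding C_def using m \<open>m \<noteq> 0\<close> by (intro CollectI exI[of _ m]) auto
  ultimately have "(q ^^ n) a \<in> C" for n by (induction n) auto
  then show False using n \<open>b \<notin> C\<close> by auto
qed

text \<open>From \<open>a\<close> the permutation \<open>q\<close> enters the cycle of
  \<open>b\<close> at \<open>p b\<close> and follows it, never meeting \<open>a\<close>, until it
  arrives at \<open>b\<close>.\<close>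

lemma mult_transpose_join:
  assumes "(a, b) \<notin> eqcl (graph_on D p)"
  shows "(a, b) \<in> eqcl (graph_on D q)"
proof -
  obtain n0 where "0 < n0 \<and> (p ^^ n0) b = b" using funpow_return[OF fin bij ab(2)] by metis
  define m where "m = (LEAST m. 0 < m \<and> (p ^^ m) b = b)"
  have m: "0 < m" "(p ^^ m) b = b"
    unfolding m_def using LeastI[of "\<lambda>m. 0 < m \<and> (p ^^ m) b = b", OF \<open>0 < n0 \<and> (p ^^ n0) b = b\<close>]
    by auto
  have least: "(p ^^ j) b \<noteq> b" if "0 < j" "j < m" for j
    using that not_less_Least unfolding m_def by blast
  have na: "(p ^^ j) b \<noteq> a" for j
    using assms funpow_eqcl[OF bij ab(2), of j] eqcl_sym by metis
  have "(q ^^ Suc j) a = (p ^^ Suc j) b" if "Suc j \<le> m" for j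
    using that
  proof (induction j)
    case 0
    then show ?case using q[OF ab(1)] by simp
  next
    case (Suc j)
    have "(p ^^ Suc j) b \<in> D" using funpow_mem[OF bij ab(2)] .
    moreover have "(p ^^ Suc j) b \<noteq> b" using least[of "Suc j"] Suc.prems by linarith
    ultimately have "q ((p ^^ Suc j) b) = p ((p ^^ Suc j) b)" using q na[of "Suc j"] by simp
    then show ?case using Suc by simp
  qed
  from this[of "m - 1"] have "(q ^^ m) a = b" using m by simp
  then show ?thesis using funpow_eqcl[OF mult_transpose_bij ab(1)] by metis
qed

lemma mult_transpose_eqcl: "graph_on D q \<subseteq> eqcl (insert (a, b) (graph_on D p))"
proof
  fix z assume "z \<in> graph_on D q"
  then obtain x where x: "z = (x, q x)" "x \<in> D" by (auto simp: graph_on_def)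
  let ?T = "insert (a, b) (graph_on D p)"
  have t: "transpose a b x \<in> D" using x ab by (simp add: transpose_def)
  have "(x, transpose a b x) \<in> eqcl ?T"
  proof (cases "x = a \<or> x = b")
    case True
    then show ?thesis using eqcl_base[of a b ?T] eqcl_sym[of a b ?T] by auto
  qed simp
  moreover have "(transpose a b x, q x) \<in> eqcl ?T"
    using t q[OF x(2)] by (intro eqcl_base) (auto simp: graph_on_iff)
  ultimately show "z \<in> eqcl ?T" unfolding x by (rule eqcl_trans)
qed

lemma mult_transpose_split:
  assumes "(a, b) \<in> eqcl (graph_on D p)"
  shows "num_classes D (graph_on D p) + 1 \<le> num_classes D (graph_on D q)"
proof -
  have "insert (a, b) (graph_on D p) \<subseteq> eqcl (graph_on D p)" using assms by auto
  then have "graph_on D q \<subseteq> eqcl (graph_on D p)"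
    using mult_transpose_eqcl eqcl_mono[of "insert (a, b) (graph_on D p)" "graph_on D p"] by auto
  from num_classes_strict_mono[OF fin this ab(1,2) assms mult_transpose_separate[OF assms]]
  show ?thesis by simp
qed

lemma mult_transpose_merge:
  "num_classes D (graph_on D p) \<le> num_classes D (graph_on D q) + 1"
  using num_classes_insert_le[OF fin, of "graph_on D p" a b]
    num_classes_mono[OF fin mult_transpose_eqcl] by linarith

end

section \<open>Planar maps\<close>

abbreviation darts :: "nat list list \<Rightarrow> nat set" where
  "darts fs \<equiv> set (concat fs)"

text \<open>A map is encoded by its darts (oriented edge sides). The lists \<open>fs\<close> are the boundary cycles of the
  faces, \<open>f\<close> is the successor along a face, \<open>e\<close> exchanges the two sides of an edge, and \<open>f \<circ> e\<close>
  turns around the starting vertex of a dart.\<close>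

definition is_map :: "nat list list \<Rightarrow> (nat \<Rightarrow> nat) \<Rightarrow> (nat \<Rightarrow> nat) \<Rightarrow> (nat \<Rightarrow> 'a letter) \<Rightarrow> bool" where
  "is_map fs f e l \<longleftrightarrow> distinct (concat fs) \<and> [] \<notin> set fs \<and>
     (\<forall>u \<in> set fs. map f u = rotate1 u) \<and>
     (\<forall>x \<in> darts fs. e x \<in> darts fs \<and> e x \<noteq> x \<and> e (e x) = x \<and> l (e x) = inv_letter (l x))"

definition vert_rel :: "nat set \<Rightarrow> (nat \<Rightarrow> nat) \<Rightarrow> (nat \<Rightarrow> nat) \<Rightarrow> (nat \<times> nat) set" where
  "vert_rel D f e = graph_on D (\<lambda>x. f (e x))"

definition comp_rel :: "nat set \<Rightarrow> (nat \<Rightarrow> nat) \<Rightarrow> (nat \<Rightarrow> nat) \<Rightarrow> (nat \<times> nat) set" where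
  "comp_rel D f e = graph_on D f \<union> graph_on D e"

text \<open>Twice the inequality \<open>2 C \<le> V - E + F\<close>, with edges counted by their two darts.\<close>

definition is_planar :: "nat list list \<Rightarrow> (nat \<Rightarrow> nat) \<Rightarrow> (nat \<Rightarrow> nat) \<Rightarrow> bool" where
  "is_planar fs f e \<longleftrightarrow>
     4 * num_classes (darts fs) (comp_rel (darts fs) f e) + card (darts fs) \<le>
     2 * num_classes (darts fs) (vert_rel (darts fs) f e) + 2 * length fs"

text \<open>Diagrams are seen only through their face labels. The head of the list will be the outer
  face: a diagram with boundary \<open>w\<close> and cells \<open>rs\<close> is
  \<open>planar_words (w # rs)\<close>.\<close>

definition planar_words :: "'a word list \<Rightarrow> bool" where
  "planar_words ws \<longleftrightarrow>
     (\<exists>fs f e l. is_map fs f e l \<and> is_planar fs f e \<and> ws = map (map l) fs)"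

section \<open>Face cycles, and rearranging the faces of a map\<close>

lemma is_map_face: "is_map fs f e l \<Longrightarrow> u \<in> set fs \<Longrightarrow> map f u = rotate1 u"
  by (simp add: is_map_def)

lemma is_map_e:
  assumes "is_map fs f e l" "x \<in> darts fs"
  shows "e x \<in> darts fs" "e x \<noteq> x" "e (e x) = x" "l (e x) = inv_letter (l x)"
  using assms by (auto simp: is_map_def simp del: set_concat)

lemma cycle_nth:
  assumes "map f w = rotate1 w" "i < length w"
  shows "w ! i = (f ^^ i) (hd w)"
  using assms(2)
proof (induction i)
  case (Suc i)
  have "w ! Suc i = rotate1 w ! i" using Suc.prems by (simp add: nth_rotate1)
  also have "\<dots> = f (w ! i)" using Suc.prems assms(1) by (metis Suc_lessD nth_map)
  finally show ?case using Suc by simp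
qed (auto simp: hd_conv_nth)

lemma is_map_image:
  assumes "is_map fs f e l" "u \<in> set fs"
  shows "f ` set u = set u"
  using is_map_face[OF assms] by (metis list.set_map set_rotate1)

lemma is_map_f_mem:
  assumes "is_map fs f e l" "x \<in> darts fs"
  shows "f x \<in> darts fs"
  using assms is_map_image[OF assms(1)] by auto

lemma is_map_bij_f:
  assumes "is_map fs f e l"
  shows "bij_betw f (darts fs) (darts fs)"
proof -
  have "f ` darts fs = darts fs"
    using is_map_image[OF assms] by (auto simp: image_UN image_Union)
  then show ?thesis
    by (simp add: bij_betw_def finite_surj_inj eq_card_imp_inj_on)
qed

lemma is_map_bij_e:
  assumes "is_map fs f e l"
  shows "bij_betw e (darts fs) (darts fs)"
  using is_map_e[OF assms] by (intro bij_betwI[of _ _ _ e]) auto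

lemma is_map_bij_v:
  assumes "is_map fs f e l"
  shows "bij_betw (\<lambda>x. f (e x)) (darts fs) (darts fs)"
  using bij_betw_trans[OF is_map_bij_e[OF assms] is_map_bij_f[OF assms]] by (simp add: o_def)

lemma is_map_regroup:
  assumes "is_map fs f e l" and "mset (concat fs') = mset (concat fs)" and "[] \<notin> set fs'"
    and "\<And>u. u \<in> set fs' \<Longrightarrow> map f u = rotate1 u"
  shows "is_map fs' f e l" "darts fs' = darts fs"
proof -
  show "darts fs' = darts fs" using assms(2) by (metis set_mset_mset)
  moreover have "distinct (concat fs')"
    using assms(1,2) mset_eq_imp_distinct_iff unfolding is_map_def by blast
  ultimately show "is_map fs' f e l"
    using assms(1,3,4) by (simp add: is_map_def)
qed

lemma is_planar_regroup:
  "is_planar fs f e \<Longrightarrow> darts fs' = darts fs \<Longrightarrow> length fs' = length fs \<Longrightarrow> is_planar fs' f e"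
  by (simp add: is_planar_def)

lemma mset_map_eqE:
  assumes "mset ws' = image_mset g (mset fs)"
  obtains fs' where "mset fs' = mset fs" "ws' = map g fs'"
  using assms
proof (induction ws' arbitrary: fs thesis)
  case (Cons w ws)
  have "w \<in> g ` set fs" using Cons.prems(2) by (metis list.set_intros(1) set_image_mset set_mset_mset)
  then obtain u where u: "u \<in> set fs" "w = g u" by auto
  then obtain A B where AB: "fs = A @ u # B" by (meson split_list)
  have "mset ws = image_mset g (mset (A @ B))" using Cons.prems(2) u AB by simp
  then obtain fs' where "mset fs' = mset (A @ B)" "ws = map g fs'" using Cons.IH by metis
  then show ?case using Cons.prems(1)[of "u # fs'"] u AB by simp
qed simp

lemma mset_concat_sum_mset: "mset (concat xss) = sum_mset (image_mset mset (mset xss))"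
  by (simp add: mset_concat flip: sum_mset_sum_list mset_map)

lemma planar_words_mset:
  assumes "planar_words ws" and "mset ws' = mset ws"
  shows "planar_words ws'"
proof -
  obtain fs f e l where *: "is_map fs f e l" "is_planar fs f e" "ws = map (map l) fs"
    using assms(1) by (auto simp: planar_words_def)
  obtain fs' where fs': "mset fs' = mset fs" "ws' = map (map l) fs'"
    using mset_map_eqE[of ws' "map l" fs] assms(2) *(3) by auto
  have s: "set fs' = set fs" using fs' by (metis set_mset_mset)
  have "mset (concat fs') = mset (concat fs)" using fs' by (simp add: mset_concat_sum_mset)
  then have "is_map fs' f e l" "darts fs' = darts fs"
    using is_map_regroup[OF *(1), of fs'] *(1) s by (auto simp: is_map_def simp del: set_concat)
  then show ?thesis
    unfolding planar_words_def using is_planar_regroup[OF *(2)] fs' mset_eq_length by metis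
qed

lemma planar_words_rotate1:
  assumes "planar_words (w # ws)"
  shows "planar_words (rotate1 w # ws)"
proof -
  obtain fs0 f e l where *: "is_map fs0 f e l" "is_planar fs0 f e" "w # ws = map (map l) fs0"
    using assms by (auto simp: planar_words_def)
  then obtain u fs where fs0: "fs0 = u # fs" "w = map l u" "ws = map (map l) fs" by auto
  have "is_map (rotate1 u # fs) f e l" "darts (rotate1 u # fs) = darts fs0"
  proof -
    have m: "mset (concat (rotate1 u # fs)) = mset (concat fs0)" using fs0 by (cases u) auto
    have n: "[] \<notin> set (rotate1 u # fs)" using * fs0 by (auto simp: is_map_def)
    have "map f u = rotate1 u" using * fs0 by (auto simp: is_map_def)
    then have "map f x = rotate1 x" if "x \<in> set (rotate1 u # fs)" for x
      using that * fs0 by (auto simp: is_map_def simp flip: rotate1_map)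
    from is_map_regroup[OF *(1) m n this]
    show "is_map (rotate1 u # fs) f e l" "darts (rotate1 u # fs) = darts fs0" by auto
  qed
  moreover from this have "is_planar (rotate1 u # fs) f e"
    using is_planar_regroup[OF *(2)] fs0 by (metis length_Cons)
  ultimately show ?thesis
    unfolding planar_words_def
    by (intro exI[of _ "rotate1 u # fs"] exI[of _ f] exI[of _ e] exI[of _ l]) (simp add: fs0 rotate1_map)
qed

lemma planar_words_rotate: "planar_words (w # ws) \<Longrightarrow> planar_words (rotate n w # ws)"
  by (induction n) (auto intro: planar_words_rotate1)

lemma planar_words_swap_append:
  assumes "planar_words ((u @ v) # ws)"
  shows "planar_words ((v @ u) # ws)"
  using planar_words_rotate[OF assms, of "length u"] by (simp add: rotate_append)

text \<open>Exchanging the images of the last darts of \<open>u\<close> and \<open>v\<close> makes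
  each of them return to the head of its own list. Read forwards this cuts a face, read backwards it
  joins two.\<close>

lemma map_rotate1_append:
  assumes "u \<noteq> []" "v \<noteq> []" and "distinct (u @ v)"
  shows "map f (u @ v) = rotate1 (u @ v) \<longleftrightarrow>
    map (f \<circ> transpose (last u) (last v)) u = rotate1 u \<and>
    map (f \<circ> transpose (last u) (last v)) v = rotate1 v"
proof -
  obtain u0 a where u: "u = u0 @ [a]" using assms(1) by (metis rev_exhaust)
  obtain v0 b where v: "v = v0 @ [b]" using assms(2) by (metis rev_exhaust)
  define g where "g = f \<circ> transpose a b"
  have g: "map g u0 = map f u0" "map g v0 = map f v0" "g a = f b" "g b = f a"
    using assms(3) unfolding u v g_def by (auto simp: transpose_def)
  have r: "rotate1 w = tl w @ [hd w]" if "w \<noteq> []" for w :: "'x list"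
    using that by (cases w) auto
  have "map f (u @ v) = rotate1 (u @ v) \<longleftrightarrow>
      map f u0 @ (([f a] @ map f v0) @ [f b]) = tl (u0 @ [a]) @ ((v0 @ [b]) @ [hd (u0 @ [a])])"
    by (cases u0) (simp_all add: u v)
  also have "\<dots> \<longleftrightarrow> map f u0 = tl (u0 @ [a]) \<and> [f a] @ map f v0 = v0 @ [b] \<and> f b = hd (u0 @ [a])"
  proof -
    have len: "length (map f u0) = length (tl (u0 @ [a]))" by simp
    show ?thesis
      using append_eq_append_conv[OF disjI1[OF len], of "([f a] @ map f v0) @ [f b]" "(v0 @ [b]) @ [hd (u0 @ [a])]"]
      by (simp only: append1_eq_conv)
  qed
  also have "[f a] @ map f v0 = v0 @ [b] \<longleftrightarrow> f a = hd (v0 @ [b]) \<and> map f v0 = tl (v0 @ [b])"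
    by (cases v0) auto
  also have "map f u0 = tl (u0 @ [a]) \<and> (f a = hd (v0 @ [b]) \<and> map f v0 = tl (v0 @ [b])) \<and> f b = hd (u0 @ [a])
    \<longleftrightarrow> map g u = rotate1 u \<and> map g v = rotate1 v"
    using r[of u] r[of v] g by (auto simp: u v simp del: map_eq_conv)
  finally show ?thesis by (simp add: g_def u v)
qed

lemma is_map_cut:
  assumes m: "is_map ((u @ v) # fs) f e l" and ne: "u \<noteq> []" "v \<noteq> []"
  shows "is_map (u # v # fs) (f \<circ> transpose (last u) (last v)) e l"
proof -
  have d: "distinct (u @ v)" and "set u \<inter> darts fs = {}" "set v \<inter> darts fs = {}"
    using m by (auto simp: is_map_def simp del: set_concat)
  then have ab: "last u \<notin> darts fs" "last v \<notin> darts fs"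
    using last_in_set[OF ne(1)] last_in_set[OF ne(2)] by blast+
  have "map (f \<circ> transpose (last u) (last v)) w = map f w" if "w \<in> set fs" for w
    using that ab by (auto simp: transpose_def)
  then show ?thesis
    using m map_rotate1_append[OF ne d, of f] ne
    by (auto simp: is_map_def simp del: set_concat map_append map_map map_eq_conv)
qed

lemma is_map_join:
  assumes m: "is_map (u # v # fs) f e l" and ne: "u \<noteq> []" "v \<noteq> []"
  shows "is_map ((u @ v) # fs) (f \<circ> transpose (last u) (last v)) e l"
proof -
  let ?f = "f \<circ> transpose (last u) (last v)"
  have d: "distinct (u @ v)" and "set u \<inter> darts fs = {}" "set v \<inter> darts fs = {}"
    using m by (auto simp: is_map_def simp del: set_concat)
  then have ab: "last u \<notin> darts fs" "last v \<notin> darts fs"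
    using last_in_set[OF ne(1)] last_in_set[OF ne(2)] by blast+
  have "map ?f w = map f w" if "w \<in> set fs" for w
    using that ab by (auto simp: transpose_def)
  moreover have "?f \<circ> transpose (last u) (last v) = f" by (simp add: comp_assoc)
  ultimately show ?thesis
    using m map_rotate1_append[OF ne d, of ?f] ne
    by (auto simp: is_map_def simp del: set_concat map_append map_map map_eq_conv)
qed

text \<open>Multiplying \<open>f\<close> by a transposition changes the numbers of faces and of vertices by one each.
  The number of components can only grow when a face and a vertex are split simultaneously.\<close>

lemma transpose_classes:
  assumes m: "is_map fs f e l" and ab: "a \<in> darts fs" "b \<in> darts fs" "a \<noteq> b"
  defines "D \<equiv> darts fs" and "f' \<equiv> f \<circ> transpose a b"
  shows "(e a, e b) \<in> eqcl (vert_rel D f e) \<Longrightarrow>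
      num_classes D (vert_rel D f e) + 1 \<le> num_classes D (vert_rel D f' e)"
    and "num_classes D (vert_rel D f e) \<le> num_classes D (vert_rel D f' e) + 1"
    and "num_classes D (comp_rel D f' e) \<le> num_classes D (comp_rel D f e) + 1"
    and "(e a, e b) \<notin> eqcl (vert_rel D f e) \<or> (a, b) \<in> eqcl (comp_rel D f' e) \<Longrightarrow>
      num_classes D (comp_rel D f' e) \<le> num_classes D (comp_rel D f e)"
proof -
  note em = is_map_e[OF m]
  have finD: "finite D" by (simp add: D_def)
  have bijv: "bij_betw (\<lambda>x. f (e x)) D D" using is_map_bij_v[OF m] by (simp add: D_def)
  have eab: "e a \<in> D" "e b \<in> D" "e a \<noteq> e b"
    using em ab unfolding D_def by metis+
  \<comment> \<open>Moved past \<open>e\<close>, the transposition of \<open>a\<close> and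
    \<open>b\<close> becomes that of \<open>e a\<close> and \<open>e b\<close>. So the vertex
    permutation also changes by a transposition only.\<close>
  have q: "f' (e x) = f (e (transpose (e a) (e b) x))" if "x \<in> D" for x
    using em(3)[OF ab(1)] em(3)[OF ab(2)] em(3)[OF that[unfolded D_def]]
    unfolding f'_def transpose_def by auto
  show "num_classes D (vert_rel D f e) + 1 \<le> num_classes D (vert_rel D f' e)"
    if "(e a, e b) \<in> eqcl (vert_rel D f e)"
    using mult_transpose_split[OF finD bijv eab q] that by (simp add: vert_rel_def)
  show "num_classes D (vert_rel D f e) \<le> num_classes D (vert_rel D f' e) + 1"
    using mult_transpose_merge[OF finD bijv eab q] by (simp add: vert_rel_def)
  have bijf: "bij_betw f D D" using is_map_bij_f[OF m] by (simp add: D_def)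
  have ff': "f x = f' (transpose a b x)" for x by (simp add: f'_def)
  have bijf': "bij_betw f' D D"
    using mult_transpose_bij[OF finD bijf _ _ _ ] ab unfolding D_def f'_def by auto
  have "graph_on D f \<subseteq> eqcl (insert (a, b) (graph_on D f'))"
    by (rule mult_transpose_eqcl[OF finD bijf' ab[folded D_def] ff'])
  then have sub: "comp_rel D f e \<subseteq> eqcl (insert (a, b) (comp_rel D f' e))"
    unfolding comp_rel_def by (auto intro: eqcl_mono[rotated])
  show "num_classes D (comp_rel D f' e) \<le> num_classes D (comp_rel D f e) + 1"
    using num_classes_insert_le[OF finD, of "comp_rel D f' e" a b] num_classes_mono[OF finD sub]
    by linarith
  assume or: "(e a, e b) \<notin> eqcl (vert_rel D f e) \<or> (a, b) \<in> eqcl (comp_rel D f' e)"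
  have e_step: "(x, e x) \<in> eqcl (comp_rel D f' e)" if "x \<in> D" for x
    using that by (auto simp: comp_rel_def graph_on_def)
  have "(a, b) \<in> eqcl (comp_rel D f' e)"
    using or
  proof
    \<comment> \<open>Two different vertices are merged here, and the common vertex keeps
      \<open>e a\<close> and \<open>e b\<close>, hence also \<open>a\<close> and \<open>b\<close>,
      in one component.\<close>
    assume "(e a, e b) \<notin> eqcl (vert_rel D f e)"
    then have "(e a, e b) \<in> eqcl (vert_rel D f' e)"
      using mult_transpose_join[OF finD bijv eab q] by (simp add: vert_rel_def)
    moreover have "vert_rel D f' e \<subseteq> eqcl (comp_rel D f' e)"
    proof -
      have "(x, f' (e x)) \<in> eqcl (comp_rel D f' e)" if "x \<in> D" for x
      proof -
        have "(e x, f' (e x)) \<in> eqcl (comp_rel D f' e)"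
          using em(1)[of x] that unfolding D_def comp_rel_def graph_on_def by blast
        then show ?thesis using e_step[OF that] eqcl_trans by metis
      qed
      then show ?thesis by (auto simp: vert_rel_def graph_on_def)
    qed
    ultimately have "(e a, e b) \<in> eqcl (comp_rel D f' e)" using eqcl_mono by metis
    then have "(a, e b) \<in> eqcl (comp_rel D f' e)"
      using e_step[of a] ab(1) eqcl_trans unfolding D_def by metis
    moreover have "(e b, b) \<in> eqcl (comp_rel D f' e)"
      using e_step[of b] ab(2) eqcl_sym unfolding D_def by metis
    ultimately show ?thesis by (rule eqcl_trans)
  qed
  then have ins: "insert (a, b) (comp_rel D f' e) \<subseteq> eqcl (comp_rel D f' e)"
    by auto
  have "comp_rel D f e \<subseteq> eqcl (comp_rel D f' e)"
    using sub eqcl_mono[OF ins] by (meson subrelI subsetD)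
  from num_classes_mono[OF finD this]
  show "num_classes D (comp_rel D f' e) \<le> num_classes D (comp_rel D f e)" .
qed

text \<open>The number of faces grows by one. Either a vertex splits as well, and together they pay
  for one new component; or at worst two vertices merge, and then no component is added.\<close>

lemma is_planar_cut:
  assumes m: "is_map ((u @ v) # fs) f e l" and ne: "u \<noteq> []" "v \<noteq> []"
    and p: "is_planar ((u @ v) # fs) f e"
  shows "is_planar (u # v # fs) (f \<circ> transpose (last u) (last v)) e"
proof -
  let ?a = "last u" and ?b = "last v"
  have ab: "?a \<in> darts ((u @ v) # fs)" "?b \<in> darts ((u @ v) # fs)" "?a \<noteq> ?b"
  proof -
    have "set u \<inter> set v = {}" using m by (auto simp: is_map_def)
    then show "?a \<noteq> ?b" using last_in_set[OF ne(1)] last_in_set[OF ne(2)] by auto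
  qed (use last_in_set[OF ne(1)] last_in_set[OF ne(2)] in auto)
  have D: "darts (u # v # fs) = darts ((u @ v) # fs)" by auto
  show ?thesis
    using transpose_classes[OF m ab] p unfolding is_planar_def D
    by (cases "(e ?a, e ?b) \<in> eqcl (vert_rel (darts ((u @ v) # fs)) f e)") (simp_all del: set_concat)
qed

lemma planar_words_cut:
  assumes "planar_words ((u @ v) # ws)" and "u \<noteq> []" "v \<noteq> []"
  shows "planar_words (u # v # ws)"
proof -
  obtain fs0 f e l where *: "is_map fs0 f e l" "is_planar fs0 f e" "(u @ v) # ws = map (map l) fs0"
    using assms(1) by (auto simp: planar_words_def)
  then obtain x y fs where fs0: "fs0 = (x @ y) # fs" "u = map l x" "v = map l y" "ws = map (map l) fs"
    by (auto simp: Cons_eq_map_conv append_eq_map_conv)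
  then have ne: "x \<noteq> []" "y \<noteq> []" using assms by auto
  show ?thesis
    unfolding planar_words_def
    using is_map_cut[OF *(1)[unfolded fs0(1)] ne] is_planar_cut[OF *(1)[unfolded fs0(1)] ne *(2)[unfolded fs0(1)]]
    by (intro exI conjI) (assumption+, simp add: fs0)
qed

text \<open>The two faces lie on both sides of the edge of \<open>x\<close> and are merged at its
  starting vertex, which leaves this edge as a spike. The vertex splits and so makes up for the lost
  face.\<close>

lemma planar_words_join:
  assumes m: "is_map ((x # u) # (v @ [e x]) # fs) f e l"
    and p: "is_planar ((x # u) # (v @ [e x]) # fs) f e"
  shows "planar_words ((map l (x # u @ v) @ [inv_letter (l x)]) # map (map l) fs)"
proof -
  let ?fs = "(x # u) # (v @ [e x]) # fs" and ?fs' = "((x # u) @ (v @ [e x])) # fs"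
  let ?a = "last (x # u)" and ?b = "e x"
  let ?f = "f \<circ> transpose ?a ?b"
  have m': "is_map ?fs' ?f e l"
    using is_map_join[OF m] by simp
  have D: "darts ?fs' = darts ?fs" by auto
  have ab: "?a \<in> darts ?fs" "?b \<in> darts ?fs" "?a \<noteq> ?b"
    using m last_in_set[of "x # u"] by (auto simp: is_map_def)
  have fa: "f ?a = x"
  proof -
    have "map f (x # u) = rotate1 (x # u)" using m by (auto simp: is_map_def)
    then have "last (map f (x # u)) = x" by simp
    then show ?thesis by (metis last_map list.distinct(1))
  qed
  have "(e ?a, e ?b) \<in> vert_rel (darts ?fs) f e"
    using fa is_map_e[OF m ab(1)] is_map_e[OF m, of x] by (auto simp: vert_rel_def graph_on_iff)
  then have 1: "(e ?a, e ?b) \<in> eqcl (vert_rel (darts ?fs) f e)" by auto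
  have "?f ?b = x" using fa by simp
  then have x: "x = ?f ?b" by simp
  \<comment> \<open>Both darts lie on the merged face, which is a single cycle of \<open>?f\<close>;
    hence no component can be added.\<close>
  have abc: "(?a, ?b) \<in> eqcl (comp_rel (darts ?fs) ?f e)"
  proof -
    let ?w = "x # u @ v @ [e x]"
    have r: "map ?f ?w = rotate1 ?w" using is_map_face[OF m', of ?w] by simp
    have xx: "\<exists>n. z = (?f ^^ n) x" if "z \<in> set ?w" for z
      using that cycle_nth[OF r] by (metis in_set_conv_nth list.sel(1))
    have cl: "(x, (?f ^^ n) x) \<in> eqcl (comp_rel (darts ?fs) ?f e)" for n
    proof -
      have "(x, (?f ^^ n) x) \<in> eqcl (graph_on (darts ?fs) ?f)"
        using funpow_eqcl[OF is_map_bij_f[OF m'], of x n] unfolding D by simp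
      moreover have "graph_on (darts ?fs) ?f \<subseteq> eqcl (comp_rel (darts ?fs) ?f e)"
        by (auto simp: comp_rel_def simp del: set_concat)
      ultimately show ?thesis using eqcl_mono by metis
    qed
    obtain i where i: "?a = (?f ^^ i) x" using xx[of ?a] last_in_set[of "x # u"] by fastforce
    obtain j where j: "?b = (?f ^^ j) x" using xx[of ?b] by auto
    have "(x, ?a) \<in> eqcl (comp_rel (darts ?fs) ?f e)" using cl[of i] i by argo
    moreover have "(x, ?b) \<in> eqcl (comp_rel (darts ?fs) ?f e)" using cl[of j] j by argo
    ultimately show ?thesis using eqcl_sym eqcl_trans by metis
  qed
  have "is_planar ?fs' ?f e"
    using transpose_classes(1)[OF m ab 1] transpose_classes(4)[OF m ab disjI2[OF abc]] p
    unfolding is_planar_def D by (simp del: set_concat)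
  moreover have "l (e x) = inv_letter (l x)" using is_map_e[OF m, of x] by simp
  ultimately show ?thesis
    unfolding planar_words_def using m' by (intro exI[of _ ?fs'] exI[of _ ?f] exI[of _ e] exI[of _ l]) simp
qed

section \<open>Flattening bigons and growing spikes\<close>

lemma eqcl_step2: "(x, y) \<in> S \<Longrightarrow> (y, z) \<in> S \<Longrightarrow> (x, z) \<in> eqcl S"
  by (meson eqcl_base eqcl_trans)

text \<open>The two sides of the bigon are identified with each other. This is the elementary fold
  to which all reductions of diagrams come down.\<close>

lemma planar_words_bigon:
  assumes "planar_words ([a, inv_letter a] # ws)"
  shows "planar_words ws"
proof -
  obtain fs0 f e l where *: "is_map fs0 f e l" "is_planar fs0 f e" "[a, inv_letter a] # ws = map (map l) fs0"
    using assms(1) by (auto simp: planar_words_def)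
  then obtain x y fs where fs0: "fs0 = [x, y] # fs" "a = l x" "inv_letter a = l y" "ws = map (map l) fs"
    by (auto simp: Cons_eq_map_conv)
  note m = *(1)[unfolded fs0(1)]
  define D where "D = darts fs"
  have D0: "darts fs0 = insert x (insert y D)" by (auto simp: D_def fs0)
  have xy: "x \<noteq> y" "x \<notin> D" "y \<notin> D" using m by (auto simp: is_map_def D_def)
  have fin: "finite D" by (simp add: D_def)
  have f: "f x = y" "f y = x" using is_map_face[OF m, of "[x, y]"] by auto
  have fD: "f z \<in> D" if "z \<in> D" for z
  proof -
    have "z \<in> darts fs" using that by (simp add: D_def)
    then obtain v where "v \<in> set fs" "z \<in> set v" by auto
    then show ?thesis using is_map_image[OF m, of v] by (auto simp: D_def)
  qed
  note em = is_map_e[OF *(1), unfolded D0]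
  show ?thesis
  proof (cases "y = e x")
    \<comment> \<open>The bigon is a component of its own, with one face, two darts and two
      vertices. It contributes 6 to either side of the inequality.\<close>
    case True
    then have ey: "e y = x" using em(3)[of x] by auto
    have eD: "e z \<in> D" if "z \<in> D" for z
      using em(1,3)[of z] that xy(2,3) ey True by (metis insertE insertI2)
    have "is_map fs f e l"
      using m eD unfolding is_map_def D_def by auto
    moreover have "is_planar fs f e"
    proof -
      let ?S = "vert_rel (insert x (insert y D)) f e"
      have v: "f (e x) = x" "f (e y) = y" using f True ey by auto
      have "\<And>z. (x, z) \<in> ?S \<or> (z, x) \<in> ?S \<Longrightarrow> z = x" "\<And>z. (y, z) \<in> ?S \<or> (z, y) \<in> ?S \<Longrightarrow> z = y"
        using v xy eD fD by (auto simp: vert_rel_def graph_on_iff)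
      then have "num_classes (insert x (insert y D)) ?S = num_classes D ?S + 2"
        using num_classes_insert_isolated[of "insert y D" x ?S] num_classes_insert_isolated[of D y ?S] xy fin
        by simp
      also have "num_classes D ?S \<le> num_classes D (vert_rel D f e)"
        by (rule num_classes_mono[OF fin]) (auto simp: vert_rel_def graph_on_def)
      finally have V: "num_classes (insert x (insert y D)) ?S \<le> num_classes D (vert_rel D f e) + 2"
        by simp
      let ?C = "comp_rel (insert x (insert y D)) f e" and ?C' = "comp_rel D f e"
      have "num_classes (insert x (insert y D)) ?C = num_classes (insert y D) ?C'"
      proof (rule num_classes_retract[where \<rho> = "\<lambda>d. if d = x then y else d"])
        show "(d, if d = x then y else d) \<in> eqcl ?C" for d
          using f by (auto simp: comp_rel_def graph_on_def)
        show "?C' \<subseteq> eqcl ?C" by (auto simp: comp_rel_def graph_on_def)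
        show "(if a = x then y else a, if b = x then y else b) \<in> eqcl ?C'" if "(a, b) \<in> ?C" for a b
          using that f True ey xy fD eD by (auto simp: comp_rel_def graph_on_def)
      qed (use xy in auto)
      also have "\<dots> = num_classes D ?C' + 1"
        using xy fD eD by (intro num_classes_insert_isolated fin) (auto simp: comp_rel_def graph_on_def)
      finally have C: "num_classes (insert x (insert y D)) ?C = num_classes D ?C' + 1" .
      show ?thesis
        using *(2) V C xy fin unfolding is_planar_def D0 D_def[symmetric] by (simp add: fs0(1))
    qed
    ultimately show ?thesis unfolding planar_words_def fs0(4) by blast
  next
    case False
    \<comment> \<open>The darts across the two sides of the bigon become partners of each
      other.\<close>
    define e' where "e' = e(e x := e y, e y := e x)"
    have exy: "e x \<in> D" "e y \<in> D" "e x \<noteq> e y"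
      using em(1-3)[of x] em(1-3)[of y] False xy by auto
    have inj: "e z \<noteq> e w" if "z \<noteq> w" "z \<in> insert x (insert y D)" "w \<in> insert x (insert y D)" for z w
      using that em(3) by metis
    have eD: "e z \<in> D" if "z \<in> D" "z \<noteq> e x" "z \<noteq> e y" for z
      using em(1,3)[of z] that xy by auto
    have "is_map fs f e' l"
    proof -
      have "e' z \<in> D \<and> e' z \<noteq> z \<and> e' (e' z) = z \<and> l (e' z) = inv_letter (l z)" if "z \<in> D" for z
      proof -
        consider "z = e x" | "z = e y" | "z \<noteq> e x" "z \<noteq> e y" by auto
        then show ?thesis
        proof cases
          case 1
          then show ?thesis using exy em(4)[of x] em(4)[of y] fs0 by (auto simp: e'_def)
        next
          case 2
          then show ?thesis using exy em(4)[of x] em(4)[of y] fs0 by (auto simp: e'_def)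
        next
          case 3
          then have "e z \<noteq> e x" "e z \<noteq> e y" using inj[of z x] inj[of z y] xy that by auto
          then show ?thesis using 3 that eD em[of z] by (auto simp: e'_def)
        qed
      qed
      then show ?thesis
        using m unfolding is_map_def D_def by auto
    qed
    moreover have "is_planar fs f e'"
    proof -
      \<comment> \<open>A vanishing dart is represented by a remaining one with the same starting
        vertex: \<open>x\<close> by \<open>e y\<close>, and \<open>y\<close> by \<open>e x\<close>.
        So vertices and components are preserved, while one face and two darts disappear.\<close>
      let ?\<rho> = "\<lambda>d. if d = x then e y else if d = y then e x else d"
      let ?S = "vert_rel (insert x (insert y D)) f e" and ?S' = "vert_rel D f e'"
      let ?C = "comp_rel (insert x (insert y D)) f e" and ?C' = "comp_rel D f e'"
      have v: "f (e (e x)) = y" "f (e (e y)) = x" using f em(3) by auto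
      have S': "(z, f (e z)) \<in> ?S'" if "z \<in> D" "z \<noteq> e x" "z \<noteq> e y" for z
        using that by (auto simp: vert_rel_def graph_on_iff e'_def)
      have S'x: "(e x, f (e y)) \<in> ?S'" "(e y, f (e x)) \<in> ?S'"
        using exy by (auto simp: vert_rel_def graph_on_iff e'_def)
      have S: "(z, f (e z)) \<in> ?S" if "z \<in> insert x (insert y D)" for z
        using that by (auto simp: vert_rel_def graph_on_iff)
      have V: "num_classes (insert x (insert y D)) ?S = num_classes D ?S'"
      proof (rule num_classes_retract[where \<rho> = ?\<rho>])
        have "(e y, x) \<in> ?S" "(e x, y) \<in> ?S" using S[of "e y"] S[of "e x"] v exy by auto
        then have 1: "(x, e y) \<in> eqcl ?S" "(y, e x) \<in> eqcl ?S" by (auto intro: eqcl_sym)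
        then show "(d, ?\<rho> d) \<in> eqcl ?S" for d by auto
        show "?S' \<subseteq> eqcl ?S"
        proof
          fix p assume "p \<in> ?S'"
          then obtain z where z: "z \<in> D" "p = (z, f (e' z))" by (auto simp: vert_rel_def graph_on_def)
          show "p \<in> eqcl ?S"
            using z 1 S[of z] S[of x] S[of y] eqcl_trans[OF eqcl_sym[OF 1(1)] eqcl_base[OF S[of x]]]
              eqcl_trans[OF eqcl_sym[OF 1(2)] eqcl_base[OF S[of y]]]
            by (auto simp: e'_def)
        qed
        show "(?\<rho> a, ?\<rho> b) \<in> eqcl ?S'" if "(a, b) \<in> ?S" for a b
        proof -
          have ab: "a \<in> insert x (insert y D)" "b = f (e a)" using that by (auto simp: vert_rel_def graph_on_iff)
          have fe: "f (e x) \<in> D" "f (e y) \<in> D" using exy fD by auto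
          consider "a = x" | "a = y" | "a = e x" | "a = e y" | "a \<in> D" "a \<noteq> e x" "a \<noteq> e y" using ab by auto
          then show ?thesis
          proof cases
            case 5
            then have "b \<in> D" using ab eD fD by auto
            then show ?thesis using 5 S'[of a] ab xy by auto
          qed (use ab v exy S'x fe xy in auto)
        qed
      qed (use xy exy in auto)
      have C: "num_classes (insert x (insert y D)) ?C = num_classes D ?C'"
      proof (rule num_classes_retract[where \<rho> = ?\<rho>])
        have "(x, y) \<in> ?C" "(y, e y) \<in> ?C" "(y, x) \<in> ?C" "(x, e x) \<in> ?C"
          using f by (auto simp: comp_rel_def graph_on_def)
        then have 1: "(x, e y) \<in> eqcl ?C" "(y, e x) \<in> eqcl ?C" "(x, y) \<in> eqcl ?C" by (auto intro: eqcl_step2)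
        then show "(d, ?\<rho> d) \<in> eqcl ?C" for d by auto
        have 2: "(e x, e y) \<in> eqcl ?C" "(e y, e x) \<in> eqcl ?C"
          using 1 eqcl_sym eqcl_trans by metis+
        show "?C' \<subseteq> eqcl ?C"
          using 2 by (auto simp: comp_rel_def graph_on_def e'_def)
        have c: "(e x, e y) \<in> eqcl ?C'" "(e y, e x) \<in> eqcl ?C'"
          using exy by (auto simp: comp_rel_def graph_on_iff e'_def)
        have ce: "(z, e z) \<in> eqcl ?C'" if "z \<in> D" "z \<noteq> e x" "z \<noteq> e y" for z
          using that by (intro eqcl_base) (auto simp: comp_rel_def graph_on_iff e'_def)
        have cf: "(z, f z) \<in> eqcl ?C'" if "z \<in> D" for z
          using that by (intro eqcl_base) (auto simp: comp_rel_def graph_on_iff)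
        show "(?\<rho> a, ?\<rho> b) \<in> eqcl ?C'" if ab: "(a, b) \<in> ?C" for a b
        proof -
          have "a \<in> insert x (insert y D)" "b = f a \<or> b = e a"
            using ab by (auto simp: comp_rel_def graph_on_iff)
          then consider "a = x" "b = y \<or> b = e x" | "a = y" "b = x \<or> b = e y" | "a \<in> D" "b = f a"
            | "a = e x" "b = x" | "a = e y" "b = y" | "a \<in> D" "a \<noteq> e x" "a \<noteq> e y" "b = e a"
            using f em(3)[of x] em(3)[of y] by fastforce
          then show ?thesis
          proof cases
            case 3
            then show ?thesis using cf[of a] fD[of a] xy by auto
          next
            case 6
            then show ?thesis using ce[of a] eD[of a] xy by auto
          qed (use xy exy c in auto)
        qed
      qed (use xy exy in auto)
      show ?thesis
        using *(2) V C xy fin unfolding is_planar_def D0 D_def[symmetric] by (simp add: fs0(1))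
    qed
    ultimately show ?thesis unfolding planar_words_def fs0(4) by blast
  qed
qed

text \<open>A new edge with darts \<open>x\<close> and \<open>y\<close> is attached at the starting
  vertex of \<open>hd u\<close>. Its free end, where \<open>y\<close> starts, is the only new vertex
  and balances the two new darts.\<close>

lemma planar_words_spike:
  assumes "planar_words (w # ws)"
  shows "planar_words ((a # inv_letter a # w) # ws)"
proof -
  obtain fs0 f e l where *: "is_map fs0 f e l" "is_planar fs0 f e" "w # ws = map (map l) fs0"
    using assms(1) by (auto simp: planar_words_def)
  then obtain u fs where fs0: "fs0 = u # fs" "w = map l u" "ws = map (map l) fs"
    by (auto simp: Cons_eq_map_conv)
  note m = *(1)[unfolded fs0(1)]
  define D where "D = darts (u # fs)"
  have fin: "finite D" by (simp add: D_def)
  obtain x where x: "x \<notin> D" using fin ex_new_if_finite infinite_UNIV_nat by metis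
  obtain y where y: "y \<notin> insert x D" using fin ex_new_if_finite infinite_UNIV_nat by (metis finite_insert)
  have "u \<noteq> []" using m by (auto simp: is_map_def)
  then obtain u0 b where u: "u = u0 @ [b]" by (metis rev_exhaust)
  have bD: "b \<in> D" "hd u \<in> D" using hd_in_set[OF \<open>u \<noteq> []\<close>] by (auto simp: D_def u)
  have xy: "x \<noteq> y" "x \<notin> D" "y \<notin> D" using x y by auto
  define f' where "f' = f(b := x, x := y, y := hd u)"
  define e' where "e' = e(x := y, y := x)"
  define l' where "l' = l(x := a, y := inv_letter a)"
  have fD: "f z \<in> D" if "z \<in> D" for z
    using that is_map_f_mem[OF m] by (simp add: D_def)
  note em = is_map_e[OF m, folded D_def]
  have r: "map f u = tl u @ [hd u]"
    using is_map_face[OF m, of u] \<open>u \<noteq> []\<close> by (cases u) auto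
  have "last (map f u) = hd u" unfolding r by simp
  then have fb: "f b = hd u" by (simp add: u)
  have f': "f' b = x" "f' x = y" "f' y = hd u" using xy bD by (auto simp: f'_def)
  have f'D: "f' z = f z" if "z \<in> D" "z \<noteq> b" for z using that xy by (auto simp: f'_def)
  have e': "e' x = y" "e' y = x" using xy by (auto simp: e'_def)
  have e'D: "e' z = e z" if "z \<in> D" for z using that xy by (auto simp: e'_def)
  have D1: "darts ((x # y # u) # fs) = insert x (insert y D)" by (auto simp: D_def)
  have bfs: "z \<notin> set u" if "z \<in> darts fs" for z using m that by (auto simp: is_map_def)
  have "is_map ((x # y # u) # fs) f' e' l'"
  proof -
    have "map f' u = tl u @ [x]"
    proof -
      have "map f' u0 = map f u0"
        using m xy by (auto simp: is_map_def u D_def f'_def)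
      moreover have "map f u0 = tl u" using r by (simp add: u)
      ultimately show ?thesis using f' by (simp add: u)
    qed
    then have "map f' (x # y # u) = rotate1 (x # y # u)"
      using f' \<open>u \<noteq> []\<close> by simp
    moreover have "map f' v = rotate1 v" if "v \<in> set fs" for v
    proof -
      have "f' z = f z" if "z \<in> set v" for z
        using \<open>v \<in> set fs\<close> that bfs[of z] by (intro f'D) (auto simp: D_def u)
      then have "map f' v = map f v" by simp
      then show ?thesis using that is_map_face[OF m, of v] by simp
    qed
    moreover have "e' z \<in> insert x (insert y D) \<and> e' z \<noteq> z \<and> e' (e' z) = z \<and> l' (e' z) = inv_letter (l' z)"
      if "z \<in> insert x (insert y D)" for z
      using that e' e'D em[of z] xy by (cases "z \<in> D") (auto simp: l'_def)
    ultimately show ?thesis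
      using m xy unfolding is_map_def D1 by (auto simp: D_def simp del: set_concat)
  qed
  moreover have "is_planar ((x # y # u) # fs) f' e'"
  proof -
    let ?S' = "vert_rel (insert x (insert y D)) f' e'" and ?S = "vert_rel D f e"
    let ?C' = "comp_rel (insert x (insert y D)) f' e'" and ?C = "comp_rel D f e"
    have vx: "(x, hd u) \<in> ?S'" using e' f' by (auto simp: vert_rel_def graph_on_iff)
    have vz: "(z, if e z = b then x else f (e z)) \<in> ?S'" if "z \<in> D" for z
      using that e'D f' f'D em by (auto simp: vert_rel_def graph_on_iff)
    have S': "p \<in> ?S' \<longleftrightarrow> p = (x, hd u) \<or> p = (y, y) \<or> (\<exists>z\<in>D. p = (z, if e z = b then x else f (e z)))" for p
    proof -
      have "f' (e' z) = (if e z = b then x else f (e z))" if "z \<in> D" for z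
        using e'D[OF that] f' f'D em(1)[OF that] by simp
      moreover have "f' (e' x) = hd u" "f' (e' y) = y" using e' f' by simp_all
      ultimately show ?thesis
        unfolding vert_rel_def graph_on_def by (cases p) fastforce
    qed
    have "num_classes (insert y (insert x D)) ?S' = num_classes (insert x D) ?S' + 1"
      using fin xy fD em bD by (intro num_classes_insert_isolated) (auto simp: S' split: if_splits)
    also have "num_classes (insert x D) ?S' = num_classes D ?S"
    proof (rule num_classes_retract[where \<rho> = "\<lambda>d. if d = x then hd u else d"])
      show "(d, if d = x then hd u else d) \<in> eqcl ?S'" for d using vx by auto
      show "?S \<subseteq> eqcl ?S'"
      proof
        fix p assume "p \<in> ?S"
        then obtain z where z: "z \<in> D" "p = (z, f (e z))" by (auto simp: vert_rel_def graph_on_def)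
        then show "p \<in> eqcl ?S'" using vz[of z] vx fb eqcl_step2[of z x ?S' "hd u"] by (auto split: if_splits)
      qed
      have S: "(z, f (e z)) \<in> eqcl ?S" if "z \<in> D" for z using that by (auto simp: vert_rel_def graph_on_iff)
      show "(if p = x then hd u else p, if q = x then hd u else q) \<in> eqcl ?S" if "(p, q) \<in> ?S'" for p q
      proof -
        consider "p = x" "q = hd u" | "p = y" "q = y" | "p \<in> D" "q = (if e p = b then x else f (e p))"
          using \<open>(p, q) \<in> ?S'\<close> by (auto simp: S')
        then show ?thesis
        proof cases
          case 3
          then show ?thesis using S[of p] fb fD[of "e p"] em(1)[of p] xy by (auto split: if_splits)
        qed (use xy bD in auto)
      qed
    qed (use bD xy in auto)
    finally have V: "num_classes (insert x (insert y D)) ?S' = num_classes D ?S + 1"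
      by (simp add: insert_commute)
    have C: "num_classes (insert x (insert y D)) ?C' = num_classes D ?C"
    proof (rule num_classes_retract[where \<rho> = "\<lambda>d. if d = x \<or> d = y then hd u else d"])
      have c: "(b, x) \<in> ?C'" "(x, y) \<in> ?C'" "(y, hd u) \<in> ?C'"
        using f' bD by (auto simp: comp_rel_def graph_on_iff)
      then have c2: "(x, hd u) \<in> eqcl ?C'" "(b, hd u) \<in> eqcl ?C'"
        using eqcl_step2 eqcl_trans eqcl_base by metis+
      then show "(d, if d = x \<or> d = y then hd u else d) \<in> eqcl ?C'" for d using c by auto
      have fz: "(z, f z) \<in> eqcl ?C'" if "z \<in> D" for z
        using that c2 fb f'D[OF that] by (cases "z = b") (auto simp: comp_rel_def graph_on_iff)
      have ez: "(z, e z) \<in> eqcl ?C'" if "z \<in> D" for z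
        using that e'D[OF that] by (auto simp: comp_rel_def graph_on_iff)
      show "?C \<subseteq> eqcl ?C'" using fz ez by (auto simp: comp_rel_def graph_on_def)
      have fz: "(z, f z) \<in> eqcl ?C" if "z \<in> D" for z
        using that by (auto simp: comp_rel_def graph_on_iff)
      have ez: "(z, e z) \<in> eqcl ?C" if "z \<in> D" for z
        using that by (auto simp: comp_rel_def graph_on_iff)
      show "(if p = x \<or> p = y then hd u else p, if q = x \<or> q = y then hd u else q) \<in> eqcl ?C" if "(p, q) \<in> ?C'" for p q
      proof -
        consider "p = x \<or> p = y" "q = x \<or> q = y \<or> q = hd u" | "p = b" "q = x"
          | "p \<in> D" "p \<noteq> b" "q = f p" | "p \<in> D" "q = e p"
          using \<open>(p, q) \<in> ?C'\<close> f' f'D e' e'D by (auto simp: comp_rel_def graph_on_iff)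
        then show ?thesis
        proof cases
          case 2
          then show ?thesis using fz[of b] bD fb xy by auto
        next
          case 3
          then show ?thesis using fz[of p] fD[of p] xy by auto
        next
          case 4
          then show ?thesis using ez[of p] em[of p] xy by auto
        qed auto
      qed
    qed (use xy bD in auto)
    have "4 * num_classes D ?C + card D \<le> 2 * num_classes D ?S + 2 * Suc (length fs)"
      using *(2) unfolding is_planar_def fs0(1) D_def[symmetric] by simp
    then show ?thesis
      using V C xy fin unfolding is_planar_def D1 by simp
  qed
  moreover have "(a # inv_letter a # w) # ws = map (map l') ((x # y # u) # fs)"
    using xy by (auto simp: fs0 l'_def D_def)
  ultimately show ?thesis
    unfolding planar_words_def
    by (intro exI[of _ "(x # y # u) # fs"] exI[of _ f'] exI[of _ e'] exI[of _ l'] conjI)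
qed

text \<open>Faces are nonempty, so diagrams grow from a single edge, whose only face runs along both
  of its sides.\<close>

lemma planar_words_base: "planar_words [[a, inv_letter a]]"
proof -
  let ?f = "\<lambda>x :: nat. 1 - x" and ?l = "\<lambda>x :: nat. if x = 0 then a else inv_letter a"
  have D: "darts [[0, 1]] = {0, 1}" by auto
  have m: "is_map [[0, 1]] ?f ?f ?l" by (auto simp: is_map_def)
  have C: "num_classes {0, 1} (comp_rel {0, 1} ?f ?f) = num_classes {0 :: nat} {}"
    by (rule num_classes_retract[where \<rho> = "\<lambda>_. 0"]) (auto simp: comp_rel_def graph_on_iff intro: eqcl_base)
  have "num_classes {0, 1} (vert_rel {0, 1} ?f ?f) = num_classes {1} (vert_rel {0, 1} ?f ?f) + 1"
    by (rule num_classes_insert_isolated) (auto simp: vert_rel_def graph_on_iff)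
  moreover have "num_classes {1} (vert_rel {0, 1} ?f ?f) = 1" by (simp add: num_classes_def)
  ultimately have "is_planar [[0, 1]] ?f ?f"
    using C unfolding is_planar_def D by (simp add: num_classes_def)
  then show ?thesis
    unfolding planar_words_def using m by (intro exI[of _ "[[0, 1]]"] exI[of _ ?f] exI[of _ ?l]) simp
qed

section \<open>Words and normal closures\<close>

lemma inv_word_append [simp]: "inv_word (u @ v) = inv_word v @ inv_word u"
  by (simp add: inv_word_def)

lemma inv_word_Cons: "inv_word (a # u) = inv_word u @ [inv_letter a]"
  by (simp add: inv_word_def)

lemma inv_word_Nil [simp]: "inv_word [] = []"
  by (simp add: inv_word_def)

lemma inv_word_inv_word [simp]: "inv_word (inv_word w) = w"
  by (simp add: inv_word_def rev_map comp_def)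

lemma length_inv_word [simp]: "length (inv_word w) = length w"
  by (simp add: inv_word_def)

lemma inv_word_eq_Nil [simp]: "inv_word w = [] \<longleftrightarrow> w = []"
  by (simp add: inv_word_def)

lemma inv_word_in_words_over [simp]: "inv_word w \<in> words_over Z \<longleftrightarrow> w \<in> words_over Z"
  using inv_word_words_over inv_word_inv_word by metis

lemma reduced_append: "reduced (u @ v) \<longleftrightarrow> reduced u \<and> reduced v \<and>
    (u \<noteq> [] \<longrightarrow> v \<noteq> [] \<longrightarrow> hd v \<noteq> inv_letter (last u))"
  by (auto simp: reduced_def successively_append_iff)

lemma reduce_Nil [simp]: "reduce [] = []"
  by (simp add: reduce_def)

lemma reduce_reduce [simp]: "reduce (reduce w) = reduce w"
  by (simp add: reduced_reduce reduce_reduced)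

lemma reduce_inv_word_cancel [simp]: "reduce (inv_word w @ w) = []"
  using reduce_inv_word_append[of "[]" w] by (simp add: reduce_def)

lemma reduce_cancel_inv_word [simp]: "reduce (w @ inv_word w) = []"
  using reduce_inv_word_cancel[of "inv_word w"] by simp

lemma reduce_cong_append: "reduce u = reduce u' \<Longrightarrow> reduce v = reduce v' \<Longrightarrow> reduce (u @ v) = reduce (u' @ v')"
  by (metis reduce_append_reduce reduce_reduce_append)

lemma reduce_cancel_middle: "reduce w = [] \<Longrightarrow> reduce (u @ w @ v) = reduce (u @ v)"
  using reduce_cong_append[of u u "w @ v" v] reduce_cong_append[of w "[]" v v] by simp

lemma reduce_inv_word_reduce: "reduce (inv_word (reduce w)) = reduce (inv_word w)"
proof -
  have 1: "reduce (inv_word w @ reduce w) = []"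
    by (simp add: reduce_append_reduce)
  have "reduce (inv_word w) = reduce (inv_word w @ (reduce w @ inv_word (reduce w)))"
    using reduce_cancel_middle[of "reduce w @ inv_word (reduce w)" "inv_word w" "[]"] by simp
  also have "\<dots> = reduce (inv_word (reduce w))"
    using reduce_cancel_middle[OF 1, of "[]" "inv_word (reduce w)"] by simp
  finally show ?thesis by simp
qed

lemma not_reducedE:
  assumes "\<not> reduced w"
  obtains u a v where "w = u @ [a, inv_letter a] @ v"
  using assms
proof (induction w arbitrary: thesis)
  case (Cons b w)
  show ?case
  proof (cases "reduced w")
    case True
    then have "w \<noteq> []" "hd w = inv_letter b" using Cons.prems(2) by (auto simp: reduced_Cons)
    then show ?thesis using Cons.prems(1)[of "[]" b "tl w"] by (cases w) auto
  next
    case False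
    then obtain u a v where "w = u @ [a, inv_letter a] @ v" using Cons.IH by metis
    then show ?thesis using Cons.prems(1)[of "b # u" a v] by simp
  qed
qed simp

lemma reduce_cancel_pair: "reduce (u @ [a, inv_letter a] @ v) = reduce (u @ v)"
  using reduce_cancel_middle[of "[a, inv_letter a]" u v] reduce_cancel_inv_word[of "[a]"]
  by (simp add: inv_word_def)

lemma carrier_free_group: "w \<in> carrier (free_group Z) \<longleftrightarrow> w \<in> words_over Z \<and> reduced w"
  by (simp add: free_group_def)

lemma mult_free_group: "u \<otimes>\<^bsub>free_group Z\<^esub> v = reduce (u @ v)"
  by (simp add: free_group_def)

lemma one_free_group: "\<one>\<^bsub>free_group Z\<^esub> = []"
  by (simp add: free_group_def)

section \<open>Products of conjugates of relators\<close>

definition conj_product :: "('a word \<times> 'a word) list \<Rightarrow> 'a word" where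
  "conj_product L = concat (map (\<lambda>(g, r). g @ r @ inv_word g) L)"

lemma conj_product_Cons: "conj_product ((g, r) # L) = g @ r @ inv_word g @ conj_product L"
  by (simp add: conj_product_def)

lemma conj_product_append: "conj_product (L @ M) = conj_product L @ conj_product M"
  by (simp add: conj_product_def)

lemma inv_word_conj_product:
  "inv_word (conj_product L) = conj_product (rev (map (\<lambda>(g, r). (g, inv_word r)) L))"
  by (induction L) (auto simp: conj_product_def)

lemma conj_product_conj:
  "reduce (g @ conj_product L @ inv_word g) = reduce (conj_product (map (\<lambda>(h, r). (g @ h, r)) L))"
proof (induction L)
  case (Cons p L)
  obtain h r where p: "p = (h, r)" by force
  have "reduce ((g @ h @ r @ inv_word h @ conj_product L) @ inv_word g) =
      reduce ((g @ h @ r @ inv_word h @ inv_word g) @ (g @ conj_product L @ inv_word g))"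
    using reduce_cancel_middle[of "inv_word g @ g" "g @ h @ r @ inv_word h" "conj_product L @ inv_word g"] by simp
  also have "\<dots> = reduce ((g @ h @ r @ inv_word h @ inv_word g) @ conj_product (map (\<lambda>(h, r). (g @ h, r)) L))"
    by (rule reduce_cong_append[OF refl Cons.IH])
  finally show ?case unfolding p by (simp add: conj_product_Cons)
qed (simp add: conj_product_def)

text \<open>The reduced products of conjugates already form a normal subgroup containing
  \<open>R\<close>, so they include the intersection that defines the closure.\<close>

lemma normal_closure_conj_product:
  assumes w: "w \<in> normal_closure (free_group Z) R" and R: "R \<subseteq> carrier (free_group Z)"
  obtains L where "set L \<subseteq> words_over Z \<times> (R \<union> inv_word ` R)" "w = reduce (conj_product L)"
proof -
  interpret group "free_group Z" by (rule group_free_group)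
  let ?A = "words_over Z \<times> (R \<union> inv_word ` R)"
  define N where "N = {reduce (conj_product L) | L. set L \<subseteq> ?A}"
  have wo: "conj_product L \<in> words_over Z" if "set L \<subseteq> ?A" for L
    using that
  proof (induction L)
    case (Cons p L)
    obtain g r where p: "p = (g, r)" by force
    have "g \<in> words_over Z" "r \<in> words_over Z"
      using Cons.prems R unfolding p by (auto simp: carrier_free_group)
    then show ?case using Cons unfolding p by (auto simp: conj_product_Cons)
  qed (simp add: conj_product_def words_over_def)
  have inN: "reduce (conj_product L) \<in> N" if "set L \<subseteq> ?A" for L
    using that by (auto simp: N_def)
  have "N \<lhd> free_group Z"
    unfolding normal_inv_iff
  proof (intro conjI ballI)
    show "subgroup N (free_group Z)"
    proof (rule subgroupI)
      show "N \<subseteq> carrier (free_group Z)"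
        using wo by (auto simp: N_def carrier_free_group reduced_reduce reduce_words_over)
      show "N \<noteq> {}" using inN[of "[]"] by auto
      show "inv\<^bsub>free_group Z\<^esub> a \<in> N" if "a \<in> N" for a
      proof -
        obtain L where L: "set L \<subseteq> ?A" "a = reduce (conj_product L)" using \<open>a \<in> N\<close> by (auto simp: N_def)
        have "a \<in> carrier (free_group Z)"
          using L wo by (auto simp: carrier_free_group reduced_reduce reduce_words_over)
        then have "inv\<^bsub>free_group Z\<^esub> a = reduce (conj_product (rev (map (\<lambda>(g, r). (g, inv_word r)) L)))"
          by (simp add: inv_free_group L reduce_inv_word_reduce inv_word_conj_product)
        moreover have "set (rev (map (\<lambda>(g, r). (g, inv_word r)) L)) \<subseteq> ?A"
          using L(1) by auto
        ultimately show ?thesis using inN by metis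
      qed
      show "a \<otimes>\<^bsub>free_group Z\<^esub> b \<in> N" if "a \<in> N" "b \<in> N" for a b
      proof -
        obtain L M where "set L \<subseteq> ?A" "a = reduce (conj_product L)" "set M \<subseteq> ?A" "b = reduce (conj_product M)"
          using \<open>a \<in> N\<close> \<open>b \<in> N\<close> by (auto simp: N_def)
        then show ?thesis
          using inN[of "L @ M"]
          by (simp add: mult_free_group reduce_reduce_append reduce_append_reduce conj_product_append)
      qed
    qed
    show "x \<otimes>\<^bsub>free_group Z\<^esub> h \<otimes>\<^bsub>free_group Z\<^esub> inv\<^bsub>free_group Z\<^esub> x \<in> N"
      if x: "x \<in> carrier (free_group Z)" and h: "h \<in> N" for x h
    proof -
      obtain L where L: "set L \<subseteq> ?A" "h = reduce (conj_product L)" using h by (auto simp: N_def)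
      have "x \<otimes>\<^bsub>free_group Z\<^esub> h \<otimes>\<^bsub>free_group Z\<^esub> inv\<^bsub>free_group Z\<^esub> x =
          reduce (reduce (x @ conj_product L) @ inv_word x)"
        by (simp add: mult_free_group inv_free_group[OF x] L reduce_append_reduce)
      also have "\<dots> = reduce (x @ conj_product L @ inv_word x)"
        by (simp add: reduce_reduce_append)
      finally have eq: "x \<otimes>\<^bsub>free_group Z\<^esub> h \<otimes>\<^bsub>free_group Z\<^esub> inv\<^bsub>free_group Z\<^esub> x =
          reduce (conj_product (map (\<lambda>(h, r). (x @ h, r)) L))"
        by (simp add: conj_product_conj)
      have "set (map (\<lambda>(h, r). (x @ h, r)) L) \<subseteq> ?A"
        using L(1) x by (auto simp: carrier_free_group)
      then show ?thesis unfolding eq by (rule inN)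
    qed
  qed
  moreover have "R \<subseteq> N"
  proof
    fix r assume "r \<in> R"
    then have "reduce (conj_product [([], r)]) = r"
      using R by (auto simp: conj_product_def carrier_free_group intro!: reduce_reduced)
    then show "r \<in> N" using inN[of "[([], r)]"] \<open>r \<in> R\<close> by (auto simp: words_over_def)
  qed
  ultimately have "w \<in> N" using w by (auto simp: normal_closure_def)
  then show thesis using that by (auto simp: N_def)
qed

section \<open>Diagrams over a presentation\<close>

text \<open>The path \<open>g\<close> grows edge by edge. Rotating the face moves the place of
  growth to the tip of the previous spike.\<close>

lemma planar_words_insert_inverse:
  "planar_words (w # ws) \<Longrightarrow> planar_words ((g @ inv_word g @ w) # ws)"
proof (induction g arbitrary: w)
  case (Cons a g)
  have "planar_words (([a] @ ([inv_letter a] @ w)) # ws)"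
    using planar_words_spike[OF Cons.prems, of a] by simp
  then have "planar_words (([inv_letter a] @ w @ [a]) # ws)"
    using planar_words_swap_append by fastforce
  then have "planar_words ((g @ inv_word g @ [inv_letter a] @ w @ [a]) # ws)" by (rule Cons.IH)
  then show ?case
    using planar_words_swap_append[of "g @ inv_word g @ [inv_letter a] @ w" "[a]"]
    by (simp add: inv_word_Cons)
qed simp

text \<open>No cell is ever glued on. The face grows a path labelled \<open>r\<close>, which it runs
  along forwards and backwards, and the way back, \<open>inv_word r\<close>, is pinched off by a
  cut.\<close>

lemma planar_words_insert_conj:
  assumes "planar_words (w # ws)" and "r \<noteq> []"
  shows "planar_words ((g @ r @ inv_word g @ w) # inv_word r # ws)"
proof -
  have "planar_words ((g @ inv_word g @ w) # ws)" using planar_words_insert_inverse[OF assms(1)] .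
  then have "planar_words ((inv_word g @ w @ g) # ws)"
    using planar_words_swap_append[of g "inv_word g @ w"] by simp
  then have "planar_words ((r @ inv_word r @ inv_word g @ w @ g) # ws)"
    by (rule planar_words_insert_inverse)
  then have "planar_words ((inv_word r @ (inv_word g @ w @ g @ r)) # ws)"
    using planar_words_swap_append[of r "inv_word r @ inv_word g @ w @ g"] by simp
  then have "planar_words (inv_word r # (inv_word g @ w @ g @ r) # ws)"
    by (rule planar_words_cut) (use assms(2) in auto)
  then have "planar_words (((inv_word g @ w) @ (g @ r)) # inv_word r # ws)"
    by (rule planar_words_mset) simp
  from planar_words_swap_append[OF this] show ?thesis by simp
qed

lemma planar_words_conj_product:
  assumes "snd ` set L \<subseteq> R \<union> inv_word ` R"
  obtains rs where "set rs \<subseteq> R \<union> inv_word ` R" "planar_words ((conj_product L @ [a, inv_letter a]) # rs)"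
  using assms
proof (induction L arbitrary: thesis)
  case Nil
  then show ?case using Nil(1)[of "[]"] planar_words_base[of a] by (simp add: conj_product_def)
next
  case (Cons p L)
  obtain g r where p: "p = (g, r)" by force
  obtain rs where rs: "set rs \<subseteq> R \<union> inv_word ` R" "planar_words ((conj_product L @ [a, inv_letter a]) # rs)"
    using Cons.IH Cons.prems(2) by auto
  show ?case
  proof (cases "r = []")
    case True
    then show ?thesis
      using Cons.prems(1)[OF rs(1)] planar_words_insert_inverse[OF rs(2), of g]
      by (simp add: p conj_product_Cons)
  next
    case False
    have "inv_word r \<in> R \<union> inv_word ` R" using Cons.prems(2) p by auto
    then show ?thesis
      using Cons.prems(1)[of "inv_word r # rs"] rs(1) planar_words_insert_conj[OF rs(2) False, of g]
      by (simp add: p conj_product_Cons)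
  qed
qed

text \<open>The two inverse letters are cut off as a bigon, and the bigon is flattened. The rest
  must not be empty, since it remains as a face.\<close>

lemma planar_words_fold:
  assumes "planar_words ((u @ [a, inv_letter a] @ v) # ws)" and "u @ v \<noteq> []"
  shows "planar_words ((u @ v) # ws)"
proof -
  have "planar_words (([a, inv_letter a] @ (v @ u)) # ws)"
    using planar_words_swap_append[OF assms(1)] by simp
  then have "planar_words ([a, inv_letter a] # (v @ u) # ws)"
    by (rule planar_words_cut) (use assms(2) in auto)
  from planar_words_swap_append[OF planar_words_bigon[OF this]] show ?thesis .
qed

lemma planar_words_reduce:
  assumes "planar_words (w # ws)" and "reduce w \<noteq> []"
  shows "planar_words (reduce w # ws)"
  using assms
proof (induction "length w" arbitrary: w rule: less_induct)
  case less
  show ?case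
  proof (cases "reduced w")
    case True
    then show ?thesis using less.prems by (simp add: reduce_reduced)
  next
    case False
    then obtain u a v where w: "w = u @ [a, inv_letter a] @ v" by (rule not_reducedE)
    then have r: "reduce w = reduce (u @ v)" using reduce_cancel_pair by metis
    then have "u @ v \<noteq> []" using less.prems(2) by (metis reduce_Nil)
    then have "planar_words ((u @ v) # ws)" using planar_words_fold[of u a v ws] less.prems(1) w by simp
    then show ?thesis using less.hyps[of "u @ v"] less.prems(2) r w by simp
  qed
qed

text \<open>The face is zipped up from its middle until only a bigon is left, which
  vanishes.\<close>

lemma planar_words_cancel:
  assumes "planar_words ((s @ inv_word s) # ws)" and "s \<noteq> []"
  shows "planar_words ws"
  using assms
proof (induction s rule: rev_induct)
  case (snoc a s)
  show ?case
  proof (cases "s = []")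
    case True
    then show ?thesis using snoc.prems planar_words_bigon[of a ws] by (simp add: inv_word_def)
  next
    case False
    have "planar_words ((s @ [a, inv_letter a] @ inv_word s) # ws)"
      using snoc.prems by (simp add: inv_word_Cons)
    then show ?thesis using planar_words_fold False snoc.IH by blast
  qed
qed simp

text \<open>Van Kampen's lemma. A diagram is built for the unreduced product of conjugates, and its
  boundary is folded until it reads \<open>w\<close>.\<close>

theorem diagram_exists:
  assumes "w \<in> normal_closure (free_group Z) R" and "R \<subseteq> carrier (free_group Z)" and "w \<noteq> []"
  obtains rs where "set rs \<subseteq> R \<union> inv_word ` R" "planar_words (w # rs)"
proof -
  obtain L where L: "set L \<subseteq> words_over Z \<times> (R \<union> inv_word ` R)" "w = reduce (conj_product L)"
    using normal_closure_conj_product[OF assms(1,2)] .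
  \<comment> \<open>The choice of the letter is arbitrary: the starting edge contributes
    \<open>[a, inv_letter a]\<close> to the boundary, which cancels in the reduction.\<close>
  define a where "a = hd w"
  have "snd ` set L \<subseteq> R \<union> inv_word ` R" using L(1) by auto
  then obtain rs where rs: "set rs \<subseteq> R \<union> inv_word ` R" "planar_words ((conj_product L @ [a, inv_letter a]) # rs)"
    using planar_words_conj_product by blast
  have w: "w = reduce (conj_product L @ [a, inv_letter a])"
    using L(2) reduce_cancel_pair[of "conj_product L" a "[]"] by simp
  have "planar_words (w # rs)" unfolding w
    by (rule planar_words_reduce[OF rs(2)]) (use assms(3) w in auto)
  then show thesis using that rs(1) by blast
qed

section \<open>Curvature\<close>

lemma cyclically_reduced_next:
  assumes "cyclically_reduced (map l u)" and "map f u = rotate1 u" and "y \<in> set u"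
  shows "l (f y) \<noteq> inv_letter (l y)"
proof -
  obtain i where i: "i < length u" "y = u ! i" using assms(3) by (metis in_set_conv_nth)
  have "f y = rotate1 u ! i" using assms(2) i by (metis nth_map)
  then have fy: "f y = u ! (Suc i mod length u)" using i by (simp add: nth_rotate1)
  show ?thesis
  proof (cases "Suc i < length u")
    case True
    have "successively (\<lambda>a b. b \<noteq> inv_letter a) (map l u)"
      using assms(1) by (simp add: cyclically_reduced_def reduced_def)
    then show ?thesis
      using True i fy unfolding successively_conv_nth by simp
  next
    case False
    then have "Suc i = length u" "u \<noteq> []" using i by auto
    then have "f y = hd u" "y = last u"
      using i(2) fy by (simp_all add: hd_conv_nth last_conv_nth flip: \<open>Suc i = length u\<close>)
    then show ?thesis using \<open>u \<noteq> []\<close>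
      using assms(1) by (simp add: cyclically_reduced_def hd_map last_map)
  qed
qed

lemma rotate_to:
  assumes "x \<in> set u"
  obtains k where "hd (rotate k u) = x"
proof -
  obtain i where "i < length u" "x = u ! i" using assms by (metis in_set_conv_nth)
  then have "hd (rotate i u) = x" using assms by (subst hd_rotate_conv_nth) auto
  then show thesis using that by blast
qed

lemma map_rotate1_rotate: "map f u = rotate1 u \<Longrightarrow> map f (rotate k u) = rotate1 (rotate k u)"
  by (metis rotate_map rotate1_rotate_swap)

lemma sum_concat:
  "distinct (concat fs) \<Longrightarrow> sum g (set (concat fs)) = (\<Sum>u\<leftarrow>fs. sum g (set u))"
  by (induction fs) (auto simp: sum.union_disjoint)

locale reduced_map =
  fixes u0 :: "nat list" and fs :: "nat list list" and f e :: "nat \<Rightarrow> nat" and l :: "nat \<Rightarrow> 'a letter"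
  assumes m: "is_map (u0 # fs) f e l" and pl: "is_planar (u0 # fs) f e"
    and red: "\<And>u. u \<in> set (u0 # fs) \<Longrightarrow> cyclically_reduced (map l u)"
begin

abbreviation "D \<equiv> darts (u0 # fs)"
abbreviation "Out \<equiv> set u0"
abbreviation "g \<equiv> inv_into D f"
abbreviation "v x \<equiv> f (e x)"

lemmas em = is_map_e[OF m]
lemmas bij_f = is_map_bij_f[OF m]
lemmas bij_v = is_map_bij_v[OF m]
lemmas fD = is_map_f_mem[OF m]

lemma f_inj: "x \<in> D \<Longrightarrow> y \<in> D \<Longrightarrow> f x = f y \<Longrightarrow> x = y"
  using bij_f by (meson bij_betw_imp_inj_on inj_onD)

lemma v_inj: "x \<in> D \<Longrightarrow> y \<in> D \<Longrightarrow> v x = v y \<Longrightarrow> x = y"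
  using bij_v by (meson bij_betw_imp_inj_on inj_onD)

lemma fg: "x \<in> D \<Longrightarrow> f (g x) = x"
  using bij_f by (simp add: bij_betw_inv_into_right del: set_concat)

lemma gf: "x \<in> D \<Longrightarrow> g (f x) = x"
  using bij_f by (simp add: bij_betw_inv_into_left del: set_concat)

lemma gD: "x \<in> D \<Longrightarrow> g x \<in> D"
  using bij_f by (metis bij_betw_imp_surj_on inv_into_into)

lemma v_eg: "x \<in> D \<Longrightarrow> v (e (g x)) = x"
  using em(3)[OF gD] fg by simp

lemma face_D: "u \<in> set (u0 # fs) \<Longrightarrow> x \<in> set u \<Longrightarrow> x \<in> D"
  by auto

lemma f_face: "u \<in> set (u0 # fs) \<Longrightarrow> x \<in> set u \<Longrightarrow> f x \<in> set u"
  using is_map_image[OF m] by blast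

lemma f_face_iff:
  assumes "u \<in> set (u0 # fs)" and "x \<in> D"
  shows "f x \<in> set u \<longleftrightarrow> x \<in> set u"
proof
  assume "f x \<in> set u"
  then obtain y where y: "y \<in> set u" "f x = f y" using is_map_image[OF m assms(1)] by (metis imageE)
  then have "x = y" using f_inj[of x y] assms(2) face_D[OF assms(1)] by blast
  then show "x \<in> set u" using y by simp
qed (use f_face assms in blast)

lemma g_face: "u \<in> set (u0 # fs) \<Longrightarrow> x \<in> set u \<Longrightarrow> g x \<in> set u"
  using f_face_iff[of u "g x"] fg[of x] gD[of x] face_D[of u x] by metis

text \<open>At a vertex of degree one a face turns back along the same edge, so its label has a
  letter followed by its inverse.\<close>

lemma v_neq: "x \<in> D \<Longrightarrow> v x \<noteq> x"
proof
  assume x: "x \<in> D" "v x = x"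
  have ex: "e x \<in> D" using em(1)[OF x(1)] .
  then obtain u where u: "u \<in> set (u0 # fs)" "e x \<in> set u" by auto
  have "l (f (e x)) \<noteq> inv_letter (l (e x))"
    using cyclically_reduced_next[OF red[OF u(1)] is_map_face[OF m u(1)] u(2)] .
  then show False using x em(4)[OF x(1)] by simp
qed

text \<open>As no vertex has degree one, a break is a dart whose starting vertex has degree at least
  three. Only there can the face on the other side change.\<close>

definition is_break :: "nat \<Rightarrow> bool" where
  "is_break x \<longleftrightarrow> v (v x) \<noteq> x"

definition outer_sides :: "nat \<Rightarrow> real" where
  "outer_sides x = of_bool (e x \<in> Out) + of_bool (e (g x) \<in> Out)"

text \<open>Negative curvature is assigned to the inner corners at vertices of degree at least three. The
  corner \<open>x\<close> precedes the edge of \<open>x\<close> and follows the edge of \<open>g x\<close>.\<close>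

definition \<kappa> :: "nat \<Rightarrow> real" where
  "\<kappa> x = (if x \<in> Out \<or> \<not> is_break x then 0 else - max (1/6) (outer_sides x / 4))"

lemma not_break_v: "x \<in> D \<Longrightarrow> \<not> is_break x \<Longrightarrow> v x = e (g x)"
  using v_inj[of "v x" "e (g x)"] v_eg[of x] em(1) fD gD unfolding is_break_def by metis

lemma break_v: "x \<in> D \<Longrightarrow> is_break x \<Longrightarrow> v x \<noteq> e (g x)"
  using v_eg[of x] unfolding is_break_def by metis

text \<open>The weights in \<open>\<kappa>\<close> are chosen for this estimate. At a vertex with
  \<open>d \<ge> 3\<close> corners, \<open>j\<close> of them outer, the inner corners may cost at
  most \<open>d/2 - 1\<close> in total. For \<open>j = 0\<close> the cost is \<open>d/6\<close>. For
  \<open>j = 1\<close> no inner corner has two outer sides, and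
  \<open>(d - 1)/4 \<le> d/2 - 1\<close>. For \<open>j \<ge> 2\<close> the maximal weight 1/2 gives
  at most \<open>(d - 2)/2\<close>.\<close>

lemma vertex_curvature:
  assumes x: "x \<in> D" and K: "K = eqcl (vert_rel D f e) `` {x}"
  shows "1 - real (card K) / 2 \<le> sum \<kappa> K" "K \<subseteq> D"
proof -
  have S: "(y, v y) \<in> vert_rel D f e" if "y \<in> D" for y
    using that unfolding vert_rel_def graph_on_iff by simp
  have orb: "\<exists>n. y = ((\<lambda>x. v x) ^^ n) x" if "y \<in> K" for y
    using that eqcl_graph_on_funpow[OF _ bij_v x] unfolding K vert_rel_def by (metis Image_singleton_iff finite_set)
  show KD: "K \<subseteq> D" using orb funpow_mem[OF bij_v x] by blast
  have fin: "finite K" using KD finite_subset by blast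
  have vK: "v y \<in> K" if "y \<in> K" for y
    using that S[of y] KD eqcl_trans[of x y _ "v y"] eqcl_base[OF S[of y]] unfolding K by blast
  have egK: "e (g y) \<in> K" if "y \<in> K" for y
  proof -
    have yD: "y \<in> D" using that KD by blast
    then have "e (g y) \<in> D" using em(1)[OF gD] by blast
    then have "(e (g y), y) \<in> vert_rel D f e" using S[of "e (g y)"] v_eg[OF yD] by simp
    then have "(y, e (g y)) \<in> eqcl (vert_rel D f e)" using eqcl_sym eqcl_base by metis
    then show ?thesis using that eqcl_trans unfolding K by (metis Image_singleton_iff)
  qed
  show "1 - real (card K) / 2 \<le> sum \<kappa> K"
  proof (cases "\<exists>y\<in>K. v (v y) = y")
    \<comment> \<open>A vertex of degree two, with corners \<open>y\<close> and \<open>v y\<close>: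
      its charge and its contribution \<open>1 - 2/2\<close> are both 0.\<close>
    case True
    then obtain y where y: "y \<in> K" "v (v y) = y" by blast
    have yD: "y \<in> D" using y KD by blast
    have "K \<subseteq> {y, v y}"
    proof
      fix z assume "z \<in> K"
      then have "(y, z) \<in> eqcl (vert_rel D f e)"
        using y(1) eqcl_sym eqcl_trans unfolding K by (metis Image_singleton_iff)
      then obtain n where n: "z = ((\<lambda>x. v x) ^^ n) y"
        using eqcl_graph_on_funpow[OF _ bij_v yD] unfolding vert_rel_def by (metis finite_set)
      have "((\<lambda>x. v x) ^^ n) y \<in> {y, v y}" by (induction n) (use y(2) in auto)
      then show "z \<in> {y, v y}" using n by simp
    qed
    then have eq: "K = {y, v y}" using y vK by blast
    have "card K = 2" unfolding eq using v_neq[OF yD] by simp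
    moreover have "\<kappa> z = 0" if "z \<in> K" for z
      using that y(2) unfolding eq by (auto simp: \<kappa>_def is_break_def)
    ultimately show ?thesis by simp
  next
    case False
    then have br: "is_break y" if "y \<in> K" for y using that by (auto simp: is_break_def)
    have xK: "x \<in> K" by (simp add: K)
    have "card {x, v x, v (v x)} \<le> card K"
      using fin xK vK by (intro card_mono) auto
    moreover have "card {x, v x, v (v x)} = 3"
      using v_neq[OF x] v_neq[of "v x"] fD[OF em(1)[OF x]] br[OF xK] by (simp add: is_break_def)
    ultimately have c3: "3 \<le> card K" by simp
    define j where "j = card (K \<inter> Out)"
    have "sum \<kappa> K = sum \<kappa> (K - Out)"
      using fin by (intro sum.mono_neutral_right) (auto simp: \<kappa>_def)
    moreover have cKO: "card (K - Out) = card K - j" "j \<le> card K"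
      unfolding j_def using fin by (auto simp: card_Diff_subset_Int intro: card_mono)
    moreover have bound: "real (card (K - Out)) * (- c) \<le> sum \<kappa> (K - Out)"
      if "\<And>y. y \<in> K - Out \<Longrightarrow> max (1/6) (outer_sides y / 4) \<le> c" for c
      by (rule sum_bounded_below) (use that br in \<open>auto simp: \<kappa>_def\<close>)
    have out1: "e y \<in> Out \<Longrightarrow> v y \<in> K \<inter> Out" and out2: "e (g y) \<in> Out \<Longrightarrow> e (g y) \<in> K \<inter> Out" if "y \<in> K" for y
      using f_face[of u0 "e y"] vK[OF that] egK[OF that] by auto
    consider "j = 0" | "j = 1" | "j \<ge> 2" by linarith
    then show ?thesis
    proof cases
      case 1
      then have "K \<inter> Out = {}" using fin by (simp add: j_def)
      then have "outer_sides y = 0" if "y \<in> K - Out" for y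
        using out1[of y] out2[of y] that by (auto simp: outer_sides_def)
      then show ?thesis using bound[of "1/6"] calculation c3 1 by simp
    next
      case 2
      have "outer_sides y \<le> 1" if "y \<in> K - Out" for y
      proof (rule ccontr)
        assume "\<not> outer_sides y \<le> 1"
        then have "e y \<in> Out" "e (g y) \<in> Out" by (auto simp: outer_sides_def of_bool_def split: if_splits)
        then have *: "v y \<in> K \<inter> Out" "e (g y) \<in> K \<inter> Out" using out1 out2 that by auto
        have "v y \<noteq> e (g y)" using break_v[of y] br[of y] that KD by blast
        then have "card {v y, e (g y)} = 2" by simp
        moreover have "card {v y, e (g y)} \<le> j"
          unfolding j_def using * fin by (intro card_mono) auto
        ultimately show False using 2 by simp
      qed
      then have "max (1/6) (outer_sides y / 4) \<le> 1/4" if "y \<in> K - Out" for y using that by fastforce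
      from bound[OF this] show ?thesis using calculation c3 2 by (simp add: of_nat_diff field_simps)
    next
      case 3
      have "max (1/6) (outer_sides y / 4) \<le> 1/2" for y by (simp add: outer_sides_def)
      from bound[OF this] show ?thesis using calculation c3 3 by (simp add: of_nat_diff field_simps)
    qed
  qed
qed

text \<open>Vertices minus edges, collected vertex by vertex: each vertex counts 1 and each dart
  starting there takes away half an edge.\<close>

lemma vertices_curvature:
  "real (num_classes D (vert_rel D f e)) - real (card D) / 2 \<le> sum \<kappa> D"
proof -
  let ?S = "vert_rel D f e"
  let ?C = "(\<lambda>x. eqcl ?S `` {x}) ` D"
  have fin: "finite K" "K \<subseteq> D" if "K \<in> ?C" for K
  proof -
    show "K \<subseteq> D" using that vertex_curvature(2) by blast
    then show "finite K" by (rule finite_subset) simp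
  qed
  have "\<Union>?C \<subseteq> D" using fin(2) by blast
  moreover have "D \<subseteq> \<Union>?C" using eqcl_refl by blast
  ultimately have U: "\<Union>?C = D" by (rule equalityI)
  have disj: "K \<inter> L = {}" if KL: "K \<in> ?C" "L \<in> ?C" "K \<noteq> L" for K L
  proof (rule ccontr)
    assume "K \<inter> L \<noteq> {}"
    then obtain z where "z \<in> K" "z \<in> L" by blast
    moreover obtain x y where "K = eqcl ?S `` {x}" "L = eqcl ?S `` {y}" using KL by blast
    ultimately have "K = eqcl ?S `` {z}" "L = eqcl ?S `` {z}"
      by (auto simp: eqcl_class_eq)
    then show False using KL by simp
  qed
  have sums: "sum h D = (\<Sum>K\<in>?C. sum h K)" for h :: "nat \<Rightarrow> real"
    using sum.Union_disjoint[of ?C h] fin(1) disj U by simp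
  have "real (num_classes D ?S) - real (card D) / 2 = (\<Sum>K\<in>?C. 1 - real (card K) / 2)"
    using sums[of "\<lambda>_. 1"] by (simp add: num_classes_def sum_subtractf sum_divide_distrib)
  also have "\<dots> \<le> (\<Sum>K\<in>?C. sum \<kappa> K)"
    using vertex_curvature(1) by (intro sum_mono) blast
  finally show ?thesis using sums[of \<kappa>] by simp
qed

text \<open>There is at least one component and the outer face carries no charge, so the Euler
  inequality bounds the sum of \<open>1 + sum \<kappa> (set u)\<close> over the inner faces from
  below by 1.\<close>

lemma positive_face:
  obtains u where "u \<in> set fs" "sum \<kappa> (set u) > -1"
proof -
  have ne: "u0 \<noteq> []" and dist: "distinct (concat fs)" "Out \<inter> darts fs = {}"
    using m by (auto simp: is_map_def)
  have "num_classes D (comp_rel D f e) \<noteq> 0"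
    using ne by (auto simp: num_classes_def)
  moreover define V where "V = num_classes D (vert_rel D f e)"
  moreover define d where "d = card D"
  ultimately have "4 + d \<le> 2 * V + 2 * Suc (length fs)"
    using pl unfolding is_planar_def by (simp del: set_concat)
  then have "real (4 + d) \<le> real (2 * V + 2 * Suc (length fs))"
    by (simp only: of_nat_le_iff)
  moreover have "real V - real d / 2 \<le> sum \<kappa> D" using vertices_curvature by (simp only: V_def d_def)
  ultimately have 1: "1 \<le> sum \<kappa> D + real (length fs)" by simp
  have "sum \<kappa> D = sum \<kappa> Out + sum \<kappa> (darts fs)"
    using dist(2) by (subst sum.union_disjoint[symmetric]) auto
  also have "sum \<kappa> Out = 0" by (simp add: \<kappa>_def)
  finally have 2: "sum \<kappa> D = (\<Sum>u\<leftarrow>fs. sum \<kappa> (set u))" using sum_concat[OF dist(1)] by simp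
  show thesis
  proof (rule ccontr)
    assume "\<not> thesis"
    then have "sum \<kappa> (set u) \<le> -1" if "u \<in> set fs" for u using that \<open>\<And>u. u \<in> set fs \<Longrightarrow> sum \<kappa> (set u) > -1 \<Longrightarrow> thesis\<close> by force
    then have "(\<Sum>u\<leftarrow>fs. sum \<kappa> (set u)) \<le> (\<Sum>u\<leftarrow>fs. -1)" by (intro sum_list_mono) auto
    then show False using 1 2 by (simp add: sum_list_triv)
  qed
qed

end

section \<open>The long outer arc of a positively curved face\<close>

lemma cycle_return:
  assumes "map f u = rotate1 u" "u \<noteq> []"
  shows "(f ^^ length u) (hd u) = hd u"
proof -
  have "(f ^^ (length u - 1)) (hd u) = last u"
    using cycle_nth[OF assms(1), of "length u - 1"] assms(2) by (simp add: last_conv_nth)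
  moreover have "f (last u) = hd u"
  proof -
    have "last (map f u) = hd u" unfolding assms(1) using assms(2) by (cases u) auto
    then show ?thesis using assms(2) by (simp add: last_map)
  qed
  ultimately have "(f ^^ Suc (length u - 1)) (hd u) = hd u" by simp
  then show ?thesis using assms(2) by simp
qed

lemma downward_closed_nat:
  fixes J :: "nat set"
  assumes "finite J" and "\<And>i j. j \<in> J \<Longrightarrow> i < j \<Longrightarrow> i \<in> J"
  shows "J = {..<card J}"
proof (cases "J = {}")
  case False
  have "J = {..Max J}"
  proof
    show "{..Max J} \<subseteq> J"
      using assms(2)[OF Max_in[OF assms(1) False]] Max_in[OF assms(1) False] by (auto simp: le_less)
  qed (use assms(1) in auto)
  then show ?thesis by (metis card_atMost lessThan_Suc_atMost)
qed simp

lemma card_Suc_less_le: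
  fixes a :: real
  assumes "0 \<le> a"
  shows "finite {j :: nat. real (Suc j) < a}" "real (card {j :: nat. real (Suc j) < a}) \<le> a"
proof -
  have sub: "{j :: nat. real (Suc j) < a} \<subseteq> {..<nat \<lfloor>a\<rfloor>}"
  proof
    fix j assume "j \<in> {j :: nat. real (Suc j) < a}"
    then have "real (Suc j) < a" by simp
    then have "int (Suc j) \<le> \<lfloor>a\<rfloor>" by (simp only: le_floor_iff of_int_of_nat_eq less_imp_le)
    then show "j \<in> {..<nat \<lfloor>a\<rfloor>}" by auto
  qed
  then show "finite {j :: nat. real (Suc j) < a}" by (rule finite_subset) simp
  have "card {j :: nat. real (Suc j) < a} \<le> nat \<lfloor>a\<rfloor>" using card_mono[OF _ sub] by simp
  then show "real (card {j :: nat. real (Suc j) < a}) \<le> a" using assms by linarith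
qed

context reduced_map
begin

lemma face_orbit:
  assumes "u \<in> set (u0 # fs)" "x \<in> set u"
  obtains k where "rotate k u = map (\<lambda>i. (f ^^ i) x) [0..<length u]" "(f ^^ length u) x = x"
proof -
  obtain k where k: "hd (rotate k u) = x" using rotate_to[OF assms(2)] .
  have r: "map f (rotate k u) = rotate1 (rotate k u)"
    using map_rotate1_rotate[OF is_map_face[OF m assms(1)]] .
  have "rotate k u = map (\<lambda>i. (f ^^ i) x) [0..<length u]"
    using cycle_nth[OF r] k by (intro nth_equalityI) auto
  moreover have "(f ^^ length u) x = x"
    using cycle_return[OF r] k assms(2) by fastforce
  ultimately show thesis using that by blast
qed

lemma face_elem:
  assumes "u \<in> set (u0 # fs)" "x \<in> set u" "y \<in> set u"
  obtains i where "i < length u" "y = (f ^^ i) x"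
proof -
  obtain k where k: "rotate k u = map (\<lambda>i. (f ^^ i) x) [0..<length u]"
    using face_orbit[OF assms(1,2)] .
  have "y \<in> set (rotate k u)" using assms(3) by simp
  then show thesis using that unfolding k by auto
qed

lemma funpow_face: "u \<in> set (u0 # fs) \<Longrightarrow> x \<in> set u \<Longrightarrow> (f ^^ i) x \<in> set u"
  by (induction i) (auto simp: f_face simp del: list.set)

lemma face_inj:
  assumes "u \<in> set (u0 # fs)" "x \<in> set u"
  shows "inj_on (\<lambda>i. (f ^^ i) x) {..<length u}"
proof -
  obtain k where k: "rotate k u = map (\<lambda>i. (f ^^ i) x) [0..<length u]"
    using face_orbit[OF assms] .
  have "distinct u" using m assms(1) by (auto simp: is_map_def distinct_concat_iff)
  then have "distinct (map (\<lambda>i. (f ^^ i) x) [0..<length u])" unfolding k[symmetric] by simp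
  then show ?thesis by (simp add: distinct_map atLeast0LessThan)
qed

text \<open>At a vertex of degree two the faces on both sides of an edge go on together, one of them
  in the opposite direction.\<close>

lemma not_break_step:
  assumes "x \<in> D" "\<not> is_break (f x)"
  shows "f (e (f x)) = e x" "e (f x) \<in> Out \<longleftrightarrow> e x \<in> Out"
proof -
  have fx: "f x \<in> D" using fD assms(1) .
  show 1: "f (e (f x)) = e x" using not_break_v[OF fx assms(2)] gf[OF assms(1)] by simp
  have "e (f x) \<in> Out \<longleftrightarrow> f (e (f x)) \<in> Out"
    using f_face_iff[of u0 "e (f x)"] em(1)[OF fx] by simp
  then show "e (f x) \<in> Out \<longleftrightarrow> e x \<in> Out" using 1 by simp
qed

lemma stretch_out:
  assumes "x \<in> D" "\<And>i. 0 < i \<Longrightarrow> i \<le> j \<Longrightarrow> \<not> is_break ((f ^^ i) x)"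
  shows "e ((f ^^ j) x) \<in> Out \<longleftrightarrow> e x \<in> Out"
  using assms(2)
proof (induction j)
  case (Suc j)
  have "e (f ((f ^^ j) x)) \<in> Out \<longleftrightarrow> e ((f ^^ j) x) \<in> Out"
    using Suc.prems[of "Suc j"] by (intro not_break_step funpow_mem[OF bij_f assms(1)]) auto
  then show ?case using Suc by simp
qed simp

lemma last_break:
  assumes u: "u \<in> set (u0 # fs)" and b0: "b0 \<in> set u" "is_break b0" and x: "x \<in> set u"
  obtains b j where "b \<in> set u" "is_break b" "j < length u" "x = (f ^^ j) b"
    "\<And>i. 0 < i \<Longrightarrow> i \<le> j \<Longrightarrow> \<not> is_break ((f ^^ i) b)"
proof -
  let ?P = "\<lambda>j. \<exists>b \<in> set u. is_break b \<and> x = (f ^^ j) b"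
  obtain i0 where i0: "i0 < length u" "x = (f ^^ i0) b0" using face_elem[OF u b0(1) x] .
  define j where "j = (LEAST j. ?P j)"
  have P0: "?P i0" using i0 b0 by blast
  have Pj: "?P j" unfolding j_def using P0 by (rule LeastI)
  then obtain b where b: "b \<in> set u" "is_break b" "x = (f ^^ j) b" by blast
  have "j \<le> i0" unfolding j_def using P0 by (rule Least_le)
  moreover have "\<not> is_break ((f ^^ i) b)" if "0 < i" "i \<le> j" for i
  proof
    assume br: "is_break ((f ^^ i) b)"
    have "x = (f ^^ (j - i)) ((f ^^ i) b)" using b(3) that by (metis comp_apply funpow_add le_add_diff_inverse2)
    then have "?P (j - i)" using br funpow_face[OF u b(1)] by blast
    then have "j \<le> j - i" unfolding j_def by (rule Least_le)
    then show False using that by linarith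
  qed
  moreover have "j < length u" using \<open>j \<le> i0\<close> i0(1) by simp
  ultimately show thesis using that[of b j] b by blast
qed

text \<open>Every break costs at least 1/6, so there are at most five. Every end of an outer arc
  costs at least 1/4, so two outer arcs with their four ends would use up the whole unit. All other
  darts lie on at most five inner arcs shorter than \<open>c * length u\<close>.\<close>

lemma long_outer_arc:
  fixes c :: real
  assumes u: "u \<in> set fs" and curv: "sum \<kappa> (set u) > -1"
    and c: "0 < c" "c < 1/5"
    and piece: "\<And>x k. x \<in> set u \<Longrightarrow> e x \<notin> Out \<Longrightarrow> 0 < k \<Longrightarrow> k \<le> length u \<Longrightarrow>
        (\<And>i. 0 < i \<Longrightarrow> i < k \<Longrightarrow> \<not> is_break ((f ^^ i) x)) \<Longrightarrow> real k < c * real (length u)"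
  obtains x t where "x \<in> set u" "t \<le> length u" "(1 - 5 * c) * real (length u) \<le> real t"
    "\<And>i. i < t \<Longrightarrow> e ((f ^^ i) x) \<in> Out" "\<And>i. 0 < i \<Longrightarrow> i < t \<Longrightarrow> \<not> is_break ((f ^^ i) x)"
proof -
  have u': "u \<in> set (u0 # fs)" using u by simp
  have ne: "u \<noteq> []" using m u by (auto simp: is_map_def)
  let ?n = "length u"
  have dist: "distinct u" using m u by (auto simp: is_map_def distinct_concat_iff)
  have card_u: "card (set u) = ?n" using dist by (rule distinct_card)
  have uD: "x \<in> D" if "x \<in> set u" for x using face_D[OF u' that] .
  have uO: "x \<notin> Out" if "x \<in> set u" for x
    using m u that by (auto simp: is_map_def)
  define T where "T = {x \<in> set u. e x \<in> Out}"
  define B where "B = {x \<in> set u. is_break x}"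
  have finB: "finite B" by (simp add: B_def)
  show thesis
  proof (cases "B = {}")
    \<comment> \<open>Without breaks the boundary is a single arc. As an inner arc it would be
      shorter than itself, so it is outer.\<close>
    case True
    then have nb: "\<not> is_break y" if "y \<in> set u" for y using that by (auto simp: B_def)
    have "e x \<in> Out" if x: "x \<in> set u" for x
    proof (rule ccontr)
      assume "e x \<notin> Out"
      then have "real ?n < c * real ?n"
        using piece[of x ?n] ne nb funpow_face[OF u' x] x by simp
      then show False using c ne by (simp add: mult_less_cancel_right1)
    qed
    moreover have "hd u \<in> set u" using ne by simp
    moreover have "(1 - 5 * c) * real ?n \<le> real ?n" using c by (simp add: mult_left_le_one_le)
    ultimately show thesis
      using that[of "hd u" ?n] nb funpow_face[OF u' \<open>hd u \<in> set u\<close>] by simp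
  next
    case False
    then obtain b0 where b0: "b0 \<in> set u" "is_break b0" by (auto simp: B_def)
    have sumB: "sum \<kappa> (set u) = (\<Sum>x\<in>B. - max (1/6) (outer_sides x / 4))"
    proof -
      have "sum \<kappa> (set u) = sum \<kappa> B"
        by (rule sum.mono_neutral_right) (auto simp: B_def \<kappa>_def)
      also have "\<dots> = (\<Sum>x\<in>B. - max (1/6) (outer_sides x / 4))"
        by (rule sum.cong) (use uO in \<open>auto simp: B_def \<kappa>_def\<close>)
      finally show ?thesis .
    qed
    have cB: "card B \<le> 5"
    proof -
      have "sum \<kappa> (set u) \<le> (\<Sum>x\<in>B. - (1/6))" unfolding sumB by (rule sum_mono) simp
      then have "real (card B) < 6" using curv by simp
      then show ?thesis by simp
    qed
    \<comment> \<open>Breaks followed by an outer edge are as many as breaks preceded by one: the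
      two kinds of darts correspond under \<open>g\<close> and coincide away from the breaks. The
      total of \<open>outer_sides\<close> is thus twice \<open>card (B \<inter> T)\<close>, and it
      is less than 4.\<close>
    have cT: "card (B \<inter> T) \<le> 1"
    proof -
      let ?T' = "{x \<in> set u. e (g x) \<in> Out}"
      have "inj_on g (set u)" using uD fg by (metis inj_onI)
      moreover have "g ` ?T' = T"
      proof
        show "g ` ?T' \<subseteq> T" using g_face[OF u'] by (auto simp: T_def)
        show "T \<subseteq> g ` ?T'"
        proof
          fix x assume "x \<in> T"
          then have "f x \<in> ?T'" "x = g (f x)" using uD gf f_face[OF u'] by (auto simp: T_def)
          then show "x \<in> g ` ?T'" by blast
        qed
      qed
      ultimately have "card ?T' = card T" by (metis (no_types, lifting) card_image inj_on_subset mem_Collect_eq subsetI)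
      moreover have "?T' - B = T - B"
      proof -
        have "e (g x) \<in> Out \<longleftrightarrow> e x \<in> Out" if "x \<in> set u" "\<not> is_break x" for x
          using not_break_step(2)[of "g x"] fg[OF uD[OF that(1)]] gD[OF uD[OF that(1)]] that(2) by simp
        then show ?thesis by (auto simp: T_def B_def)
      qed
      moreover have "card A = card (A \<inter> B) + card (A - B)" if "A \<subseteq> set u" for A
        using that finite_subset[OF that] by (metis card_Un_disjoint Diff_disjoint Int_Diff_disjoint Int_Diff_Un finite_Diff finite_Int finite_set)
      ultimately have eq: "card (T \<inter> B) = card (?T' \<inter> B)"
        by (metis (no_types, lifting) T_def add_right_cancel mem_Collect_eq subsetI)
      have "sum \<kappa> (set u) \<le> (\<Sum>x\<in>B. - (outer_sides x / 4))" unfolding sumB by (rule sum_mono) simp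
      also have "\<dots> = - ((\<Sum>x\<in>B. of_bool (e x \<in> Out)) + (\<Sum>x\<in>B. of_bool (e (g x) \<in> Out))) / 4"
        by (simp only: outer_sides_def sum_negf sum_divide_distrib[symmetric] sum.distrib minus_divide_left)
      also have "(\<Sum>x\<in>B. of_bool (e x \<in> Out)) = real (card (T \<inter> B))"
      proof -
        have "T \<inter> B = B \<inter> {x. e x \<in> Out}" by (auto simp: T_def B_def)
        then show ?thesis using finB by (simp add: sum_of_bool_eq)
      qed
      also have "(\<Sum>x\<in>B. of_bool (e (g x) \<in> Out)) = real (card (?T' \<inter> B))"
      proof -
        have "?T' \<inter> B = B \<inter> {x. e (g x) \<in> Out}" by (auto simp: B_def)
        then show ?thesis using finB by (simp add: sum_of_bool_eq)
      qed
      finally have "real (card (T \<inter> B)) < 2" using curv eq by simp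
      then show ?thesis by (simp add: Int_commute)
    qed
    have from_break: "\<exists>b\<in>B. \<exists>j<?n. x = (f ^^ j) b \<and> (\<forall>i. 0 < i \<longrightarrow> i \<le> j \<longrightarrow> \<not> is_break ((f ^^ i) b)) \<and> (b \<in> T \<longleftrightarrow> x \<in> T)"
      if x: "x \<in> set u" for x
    proof -
      obtain b j where b: "b \<in> set u" "is_break b" "j < ?n" "x = (f ^^ j) b"
        "\<And>i. 0 < i \<Longrightarrow> i \<le> j \<Longrightarrow> \<not> is_break ((f ^^ i) b)"
        using last_break[OF u' b0 x] by blast
      moreover have "b \<in> T \<longleftrightarrow> x \<in> T"
        using stretch_out[OF uD[OF b(1)] b(5)] b x by (simp add: T_def)
      ultimately show ?thesis by (auto simp: B_def)
    qed
    \<comment> \<open>Possible distances of a dart on an inner arc from the break before it: the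
      \<open>j + 1\<close> darts up to it are short by the hypothesis on pieces.\<close>
    let ?J = "{j :: nat. real (Suc j) < c * real ?n}"
    have J: "finite ?J" "real (card ?J) \<le> c * real ?n"
      using card_Suc_less_le[of "c * real ?n"] c by auto
    have "set u - T \<subseteq> (\<lambda>(b, j). (f ^^ j) b) ` (B \<times> ?J)"
    proof
      fix x assume x: "x \<in> set u - T"
      then obtain b j where b: "b \<in> B" "j < ?n" "x = (f ^^ j) b"
        "\<And>i. 0 < i \<Longrightarrow> i \<le> j \<Longrightarrow> \<not> is_break ((f ^^ i) b)" "b \<notin> T"
        using from_break[of x] by blast
      have "real (Suc j) < c * real ?n"
        using b by (intro piece[of b]) (auto simp: B_def T_def)
      then show "x \<in> (\<lambda>(b, j). (f ^^ j) b) ` (B \<times> ?J)" using b by force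
    qed
    then have "card (set u - T) \<le> card (B \<times> ?J)"
      using finB J(1) by (meson card_image_le card_mono finite_SigmaI finite_imageI le_trans)
    also have "\<dots> \<le> 5 * card ?J" using cB by (simp add: card_cartesian_product)
    finally have "real (card (set u - T)) \<le> 5 * real (card ?J)" by linarith
    then have c1: "real (card (set u - T)) \<le> 5 * c * real ?n" using J(2) by linarith
    have "card (set u - T) = ?n - card T" "card T \<le> ?n"
      using card_u by (auto simp: T_def card_Diff_subset intro: card_mono[of "set u", simplified card_u])
    then have cardT: "(1 - 5 * c) * real ?n \<le> real (card T)"
      using c1 by (simp add: of_nat_diff algebra_simps)
    have "0 < (1 - 5 * c) * real ?n" using c ne by simp
    then have "T \<noteq> {}" using cardT by auto
    then obtain x where "x \<in> T" by blast
    then obtain b where b: "b \<in> B" "b \<in> T" using from_break[of x] by (auto simp: T_def)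
    have only: "b' = b" if "b' \<in> B" "b' \<in> T" for b'
      using cT b that card_le_Suc0_iff_eq[of "B \<inter> T"] finB by auto
    have bu: "b \<in> set u" using b by (simp add: B_def)
    \<comment> \<open>Distances of the outer darts from \<open>b\<close>, the only break at which an
      outer arc can start. They form an initial segment, so the outer darts are contiguous.\<close>
    define J' where "J' = {j. j < ?n \<and> (f ^^ j) b \<in> T}"
    have inj: "inj_on (\<lambda>i. (f ^^ i) b) {..<?n}" using face_inj[OF u' bu] .
    have nb: "\<not> is_break ((f ^^ i) b)" if "j \<in> J'" "0 < i" "i \<le> j" for i j
    proof -
      have jT: "(f ^^ j) b \<in> T" "j < ?n" using that by (auto simp: J'_def)
      then obtain b' j' where b': "b' \<in> B" "j' < ?n" "(f ^^ j) b = (f ^^ j') b'"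
        "\<And>i. 0 < i \<Longrightarrow> i \<le> j' \<Longrightarrow> \<not> is_break ((f ^^ i) b')" "b' \<in> T"
        using from_break[of "(f ^^ j) b"] by (auto simp: T_def)
      have "b' = b" using only b' by blast
      then have "j' = j" using inj b'(2,3) jT(2) by (metis inj_onD lessThan_iff)
      then show ?thesis using b'(4) that \<open>b' = b\<close> by blast
    qed
    have "J' = {..<card J'}"
    proof (rule downward_closed_nat)
      show "i \<in> J'" if "j \<in> J'" "i < j" for i j
      proof -
        have "e ((f ^^ i) b) \<in> Out"
          using stretch_out[OF uD[OF bu], of i] nb[OF that(1)] that(2) b by (simp add: T_def)
        then show ?thesis using that funpow_face[OF u' bu] by (auto simp: J'_def T_def)
      qed
    qed (simp add: J'_def)
    moreover have "card J' = card T"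
    proof -
      have "(\<lambda>i. (f ^^ i) b) ` J' = T"
        using face_elem[OF u' bu] by (auto simp: J'_def T_def)
      moreover have "inj_on (\<lambda>i. (f ^^ i) b) J'"
        by (rule inj_on_subset[OF inj]) (auto simp: J'_def)
      ultimately show ?thesis by (metis card_image)
    qed
    ultimately have J': "J' = {..<card T}" by simp
    show thesis
    proof (rule that[of b "card T"])
      show "card T \<le> ?n" using \<open>card T \<le> ?n\<close> .
      show "e ((f ^^ i) b) \<in> Out" if "i < card T" for i
        using that J' by (auto simp: J'_def T_def)
      show "\<not> is_break ((f ^^ i) b)" if "0 < i" "i < card T" for i
        using nb[of i i] that J' by auto
    qed (use bu cardT in auto)
  qed
qed

text \<open>The outer face passes the arc in the opposite direction. Read from the partner of the
  last dart of the arc, it spells the inverse.\<close>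

lemma outer_arc_word:
  assumes u: "u \<in> set (u0 # fs)" and x: "x \<in> set u" and t: "0 < t" "t \<le> length u"
    and out: "\<And>i. i < t \<Longrightarrow> e ((f ^^ i) x) \<in> Out"
    and nb: "\<And>i. 0 < i \<Longrightarrow> i < t \<Longrightarrow> \<not> is_break ((f ^^ i) x)"
  obtains k where "t \<le> length u0"
    "take t (rotate k (map l u0)) = inv_word (map (\<lambda>i. l ((f ^^ i) x)) [0..<t])"
proof -
  have u0: "u0 \<in> set (u0 # fs)" by simp
  define y where "y = e ((f ^^ (t - 1)) x)"
  have yO: "y \<in> set u0" using out[of "t - 1"] t by (simp add: y_def)
  have xD: "(f ^^ i) x \<in> D" for i using funpow_mem[OF bij_f face_D[OF u x]] .
  have step: "(f ^^ i) y = e ((f ^^ (t - 1 - i)) x)" if "i < t" for i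
    using that
  proof (induction i)
    case (Suc i)
    have ti: "Suc (t - 1 - Suc i) = t - 1 - i" using Suc.prems by simp
    have eq: "(f ^^ (t - 1 - i)) x = f ((f ^^ (t - 1 - Suc i)) x)" by (subst ti[symmetric]) simp
    have "f (e (f ((f ^^ (t - 1 - Suc i)) x))) = e ((f ^^ (t - 1 - Suc i)) x)"
      by (rule not_break_step(1)[OF xD], unfold eq[symmetric], rule nb) (use Suc.prems in auto)
    then have "f (e ((f ^^ (t - 1 - i)) x)) = e ((f ^^ (t - 1 - Suc i)) x)" by (simp only: eq)
    then show ?case using Suc by simp
  qed (simp add: y_def)
  obtain k where k: "rotate k u0 = map (\<lambda>i. (f ^^ i) y) [0..<length u0]"
    using face_orbit[OF u0 yO] .
  have "t \<le> length u0"
  proof -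
    have "inj_on (\<lambda>i. e ((f ^^ i) x)) {..<t}"
    proof (rule inj_onI)
      fix i j assume ij: "i \<in> {..<t}" "j \<in> {..<t}" "e ((f ^^ i) x) = e ((f ^^ j) x)"
      then have "(f ^^ i) x = (f ^^ j) x" using em(3)[OF xD] by metis
      then show "i = j" using inj_onD[OF face_inj[OF u x]] ij t by auto
    qed
    then have "t = card ((\<lambda>i. e ((f ^^ i) x)) ` {..<t})" by (simp add: card_image)
    also have "\<dots> \<le> card Out" using out by (intro card_mono) auto
    also have "\<dots> \<le> length u0" by (rule card_length)
    finally show ?thesis .
  qed
  moreover have "take t (rotate k (map l u0)) = inv_word (map (\<lambda>i. l ((f ^^ i) x)) [0..<t])"
  proof (rule nth_equalityI)
    show "length (take t (rotate k (map l u0))) = length (inv_word (map (\<lambda>i. l ((f ^^ i) x)) [0..<t]))"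
      using \<open>t \<le> length u0\<close> by simp
    fix i assume "i < length (take t (rotate k (map l u0)))"
    then have i: "i < t" by simp
    have "take t (rotate k (map l u0)) ! i = l ((f ^^ i) y)"
      using i \<open>t \<le> length u0\<close> by (simp add: rotate_map k)
    also have "\<dots> = inv_letter (l ((f ^^ (t - 1 - i)) x))"
      using step[OF i] em(4)[OF xD] by simp
    also have "\<dots> = inv_word (map (\<lambda>i. l ((f ^^ i) x)) [0..<t]) ! i"
      using i by (simp add: inv_word_def rev_nth)
    finally show "take t (rotate k (map l u0)) ! i = inv_word (map (\<lambda>i. l ((f ^^ i) x)) [0..<t]) ! i" .
  qed
  ultimately show thesis using that by blast
qed

end

section \<open>Greendlinger's lemma\<close>

lemma rotate_split:
  obtains u v where "w = u @ v" "rotate n w = v @ u"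
  using that[of "take (n mod length w) w" "drop (n mod length w) w"] by (simp add: rotate_drop_take)

lemma mset_rotate: "mset (rotate n w) = mset w"
  by (rule rotate_split[of w n]) simp

lemma cyclically_reduced_swap: "cyclically_reduced (u @ v) \<Longrightarrow> cyclically_reduced (v @ u)"
  by (cases "u = []"; cases "v = []") (auto simp: cyclically_reduced_def reduced_append)

lemma cyclically_reduced_rotate: "cyclically_reduced w \<Longrightarrow> cyclically_reduced (rotate n w)"
  by (metis rotate_split cyclically_reduced_swap)

lemma inv_letter_eq_iff: "inv_letter a = b \<longleftrightarrow> a = inv_letter b"
  by auto

lemma reduced_inv_word: "reduced (inv_word w) \<longleftrightarrow> reduced w"
proof (induction w)
  case (Cons a w)
  show ?case
    by (cases w) (use Cons in \<open>auto simp: inv_word_Cons reduced_append reduced_Cons inv_letter_eq_iff\<close>)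
qed simp

lemma hd_inv_word: "w \<noteq> [] \<Longrightarrow> hd (inv_word w) = inv_letter (last w)"
  by (simp add: inv_word_def hd_rev last_map)

lemma last_inv_word: "w \<noteq> [] \<Longrightarrow> last (inv_word w) = inv_letter (hd w)"
  by (simp add: inv_word_def last_rev hd_map)

lemma cyclically_reduced_inv_word: "cyclically_reduced w \<Longrightarrow> cyclically_reduced (inv_word w)"
  by (auto simp: cyclically_reduced_def reduced_inv_word hd_inv_word last_inv_word inv_letter_eq_iff)

lemma symmetrized_base: "r \<in> R \<union> inv_word ` R \<Longrightarrow> r \<in> symmetrized R"
  unfolding symmetrized_def by (intro CollectI exI[of _ 0] exI[of _ r]) simp

lemma symmetrized_rotate:
  assumes "s \<in> symmetrized R"
  shows "rotate n s \<in> symmetrized R"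
proof -
  obtain i r where "r \<in> R \<union> inv_word ` R" "s = rotate i r"
    using assms by (auto simp: symmetrized_def)
  then show ?thesis
    unfolding symmetrized_def by (intro CollectI exI[of _ "n + i"] exI[of _ r]) (simp add: rotate_rotate)
qed

lemma symmetrized_swap: "u @ v \<in> symmetrized R \<Longrightarrow> v @ u \<in> symmetrized R"
  using symmetrized_rotate[of "u @ v" R "length u"] by (simp add: rotate_append)

lemma symmetrized_inv_word:
  assumes "s \<in> symmetrized R"
  shows "inv_word s \<in> symmetrized R"
proof -
  obtain n r where r: "r \<in> R \<union> inv_word ` R" "s = rotate n r"
    using assms by (auto simp: symmetrized_def)
  obtain u v where uv: "r = u @ v" "rotate n r = v @ u" using rotate_split .
  have "inv_word r \<in> R \<union> inv_word ` R" using r(1) by auto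
  then have "inv_word v @ inv_word u \<in> symmetrized R" using symmetrized_base uv by fastforce
  then show ?thesis using symmetrized_swap r uv by fastforce
qed

lemma symmetrized_cyclically_reduced:
  assumes "metric_small_cancellation c R" "s \<in> symmetrized R"
  shows "cyclically_reduced s"
  using assms unfolding symmetrized_def metric_small_cancellation_def
  by (auto intro!: cyclically_reduced_rotate cyclically_reduced_inv_word)

lemma common_prefix_short:
  assumes "metric_small_cancellation c R" "s \<in> symmetrized R" "s' \<in> symmetrized R" "s \<noteq> s'"
    and "take k s = take k s'" "k \<le> length s" "k \<le> length s'"
  shows "real k < c * real (length s)"
proof -
  have "prefix (take k s) s" "prefix (take k s) s'" using assms(5) by (metis take_is_prefix)+
  then have "piece R (take k s)" using assms(2-4) by (auto simp: piece_def)
  then have "real (length (take k s)) < c * real (length s)"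
    using assms(1,2) \<open>prefix (take k s) s\<close> unfolding metric_small_cancellation_def by blast
  then show ?thesis using assms(6) by simp
qed

context reduced_map
begin

text \<open>Along the stretch the label of \<open>u\<close> and the inverse label of its neighbour
  agree, which makes a piece unless the whole labels agree. In that case two cells cancel, against
  minimality, or a cell borders on itself, against its label being reduced.\<close>

lemma inner_arc_short:
  assumes sc: "metric_small_cancellation c R" "c \<le> 1"
    and faces: "\<And>u. u \<in> set fs \<Longrightarrow> map l u \<in> symmetrized R"
    and minimal: "\<And>rs. set rs \<subseteq> symmetrized R \<Longrightarrow> planar_words (map l u0 # rs) \<Longrightarrow> length fs \<le> length rs"
    and u: "u \<in> set fs" and x: "x \<in> set u" and ex: "e x \<notin> Out" and k: "0 < k" "k \<le> length u"
    and nb: "\<And>i. 0 < i \<Longrightarrow> i < k \<Longrightarrow> \<not> is_break ((f ^^ i) x)"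
  shows "real k < c * real (length u)"
proof -
  have u': "u \<in> set (u0 # fs)" using u by simp
  have xD: "x \<in> D" using face_D[OF u' x] .
  have fxD: "(f ^^ i) x \<in> D" for i using funpow_mem[OF bij_f xD] .
  obtain u1 where u1': "u1 \<in> set (u0 # fs)" "e x \<in> set u1" using em(1)[OF xD] by auto
  then have u1: "u1 \<in> set fs" using ex by auto
  define n where "n = length u"
  define n1 where "n1 = length u1"
  have n1: "0 < n1" using u1'(2) by (auto simp: n1_def)
  define y where "y = f (e x)"
  have y: "y \<in> set u1" using f_face[OF u1'] by (simp add: y_def)
  obtain i0 where rot: "rotate i0 u = map (\<lambda>i. (f ^^ i) x) [0..<n]" "(f ^^ n) x = x"
    using face_orbit[OF u' x] unfolding n_def .
  obtain i1 where rot1: "rotate i1 u1 = map (\<lambda>i. (f ^^ i) y) [0..<n1]"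
    using face_orbit[OF u1'(1) y] unfolding n1_def .
  have "(f ^^ n1) (e x) = e x" using face_orbit[OF u1'] unfolding n1_def .
  then have y_last: "(f ^^ (n1 - 1)) y = e x"
    using n1 by (metis y_def Suc_diff_1 comp_apply funpow_Suc_right)
  have yD: "(f ^^ i) y \<in> D" for i using funpow_mem[OF bij_f face_D[OF u1'(1) y]] .
  define s where "s = map (\<lambda>i. l ((f ^^ i) x)) [0..<n]"
  define s1 where "s1 = map (\<lambda>i. l ((f ^^ i) y)) [0..<n1]"
  have "s = rotate i0 (map l u)" by (simp add: rotate_map rot s_def)
  then have s: "s \<in> symmetrized R" using symmetrized_rotate[OF faces[OF u]] by simp
  have "s1 = rotate i1 (map l u1)" by (simp add: rotate_map rot1 s1_def)
  then have s1: "inv_word s1 \<in> symmetrized R"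
    using symmetrized_inv_word[OF symmetrized_rotate[OF faces[OF u1]]] by simp
  have len: "length s = n" "length (inv_word s1) = n1" by (simp_all add: s_def s1_def)
  have s1_nth: "inv_word s1 ! i = inv_letter (l ((f ^^ (n1 - 1 - i)) y))" if "i < n1" for i
    using that by (simp add: inv_word_def s1_def rev_nth)
  have match: "(f ^^ (n1 - 1 - i)) y = e ((f ^^ i) x)" if "i < k" "i < n1" for i
    using that
  proof (induction i)
    case (Suc i)
    have "f (e (f ((f ^^ i) x))) = e ((f ^^ i) x)"
      by (rule not_break_step(1)[OF fxD]) (use nb[of "Suc i"] Suc.prems in simp)
    also have "\<dots> = (f ^^ (n1 - 1 - i)) y" using Suc by simp
    also have "\<dots> = f ((f ^^ (n1 - 1 - Suc i)) y)"
    proof -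
      have "n1 - 1 - i = Suc (n1 - 1 - Suc i)" using Suc.prems by simp
      then show ?thesis by simp
    qed
    finally have "e (f ((f ^^ i) x)) = (f ^^ (n1 - 1 - Suc i)) y"
      using f_inj[OF em(1) yD] fD[OF fxD] by blast
    then show ?case by simp
  qed (use y_last in simp)
  \<comment> \<open>The stretch might be longer than the boundary of the neighbour, hence the
    minimum. This is excluded afterwards, since a whole relator is no piece when
    \<open>c \<le> 1\<close>.\<close>
  have common: "take (min k n1) s = take (min k n1) (inv_word s1)"
  proof (rule nth_equalityI)
    show "length (take (min k n1) s) = length (take (min k n1) (inv_word s1))"
      using k len by (simp add: n_def)
    fix i assume "i < length (take (min k n1) s)"
    then have i: "i < k" "i < n1" "i < n" using len by auto
    then have "inv_word s1 ! i = l ((f ^^ i) x)"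
      using s1_nth[OF i(2)] match[OF i(1,2)] em(4)[OF fxD] by simp
    then show "take (min k n1) s ! i = take (min k n1) (inv_word s1) ! i"
      using i by (simp add: s_def)
  qed
  show ?thesis
  proof (cases "s = inv_word s1")
    case False
    have k1: "min k n1 \<le> length s" "min k n1 \<le> length (inv_word s1)" using k len by (auto simp: n_def)
    have "real (min k n1) < c * real n"
      using common_prefix_short[OF sc(1) s s1 False common k1] len by simp
    moreover have "real (min k n1) < c * real n1"
      using common_prefix_short[OF sc(1) s1 s False[symmetric] common[symmetric] k1(2,1)] len by simp
    moreover have "c * real n1 \<le> real n1" using sc(2) mult_right_mono[of c 1 "real n1"] by simp
    ultimately show ?thesis by (cases "k \<le> n1") (auto simp: n_def)
  next
    case eq: True
    then have nn: "n1 = n" using len by metis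
    show ?thesis
    proof (cases "u1 = u")
      \<comment> \<open>The label from \<open>x\<close> to its partner \<open>(f ^^ p) x\<close> is
        its own inverse. In its middle there is a letter inverse to itself or a pair of adjacent
        inverse letters.\<close>
      case True
      obtain p where p: "p < n" "e x = (f ^^ p) x"
        using face_elem[OF u' x] u1'(2) True unfolding n_def by metis
      have sym: "l ((f ^^ i) x) = inv_letter (l ((f ^^ (p - i)) x))" if "i \<le> p" for i
      proof -
        have i: "i < n" using that p(1) by simp
        have "y = (f ^^ Suc p) x" using p(2) by (simp add: y_def)
        then have "(f ^^ (n1 - 1 - i)) y = (f ^^ (n - 1 - i + Suc p)) x"
          unfolding funpow_add comp_apply nn by (rule arg_cong)
        also have "n - 1 - i + Suc p = (p - i) + n" using i that by simp
        also have "(f ^^ ((p - i) + n)) x = (f ^^ (p - i)) x" by (simp add: funpow_add rot(2))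
        finally have "s ! i = inv_letter (l ((f ^^ (p - i)) x))" using s1_nth[of i] eq i nn by simp
        then show ?thesis using i by (simp add: s_def)
      qed
      show ?thesis
      proof (cases "even p")
        case True
        then obtain q where "p = 2 * q" by (elim evenE)
        then show ?thesis using sym[of q] by (simp add: mult_2)
      next
        case False
        then obtain q where q: "p = 2 * q + 1" by (elim oddE)
        have "l (f ((f ^^ q) x)) \<noteq> inv_letter (l ((f ^^ q) x))"
          using cyclically_reduced_next[OF red[OF u'] is_map_face[OF m u'] funpow_face[OF u' x]] .
        moreover have "p - q = Suc q" using q by simp
        ultimately show ?thesis using sym[of q] q by simp
      qed
    next
      \<comment> \<open>A mirror pair: joined at the edge of \<open>x\<close> the two cells form one
        face \<open>s @ inv_word s\<close>, which folds away and leaves two cells fewer.\<close>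
      case False
      define fs'' where "fs'' = remove1 u1 (remove1 u fs)"
      have mfs: "mset fs = {#u, u1#} + mset fs''"
      proof -
        have *: "mset ws = add_mset z (mset (remove1 z ws))" if "z \<in> set ws" for z :: "nat list" and ws
          using that by simp
        have "mset fs = add_mset u (mset (remove1 u fs))" by (rule *[OF u])
        moreover have "u1 \<in> set (remove1 u fs)" using u1 False by (simp add: in_set_remove1)
        then have "mset (remove1 u fs) = add_mset u1 (mset fs'')" unfolding fs''_def by (rule *)
        ultimately show ?thesis by simp
      qed
      have "0 < n" using k unfolding n_def by linarith
      then have x0: "hd (rotate i0 u) = x" "rotate i0 u \<noteq> []"
        unfolding rot(1) by (simp_all add: upt_conv_Cons)
      then obtain a where a: "rotate i0 u = x # a" by (metis list.collapse)
      have "last (rotate i1 u1) = e x" "rotate i1 u1 \<noteq> []"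
        unfolding rot1 using n1 y_last by (auto simp: last_map)
      then obtain b where b: "rotate i1 u1 = b @ [e x]" by (metis append_butlast_last_id)
      let ?fs = "(x # a) # (b @ [e x]) # u0 # fs''"
      have mc: "mset (concat ?fs) = mset (concat (u0 # fs))"
      proof -
        have "mset (x # a) = mset u" "mset (b @ [e x]) = mset u1"
          using a b by (metis mset_rotate)+
        then show ?thesis by (simp add: mset_concat_sum_mset mfs ac_simps)
      qed
      have sfs: "set fs'' \<subseteq> set fs" using notin_set_remove1 by (fastforce simp: fs''_def)
      have cyc: "map f z = rotate1 z" if "z \<in> set ?fs" for z
      proof -
        have "map f (x # a) = rotate1 (x # a)" "map f (b @ [e x]) = rotate1 (b @ [e x])"
          unfolding a[symmetric] b[symmetric]
          using map_rotate1_rotate is_map_face[OF m u'] is_map_face[OF m u1'(1)] by blast+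
        then show ?thesis using that sfs is_map_face[OF m, of z] by auto
      qed
      have nil: "[] \<notin> set ?fs" using sfs m by (auto simp: is_map_def)
      note m' = is_map_regroup[OF m mc nil cyc]
      have "length fs = length fs'' + 2" using arg_cong[OF mfs, of size] by simp
      then have "is_planar ?fs f e" using is_planar_regroup[OF pl m'(2)] by simp
      from planar_words_join[OF m'(1) this]
      have "planar_words ((map l (x # a @ b) @ [inv_letter (l x)]) # map l u0 # map (map l) fs'')" by simp
      moreover have "map l (x # a @ b) @ [inv_letter (l x)] = s @ inv_word s"
      proof -
        have "map l (x # a) = s" unfolding a[symmetric] rot s_def by simp
        moreover have "map l (b @ [e x]) = s1" unfolding b[symmetric] rot1 s1_def by simp
        moreover have "s1 = inv_word s" using eq by simp
        ultimately show ?thesis using em(4)[OF xD] by simp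
      qed
      ultimately have "planar_words ((s @ inv_word s) # map l u0 # map (map l) fs'')" by simp
      then have "planar_words (map l u0 # map (map l) fs'')"
        by (rule planar_words_cancel) (use k in \<open>auto simp: s_def n_def\<close>)
      moreover have "set (map (map l) fs'') \<subseteq> symmetrized R" using faces sfs by auto
      ultimately have "length fs \<le> length fs''" using minimal[of "map (map l) fs''"] by simp
      then show ?thesis using \<open>length fs = length fs'' + 2\<close> by simp
    qed
  qed
qed

end

text \<open>A diagram with the fewest cells contains no mirror pair, so all inner arcs are short,
  and a positively curved cell shows most of its boundary outside.\<close>

theorem greendlinger:
  assumes sc: "metric_small_cancellation c R" "0 < c" "c < 1/5"
    and R: "R \<subseteq> carrier (free_group Z)"
    and w: "w \<in> normal_closure (free_group Z) R" "w \<noteq> []" "cyclically_reduced w"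
  obtains k s t where "s \<in> symmetrized R" "0 < t" "t \<le> length s" "t \<le> length w"
    "(1 - 5 * c) * real (length s) \<le> real t" "take t (rotate k w) = take t s"
proof -
  let ?P = "\<lambda>rs. set rs \<subseteq> symmetrized R \<and> planar_words (w # rs)"
  obtain rs0 where "?P rs0"
    using diagram_exists[OF w(1) R w(2)] symmetrized_base by (metis subsetD subsetI)
  then obtain rs where rs: "?P rs" and least: "\<And>rs'. ?P rs' \<Longrightarrow> length rs \<le> length rs'"
    using ex_has_least_nat[of ?P _ length] by blast
  obtain fs0 f e l where fs0: "is_map fs0 f e l" "is_planar fs0 f e" "w # rs = map (map l) fs0"
    using rs by (auto simp: planar_words_def)
  then obtain u0 fs where fs: "fs0 = u0 # fs" "w = map l u0" "rs = map (map l) fs"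
    by (auto simp: Cons_eq_map_conv)
  have faces: "map l u \<in> symmetrized R" if "u \<in> set fs" for u
    using rs that by (auto simp: fs)
  interpret reduced_map u0 fs f e l
    by unfold_locales
      (use fs0 fs w(3) faces symmetrized_cyclically_reduced[OF sc(1)] in auto)
  obtain u where u: "u \<in> set fs" "sum \<kappa> (set u) > -1" using positive_face .
  have u': "u \<in> set (u0 # fs)" using u by simp
  have "c \<le> 1" using sc(3) by simp
  obtain x t where xt: "x \<in> set u" "t \<le> length u" "(1 - 5 * c) * real (length u) \<le> real t"
    "\<And>i. i < t \<Longrightarrow> e ((f ^^ i) x) \<in> Out" "\<And>i. 0 < i \<Longrightarrow> i < t \<Longrightarrow> \<not> is_break ((f ^^ i) x)"
  proof (rule long_outer_arc[OF u sc(2,3)])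
    show "real k < c * real (length u)"
      if "x \<in> set u" "e x \<notin> Out" "0 < k" "k \<le> length u"
        "\<And>i. 0 < i \<Longrightarrow> i < k \<Longrightarrow> \<not> is_break ((f ^^ i) x)" for x k
      by (rule inner_arc_short[OF sc(1) \<open>c \<le> 1\<close> faces _ u(1) that])
        (use least in \<open>auto simp: fs\<close>)
  qed blast
  have "0 < length u" using xt(1) by auto
  then have "0 < (1 - 5 * c) * real (length u)" using sc(3) by simp
  then have t0: "0 < t" using xt(3) by (metis of_nat_0 of_nat_0_less_iff order_less_le_trans)
  obtain i0 where rot: "rotate i0 u = map (\<lambda>i. (f ^^ i) x) [0..<length u]"
    using face_orbit[OF u' xt(1)] .
  define s0 where "s0 = map (\<lambda>i. l ((f ^^ i) x)) [0..<length u]"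
  have "s0 = rotate i0 (map l u)" by (simp add: rotate_map rot s0_def)
  then have s0: "s0 \<in> symmetrized R" using symmetrized_rotate[OF faces[OF u(1)]] by simp
  obtain k where k: "t \<le> length u0"
    "take t (rotate k (map l u0)) = inv_word (map (\<lambda>i. l ((f ^^ i) x)) [0..<t])"
    using outer_arc_word[OF u' xt(1) t0 xt(2,4,5)] .
  \<comment> \<open>The boundary spells the inverse of the outer arc, so the cell label is inverted,
    with the arc brought to the front.\<close>
  define s where "s = inv_word (drop t s0 @ take t s0)"
  have "s \<in> symmetrized R"
    unfolding s_def using symmetrized_inv_word[OF symmetrized_swap[of "take t s0" "drop t s0"]] s0 by simp
  moreover have tk: "take t s0 = map (\<lambda>i. l ((f ^^ i) x)) [0..<t]"
    using xt(2) by (simp add: s0_def take_map)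
  moreover have "length s = length u" by (simp add: s_def s0_def)
  moreover have "take t s = inv_word (take t s0)"
    using xt(2) by (simp add: s_def s0_def)
  ultimately show thesis
    using that[of s t k] t0 xt(2,3) k by (simp add: fs)
qed

section \<open>Elements of presented groups as classes of words\<close>

lemma inv_letter_inject: "inv_letter a = inv_letter b \<longleftrightarrow> a = b"
  by (metis inv_letter_inv_letter)

lemma words_over_Cons [simp]: "a # w \<in> words_over Z \<longleftrightarrow> fst a \<in> Z \<and> w \<in> words_over Z"
  by (cases a) (auto simp: words_over_def)

lemma Nil_words_over [simp]: "[] \<in> words_over Y"
  by (simp add: words_over_def)

locale presentation =
  fixes Z :: "'a set" and R :: "'a word set"
  assumes relators: "R \<subseteq> carrier (free_group Z)"
begin

abbreviation "Fr \<equiv> free_group Z"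
abbreviation "N \<equiv> normal_closure Fr R"
abbreviation "G \<equiv> presented_group Z R"

text \<open>Words need not be reduced to name an element, so multiplication is plain
  concatenation.\<close>

definition cls :: "'a word \<Rightarrow> 'a word set" where
  "cls w = N #>\<^bsub>Fr\<^esub> reduce w"

lemma N_normal: "N \<lhd> Fr"
  using group.normal_closure_normal[OF group_free_group relators] .

lemma N_subgroup: "subgroup N Fr"
  using N_normal by (rule normal_imp_subgroup)

lemma G_group: "group G"
  using group_presented_group[OF relators] .

lemma reduce_carrier: "w \<in> words_over Z \<Longrightarrow> reduce w \<in> carrier Fr"
  by (simp add: carrier_free_group reduced_reduce reduce_words_over)

lemma cls_reduce [simp]: "cls (reduce w) = cls w"
  by (simp add: cls_def)

lemma cls_cong: "reduce u = reduce v \<Longrightarrow> cls u = cls v"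
  by (simp add: cls_def)

lemma cls_cancel_pair: "cls (u @ [a, inv_letter a] @ v) = cls (u @ v)"
  by (rule cls_cong) (rule reduce_cancel_pair)

lemma carrier_G: "carrier G = cls ` words_over Z"
proof
  show "carrier G \<subseteq> cls ` words_over Z"
  proof
    fix x assume "x \<in> carrier G"
    then obtain w where w: "w \<in> carrier Fr" "x = N #>\<^bsub>Fr\<^esub> w"
      by (auto simp: presented_group_def FactGroup_def RCOSETS_def)
    then have "x = cls w" by (simp add: cls_def carrier_free_group reduce_reduced)
    then show "x \<in> cls ` words_over Z" using w by (auto simp: carrier_free_group)
  qed
  show "cls ` words_over Z \<subseteq> carrier G"
    using reduce_carrier by (auto simp: presented_group_def FactGroup_def RCOSETS_def cls_def)
qed

lemma cls_mem [simp]: "w \<in> words_over Z \<Longrightarrow> cls w \<in> carrier G"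
  by (simp add: carrier_G)

lemma cls_mult:
  "u \<in> words_over Z \<Longrightarrow> v \<in> words_over Z \<Longrightarrow> cls u \<otimes>\<^bsub>G\<^esub> cls v = cls (u @ v)"
  using normal.rcos_sum[OF N_normal reduce_carrier reduce_carrier, of u v]
  by (simp add: presented_group_def FactGroup_def cls_def mult_free_group reduce_reduce_append reduce_append_reduce)

lemma cls_Nil: "cls [] = \<one>\<^bsub>G\<^esub>"
proof -
  interpret group Fr by (rule group_free_group)
  have "N \<subseteq> carrier Fr" using N_subgroup by (rule subgroup.subset)
  then show ?thesis
    using coset_mult_one[of N] by (simp add: presented_group_def FactGroup_def cls_def one_free_group)
qed

lemma cls_inv:
  assumes "w \<in> words_over Z"
  shows "inv\<^bsub>G\<^esub> (cls w) = cls (inv_word w)"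
proof -
  interpret group G by (rule G_group)
  have "cls (inv_word w @ w) = \<one>\<^bsub>G\<^esub>"
    using cls_cong[of "inv_word w @ w" "[]"] by (simp add: cls_Nil)
  then show ?thesis
    using assms by (intro inv_equality) (simp_all add: cls_mult)
qed

lemma cls_eq_iff:
  assumes "u \<in> words_over Z" "v \<in> words_over Z"
  shows "cls u = cls v \<longleftrightarrow> cls (inv_word u @ v) = \<one>\<^bsub>G\<^esub>"
proof -
  interpret group G by (rule G_group)
  have "cls (inv_word u @ v) = inv\<^bsub>G\<^esub> (cls u) \<otimes>\<^bsub>G\<^esub> cls v"
    using assms by (simp add: cls_inv cls_mult)
  moreover have "cls v = cls u \<otimes>\<^bsub>G\<^esub> (inv\<^bsub>G\<^esub> (cls u) \<otimes>\<^bsub>G\<^esub> cls v)"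
    using assms by (simp add: m_assoc[symmetric])
  ultimately show ?thesis using assms by auto
qed

lemma cls_eq_one_iff:
  assumes "w \<in> words_over Z"
  shows "cls w = \<one>\<^bsub>G\<^esub> \<longleftrightarrow> reduce w \<in> N"
proof -
  interpret group Fr by (rule group_free_group)
  have "\<one>\<^bsub>G\<^esub> = N" by (simp add: presented_group_def FactGroup_def)
  then show ?thesis
    using coset_join1[of N "reduce w"] coset_join2[of "reduce w" N] N_subgroup reduce_carrier[OF assms]
      subgroup.subset[OF N_subgroup] by (auto simp: cls_def)
qed

lemma cls_cong_append:
  assumes "cls u = cls u'" "cls v = cls v'"
    and "u \<in> words_over Z" "u' \<in> words_over Z" "v \<in> words_over Z" "v' \<in> words_over Z"
  shows "cls (u @ v) = cls (u' @ v')"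
  using assms cls_mult by metis

lemma cls_append_cancel:
  assumes "cls (u @ v) = cls (u @ w)" "u \<in> words_over Z" "v \<in> words_over Z" "w \<in> words_over Z"
  shows "cls v = cls w"
proof -
  interpret group G by (rule G_group)
  show ?thesis using assms l_cancel[of "cls u" "cls v" "cls w"] by (simp add: cls_mult)
qed

lemma cls_append_cancel_right:
  assumes "cls (v @ u) = cls (w @ u)" "u \<in> words_over Z" "v \<in> words_over Z" "w \<in> words_over Z"
  shows "cls v = cls w"
proof -
  interpret group G by (rule G_group)
  show ?thesis using assms r_cancel[of "cls v" "cls u" "cls w"] by (simp add: cls_mult)
qed

lemma relator_words: "r \<in> R \<Longrightarrow> r \<in> words_over Z" "r \<in> R \<Longrightarrow> reduced r"
  using relators by (auto simp: carrier_free_group)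

lemma cls_relator: "r \<in> R \<Longrightarrow> cls r = \<one>\<^bsub>G\<^esub>"
  using relator_words[of r] cls_eq_one_iff[of r]
  by (auto simp: reduce_reduced normal_closure_def)

lemma cls_swap_one:
  assumes "cls (u @ v) = \<one>\<^bsub>G\<^esub>" "u \<in> words_over Z" "v \<in> words_over Z"
  shows "cls (v @ u) = \<one>\<^bsub>G\<^esub>"
proof -
  interpret group G by (rule G_group)
  show ?thesis using assms inv_comm[of "cls u" "cls v"] by (simp add: cls_mult)
qed

lemma symmetrized_words: "s \<in> symmetrized R \<Longrightarrow> s \<in> words_over Z"
  using relator_words(1) unfolding symmetrized_def words_over_def
  by (auto simp: in_lists_conv_set inv_word_def inv_letter_def) blast+

lemma cls_symmetrized:
  assumes "s \<in> symmetrized R"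
  shows "cls s = \<one>\<^bsub>G\<^esub>"
proof -
  interpret group G by (rule G_group)
  obtain n r where r: "r \<in> R \<union> inv_word ` R" "s = rotate n r"
    using assms by (auto simp: symmetrized_def)
  have rZ: "r \<in> words_over Z" using r relator_words by auto
  obtain u v where uv: "r = u @ v" "rotate n r = v @ u" using rotate_split .
  have "cls r = \<one>\<^bsub>G\<^esub>"
    using r(1) cls_relator relator_words(1) by (auto simp flip: cls_inv)
  then show ?thesis using cls_swap_one[of u v] rZ uv r by simp
qed

lemma cls_replace:
  assumes "q @ q' \<in> symmetrized R" "x \<in> words_over Z" "z \<in> words_over Z"
  shows "cls (x @ q @ z) = cls (x @ inv_word q' @ z)"
proof -
  have w: "q \<in> words_over Z" "q' \<in> words_over Z" using symmetrized_words[OF assms(1)] by auto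
  have "cls (q' @ q) = \<one>\<^bsub>G\<^esub>" using cls_swap_one cls_symmetrized[OF assms(1)] w by blast
  then have "cls (inv_word q') = cls q" using cls_eq_iff[of "inv_word q'" q] w by simp
  then show ?thesis using assms w by (intro cls_cong_append) auto
qed

definition geodesic :: "'a word \<Rightarrow> bool" where
  "geodesic w \<longleftrightarrow> w \<in> words_over Z \<and>
     (\<forall>w' \<in> words_over Z. cls w' = cls w \<longrightarrow> length w \<le> length w')"

text \<open>Von Dyck's principle for functions on words: being multiplicative and killing cancelling
  pairs and relators suffices to depend on the class only. The shift, the evaluation in
  \<open>P\<close> and the lift from \<open>P\<close> are all shown to be well defined in this
  way.\<close>

lemma cls_eq_imp_eq:
  assumes H: "group H" and \<phi>: "\<And>w. w \<in> words_over Z \<Longrightarrow> \<phi> w \<in> carrier H"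
    and app: "\<And>u v. u \<in> words_over Z \<Longrightarrow> v \<in> words_over Z \<Longrightarrow> \<phi> (u @ v) = \<phi> u \<otimes>\<^bsub>H\<^esub> \<phi> v"
    and canc: "\<And>a. fst a \<in> Z \<Longrightarrow> \<phi> [a, inv_letter a] = \<one>\<^bsub>H\<^esub>"
    and rel: "\<And>r. r \<in> R \<Longrightarrow> \<phi> r = \<one>\<^bsub>H\<^esub>"
    and uv: "u \<in> words_over Z" "v \<in> words_over Z" "cls u = cls v"
  shows "\<phi> u = \<phi> v"
proof -
  interpret H: group H by fact
  have red: "\<phi> (reduce w) = \<phi> w" if "w \<in> words_over Z" for w
    using that
  proof (induction "length w" arbitrary: w rule: less_induct)
    case less
    show ?case
    proof (cases "reduced w")
      case False
      then obtain x a y where w: "w = x @ [a, inv_letter a] @ y" by (rule not_reducedE)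
      have xy: "x \<in> words_over Z" "y \<in> words_over Z" "fst a \<in> Z" "fst (inv_letter a) \<in> Z"
        using less.prems w by (auto simp: inv_letter_def)
      have "\<phi> w = \<phi> (x @ y)"
        using app[of x "[a, inv_letter a] @ y"] app[of "[a, inv_letter a]" y] app[of x y] xy canc[OF xy(3)] \<phi>[of y]
        unfolding w by simp
      moreover have "reduce w = reduce (x @ y)" unfolding w by (rule reduce_cancel_pair)
      moreover have "\<phi> (reduce (x @ y)) = \<phi> (x @ y)" using w xy by (intro less.hyps) auto
      ultimately show ?thesis by simp
    qed (simp add: reduce_reduced)
  qed
  have "\<phi> \<in> hom Fr H"
    using \<phi> red app by (auto simp: hom_def carrier_free_group mult_free_group)
  then interpret group_hom Fr H \<phi>
    using group_free_group H by (simp add: group_hom_def group_hom_axioms_def)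
  have "R \<subseteq> kernel Fr H \<phi>" using rel relators by (auto simp: kernel_def)
  then have "N \<subseteq> kernel Fr H \<phi>"
    using normal_kernel by (auto simp: normal_closure_def)
  moreover have "reduce (inv_word u @ v) \<in> N"
    using uv cls_eq_iff cls_eq_one_iff by simp
  ultimately have "\<phi> (inv_word u @ v) = \<one>\<^bsub>H\<^esub>"
    using red[of "inv_word u @ v"] uv by (auto simp: kernel_def)
  moreover have "\<phi> (inv_word u @ u) = \<one>\<^bsub>H\<^esub>"
    using red[of "inv_word u @ u"] hom_one uv(1) by (simp add: one_free_group)
  ultimately show ?thesis
    using H.l_cancel[of "\<phi> (inv_word u)" "\<phi> u" "\<phi> v"] uv \<phi> by (simp add: app)
qed

section \<open>Geodesic words\<close>

lemma geodesic_reduced: "geodesic w \<Longrightarrow> reduced w"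
proof (rule ccontr)
  assume w: "geodesic w" "\<not> reduced w"
  obtain u a v where uv: "w = u @ [a, inv_letter a] @ v" using not_reducedE[OF w(2)] .
  then have "cls (u @ v) = cls w" "u @ v \<in> words_over Z"
    using cls_cancel_pair w(1) by (auto simp: geodesic_def)
  then show False using w(1) uv unfolding geodesic_def by fastforce
qed

text \<open>Otherwise the subword \<open>q\<close> could be replaced by the shorter
  \<open>inv_word q'\<close>.\<close>

lemma geodesic_half:
  assumes "geodesic (x @ q @ z)" "q @ q' \<in> symmetrized R"
  shows "length q \<le> length q'"
proof -
  have xz: "x \<in> words_over Z" "z \<in> words_over Z" using assms(1) by (auto simp: geodesic_def)
  have "q' \<in> words_over Z" using symmetrized_words[OF assms(2)] by simp
  then have "length (x @ q @ z) \<le> length (x @ inv_word q' @ z)"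
    using assms(1) cls_replace[OF assms(2) xz] xz unfolding geodesic_def by (metis inv_word_in_words_over words_over_append)
  then show ?thesis by simp
qed

lemma geodesic_inv_word:
  assumes "geodesic w"
  shows "geodesic (inv_word w)"
proof -
  interpret group G by (rule G_group)
  have w: "w \<in> words_over Z" using assms by (simp add: geodesic_def)
  have "length w \<le> length w'" if "w' \<in> words_over Z" "cls w' = cls (inv_word w)" for w'
  proof -
    have "cls (inv_word w') = cls w" using that w by (metis cls_inv cls_mem inv_inv)
    then show ?thesis using assms that(1) unfolding geodesic_def by (metis inv_word_in_words_over length_inv_word)
  qed
  then show ?thesis using w by (simp add: geodesic_def)
qed

lemma cls_pow:
  "w \<in> words_over Z \<Longrightarrow> cls w [^]\<^bsub>G\<^esub> n = cls (concat (replicate n w))"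
proof (induction n)
  case (Suc n)
  interpret group G by (rule G_group)
  have "concat (replicate n w) \<in> words_over Z" for n
    using Suc.prems by (induction n) auto
  moreover have "cls w [^]\<^bsub>G\<^esub> Suc n = cls w \<otimes>\<^bsub>G\<^esub> cls w [^]\<^bsub>G\<^esub> n"
    using Suc.prems by (intro nat_pow_Suc2) simp
  ultimately show ?case using Suc by (simp add: cls_mult)
qed (simp add: cls_Nil)

end

section \<open>Torsion and fixed points in small cancellation groups\<close>

locale small_cancellation = presentation +
  fixes c :: real
  assumes sc: "metric_small_cancellation c R" and c: "0 < c" "c \<le> 1/20"
begin

text \<open>The bound \<open>c \<le> 1/20\<close> makes \<open>1 - 5 * c\<close> at least
  3/4.\<close>

lemma long_relator_part:
  assumes "w \<in> words_over Z" "cls w = \<one>\<^bsub>G\<^esub>" "w \<noteq> []" "cyclically_reduced w"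
  obtains k s t where "s \<in> symmetrized R" "0 < t" "t \<le> length s" "t \<le> length w"
    "3 * real (length s) \<le> 4 * real t" "take t (rotate k w) = take t s"
proof -
  have "w \<in> N"
    using assms cls_eq_one_iff by (simp add: cyclically_reduced_def reduce_reduced)
  moreover have "c < 1/5" using c by simp
  ultimately obtain k s t where *: "s \<in> symmetrized R" "0 < t" "t \<le> length s" "t \<le> length w"
    "(1 - 5 * c) * real (length s) \<le> real t" "take t (rotate k w) = take t s"
    using greendlinger[OF sc c(1) _ relators _ assms(3,4)] by metis
  have "3/4 * real (length s) \<le> (1 - 5 * c) * real (length s)"
    using c by (intro mult_right_mono) auto
  then show thesis using that[OF *(1-4) _ *(6)] *(5) by simp
qed

section \<open>Absence of torsion\<close>

lemma cyclically_reduced_power: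
  assumes "cyclically_reduced h" "h \<noteq> []"
  shows "cyclically_reduced (concat (replicate (Suc n) h))"
proof -
  have "reduced (concat (replicate (Suc n) h)) \<and> concat (replicate (Suc n) h) \<noteq> [] \<and>
      hd (concat (replicate (Suc n) h)) = hd h \<and> last (concat (replicate (Suc n) h)) = last h"
    using assms by (induction n) (auto simp: cyclically_reduced_def reduced_append)
  then show ?thesis using assms by (simp add: cyclically_reduced_def)
qed

lemma rotate_concat_replicate:
  "rotate k (concat (replicate n h)) = concat (replicate n (rotate k h))"
proof (induction k)
  case (Suc k)
  have "rotate1 (concat (replicate n g)) = concat (replicate n (rotate1 g))" for g :: "'x list"
  proof (cases g)
    case (Cons a y)
    have "concat (replicate n (a # y)) @ [a] = a # concat (replicate n (y @ [a]))"
      by (induction n) auto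
    then show ?thesis unfolding Cons by (cases n) auto
  qed simp
  then show ?case using Suc by simp
qed simp

text \<open>A geodesic \<open>h\<close> that is a prefix of \<open>s\<close> covers at most half of
  it. Of the three quarters of \<open>s\<close> found in the power, at least a quarter thus overlaps
  with the rotation of \<open>s\<close> by \<open>length h\<close>, and a piece has less than a
  twentieth.\<close>

lemma torsion_free_presented_group:
  assumes noprop: "\<And>s n. s \<in> symmetrized R \<Longrightarrow> 0 < n \<Longrightarrow> n < length s \<Longrightarrow> rotate n s \<noteq> s"
  shows "torsion_free G"
  unfolding torsion_free_def
proof (intro ballI allI impI, rule ccontr)
  interpret group G by (rule G_group)
  fix x and n :: nat
  assume x: "x \<in> carrier G" "0 < n" "x [^]\<^bsub>G\<^esub> n = \<one>\<^bsub>G\<^esub>" "x \<noteq> \<one>\<^bsub>G\<^esub>"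
  define P where "P h \<longleftrightarrow> h \<in> words_over Z \<and> cls h [^]\<^bsub>G\<^esub> n = \<one>\<^bsub>G\<^esub> \<and> cls h \<noteq> \<one>\<^bsub>G\<^esub>" for h
  obtain h0 where "P h0" using x by (auto simp: P_def carrier_G)
  then obtain h where h: "P h" and least: "\<And>h'. P h' \<Longrightarrow> length h \<le> length h'"
    using ex_has_least_nat[of P h0 length] by blast
  \<comment> \<open>Conjugation by \<open>cls v\<close>. Minimality is needed for all rotations of
    \<open>h\<close>, because the relator may start anywhere in the cyclic word.\<close>
  have swap: "P (v @ u)" if "P (u @ v)" for u v
  proof -
    have uv: "u \<in> words_over Z" "v \<in> words_over Z" using that by (auto simp: P_def)
    have "cls (v @ u) [^]\<^bsub>G\<^esub> n \<otimes>\<^bsub>G\<^esub> cls v = cls v \<otimes>\<^bsub>G\<^esub> cls (u @ v) [^]\<^bsub>G\<^esub> n"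
    proof (induction n)
      case (Suc n)
      have "cls (v @ u) [^]\<^bsub>G\<^esub> Suc n \<otimes>\<^bsub>G\<^esub> cls v = cls (v @ u) [^]\<^bsub>G\<^esub> n \<otimes>\<^bsub>G\<^esub> (cls v \<otimes>\<^bsub>G\<^esub> cls (u @ v))"
        using uv by (simp add: cls_mult[symmetric] m_assoc)
      also have "\<dots> = cls v \<otimes>\<^bsub>G\<^esub> cls (u @ v) [^]\<^bsub>G\<^esub> Suc n"
        using Suc uv by (simp add: m_assoc[symmetric])
      finally show ?case .
    qed (use uv in simp)
    then have "cls (v @ u) [^]\<^bsub>G\<^esub> n = \<one>\<^bsub>G\<^esub>"
      using that uv by (simp add: P_def)
    moreover have "cls (v @ u) \<noteq> \<one>\<^bsub>G\<^esub>"
      using that uv cls_swap_one[of v u] by (auto simp: P_def)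
    ultimately show ?thesis using uv by (simp add: P_def)
  qed
  have rot: "P (rotate k h)" for k using swap h by (metis rotate_split)
  have Pcls: "P h'" if "P h''" "cls h' = cls h''" "h' \<in> words_over Z" for h' h''
    using that by (simp add: P_def)
  have geo: "geodesic (rotate k h)" for k
  proof -
    have "length h \<le> length w'" if "w' \<in> words_over Z" "cls w' = cls (rotate k h)" for w'
      using least[of w'] Pcls[OF rot[of k] that(2,1)] by blast
    moreover have "rotate k h \<in> words_over Z" using rot[of k] by (simp add: P_def)
    ultimately show ?thesis by (simp add: geodesic_def)
  qed
  have hne: "h \<noteq> []" using h cls_Nil unfolding P_def by metis
  have cyc: "cyclically_reduced h"
  proof (rule ccontr)
    \<comment> \<open>Rotating by one letter brings the two ends of \<open>h\<close> together, and
      the rotated word is reduced because it is geodesic too.\<close>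
    assume ncyc: "\<not> cyclically_reduced h"
    have "reduced h" using geodesic_reduced[OF geo[of 0]] by simp
    then have hl: "hd h = inv_letter (last h)" using ncyc by (auto simp: cyclically_reduced_def)
    obtain a y where y: "h = a # y" using hne by (cases h) auto
    have "reduced (y @ [a])" using geodesic_reduced[OF geo[of 1]] y by simp
    moreover have "y \<noteq> []" using hl y by auto
    ultimately show False using hl y by (auto simp: reduced_append)
  qed
  obtain n' where n': "n = Suc n'" using x(2) by (cases n) auto
  define w where "w = concat (replicate n h)"
  have hZ: "h \<in> words_over Z" using h by (simp add: P_def)
  have "w \<in> words_over Z" unfolding w_def using hZ by (induction n) auto
  moreover have "cls w = \<one>\<^bsub>G\<^esub>" using cls_pow[OF hZ, of n] h by (simp add: P_def w_def)
  moreover have "cyclically_reduced w" using cyclically_reduced_power[OF cyc hne] by (simp add: w_def n')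
  moreover have "w \<noteq> []" using hne by (simp add: w_def n')
  ultimately obtain k s t where s: "s \<in> symmetrized R" "0 < t" "t \<le> length s" "t \<le> length w"
    "3 * real (length s) \<le> 4 * real t" "take t (rotate k w) = take t s"
    using long_relator_part by blast
  define h' where "h' = rotate k h"
  have h'geo: "geodesic h'" using geo by (simp add: h'_def)
  define w' where "w' = concat (replicate n h')"
  have w': "take t w' = take t s" using s(6) by (simp add: w_def w'_def h'_def rotate_concat_replicate)
  have lw': "length w' = length w"
    by (simp add: w_def w'_def h'_def length_concat sum_list_replicate map_replicate_const)
  show False
  proof (cases "t \<le> length h'")
    case True
    then have "take t h' = take t s" using w' by (simp add: w'_def n')
    then have "h' = take t s @ drop t h'" by (metis append_take_drop_id)
    then have "t \<le> length s - t"
      using geodesic_half[of "[]" "take t s" "drop t h'" "drop t s"] h'geo s(1,3)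
      by (metis append_Nil append_take_drop_id length_drop length_take min.absorb2)
    then show False using s(2,3,5) by linarith
  next
    case False
    define p where "p = length h'"
    have p: "0 < p" "p < t" using False hne by (auto simp: p_def h'_def)
    have ww: "w' = h' @ concat (replicate n' h')" by (simp add: w'_def n')
    have "take p (take t s) = take p (take t w')" using w' by simp
    then have hs: "take p s = h'" using p ww by (simp add: p_def min_def)
    have wr: "w' = concat (replicate n' h') @ h'"
    proof -
      have "concat (replicate i g) @ g = g @ concat (replicate i g)" for i and g :: "'a word"
        by (induction i) auto
      then show ?thesis by (simp add: ww)
    qed
    have tp: "t - p \<le> length (concat (replicate n' h'))"
      using s(4) lw' ww by (simp add: p_def)
    \<comment> \<open>The power \<open>w'\<close> has period \<open>p\<close>, so what follows the
      first \<open>p\<close> letters of \<open>s\<close> again agrees with the beginning of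
      \<open>w'\<close>.\<close>
    have "take (t - p) (rotate p s) = take (t - p) (drop p s)"
      using p s(3) by (simp add: rotate_drop_take)
    also have "\<dots> = drop p (take t s)" by (simp add: drop_take)
    also have "\<dots> = drop p (take t w')" using w' by simp
    also have "\<dots> = take (t - p) (concat (replicate n' h'))"
    proof -
      have "drop p w' = concat (replicate n' h')" by (simp add: ww p_def)
      then show ?thesis by (simp add: drop_take)
    qed
    also have "\<dots> = take (t - p) w'" using tp by (subst wr) simp
    also have "\<dots> = take (t - p) (take t w')" by simp
    also have "\<dots> = take (t - p) s" unfolding w' by simp
    finally have common: "take (t - p) s = take (t - p) (rotate p s)" by simp
    have "rotate p s \<noteq> s" using noprop[OF s(1)] p s(3) by simp
    then have "real (t - p) < c * real (length s)"
      using common_prefix_short[OF sc s(1) symmetrized_rotate[OF s(1), of p] _ common] s(3) by force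
    also have "\<dots> \<le> 1/20 * real (length s)" using c by (intro mult_right_mono) auto
    finally have "20 * (real t - real p) < real (length s)" using p by (simp add: of_nat_diff)
    moreover have "p \<le> length s - p"
      using geodesic_half[of "[]" "h'" "[]" "drop p s"] h'geo s(1) hs append_take_drop_id[of p s]
      by (simp add: p_def)
    then have "2 * real p \<le> real (length s)" using p s(3) by linarith
    moreover have "0 \<le> real (length s)" by simp
    ultimately show False using s(5) by argo
  qed
qed

text \<open>If a relator straddles the junction of the two geodesics \<open>w\<close> and \<open>map \<sigma> w\<close>, then comparing it with
  the \<open>\<sigma>\<close>-image of its inverse, both read from the junction, yields \<open>s = map \<sigma> (inv_word s)\<close>.\<close>

lemma no_symmetric_junction:
  assumes \<sigma>: "\<And>a. \<sigma> (inv_letter a) = inv_letter (\<sigma> a)"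
    and sym: "\<And>s. s \<in> symmetrized R \<Longrightarrow> map \<sigma> s \<in> symmetrized R"
    and noinv: "\<And>s. s \<in> symmetrized R \<Longrightarrow> map \<sigma> (inv_word s) \<noteq> s"
    and pq: "prefix p w" "prefix q (map \<sigma> w)" and s: "inv_word p @ q @ z \<in> symmetrized R"
    and len: "c * real (length (inv_word p @ q @ z)) \<le> real (length p)"
      "c * real (length (inv_word p @ q @ z)) \<le> real (length q)"
  shows False
proof -
  define s where "s = q @ z @ inv_word p"
  have s': "s \<in> symmetrized R" using symmetrized_swap[OF s] by (simp add: s_def)
  define s1 where "s1 = map \<sigma> (inv_word s)"
  have s1: "s1 \<in> symmetrized R" using sym[OF symmetrized_inv_word[OF s']] by (simp add: s1_def)
  have "s1 \<noteq> s" using noinv[OF s'] by (simp add: s1_def)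
  define j where "j = min (length p) (length q)"
  have "take j s = take j (map \<sigma> w)"
    using pq(2) by (auto simp: prefix_def s_def j_def)
  moreover have "take j s1 = take j (map \<sigma> w)"
  proof -
    have "take j s1 = take j (map \<sigma> p)" by (simp add: s1_def s_def j_def)
    then show ?thesis using pq(1) by (auto simp: prefix_def j_def)
  qed
  ultimately have "real j < c * real (length s)"
    using common_prefix_short[OF sc s' s1 \<open>s1 \<noteq> s\<close>[symmetric], of j]
    by (simp add: s_def s1_def j_def)
  then show False using len by (auto simp: s_def j_def min_def add_ac split: if_splits)
qed

text \<open>The relator part splits into \<open>u1\<close>, \<open>u2\<close>, \<open>u3\<close>
  inside \<open>A2\<close>, \<open>B\<close>, \<open>A1\<close>. Each holds at most half of the
  relator and together they hold 3/4, so once \<open>u2\<close> is seen to have a quarter,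
  \<open>u1\<close> or \<open>u3\<close> has an eighth. Both exceed the piece bound 1/20.\<close>

lemma straddle:
  assumes A: "geodesic (A1 @ A2)" and B: "geodesic B" and len: "length (A1 @ A2) = length B"
    and s: "s \<in> symmetrized R" "0 < t" "t \<le> length s" "3 * real (length s) \<le> 4 * real t"
    and t: "take t (A2 @ B @ A1) = take t s" "t \<le> length (A2 @ B @ A1)"
  obtains (left) p q z where "suffix p (A1 @ A2)" "prefix q B" "p @ q @ z \<in> symmetrized R"
      "c * real (length (p @ q @ z)) \<le> real (length p)" "c * real (length (p @ q @ z)) \<le> real (length q)"
  | (right) p q z where "suffix p B" "prefix q (A1 @ A2)" "p @ q @ z \<in> symmetrized R"
      "c * real (length (p @ q @ z)) \<le> real (length p)" "c * real (length (p @ q @ z)) \<le> real (length q)"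
proof -
  define u1 where "u1 = take t A2"
  define u2 where "u2 = take (t - length A2) B"
  define u3 where "u3 = take (t - length A2 - length B) A1"
  define v where "v = drop t s"
  have ss: "s = u1 @ u2 @ u3 @ v"
    using append_take_drop_id[of t s] unfolding t(1)[symmetric] by (simp add: u1_def u2_def u3_def v_def)
  have tl: "t = length u1 + length u2 + length u3"
    using t(2) by (auto simp: u1_def u2_def u3_def)
  have r2: "u2 @ (u3 @ v @ u1) \<in> symmetrized R" using symmetrized_swap[of u1 "u2 @ u3 @ v"] s(1) ss by simp
  then have r3: "u3 @ (v @ u1 @ u2) \<in> symmetrized R" using symmetrized_swap[of u2 "u3 @ v @ u1"] by simp
  have g1: "2 * length u1 \<le> length s"
    using geodesic_half[of A1 u1 "drop t A2" "u2 @ u3 @ v"] A s(1) ss by (simp add: u1_def)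
  have g2: "2 * length u2 \<le> length s"
    using geodesic_half[of "[]" u2 "drop (t - length A2) B" "u3 @ v @ u1"] B r2 ss by (simp add: u2_def)
  have g3: "2 * length u3 \<le> length s"
    using geodesic_half[of "[]" u3 "drop (t - length A2 - length B) A1 @ A2" "v @ u1 @ u2"] A r3 ss
    by (simp add: u3_def flip: append_assoc)
  have cs: "c * real (length s) \<le> 1/20 * real (length s)" using c by (intro mult_right_mono) auto
  have big: "3 * length s \<le> 4 * t" using s(4) by linarith
  have u2_big: "length s \<le> 4 * length u2"
  proof (cases "u3 = []")
    case True
    then show ?thesis using g1 tl big by simp
  next
    case False
    \<comment> \<open>A part that leaves \<open>B\<close> again contains all of \<open>B\<close>,
      which is as long as \<open>A1\<close> and \<open>A2\<close> together and so makes up at least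
      half of the part.\<close>
    then have "u2 = B" "u1 = A2" by (auto simp: u1_def u2_def u3_def)
    moreover have "length u3 \<le> length A1" by (simp add: u3_def)
    ultimately have "length u1 + length u3 \<le> length u2" using len by simp
    then show ?thesis using tl big by linarith
  qed
  have sne: "0 < length s" using s(2,3) by linarith
  show thesis
  proof (cases "length s \<le> 8 * length u1")
    case True
    have "u2 \<noteq> []" using u2_big sne by auto
    then have "u1 = A2" by (auto simp: u1_def u2_def)
    show thesis
    proof (rule left[of u1 u2 "u3 @ v"])
      show "suffix u1 (A1 @ A2)" using \<open>u1 = A2\<close> by (simp add: suffix_def)
      show "prefix u2 B" by (simp add: u2_def take_is_prefix)
      show "u1 @ u2 @ u3 @ v \<in> symmetrized R" using s(1) ss by simp
      show "c * real (length (u1 @ u2 @ u3 @ v)) \<le> real (length u1)"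
        unfolding ss[symmetric] using cs True by linarith
      show "c * real (length (u1 @ u2 @ u3 @ v)) \<le> real (length u2)"
        unfolding ss[symmetric] using cs u2_big by linarith
    qed
  next
    case False
    then have u3_big: "length s \<le> 8 * length u3" using g2 tl big by linarith
    then have "u3 \<noteq> []" using sne by auto
    then have "u2 = B" by (auto simp: u2_def u3_def)
    have l: "length (u2 @ u3 @ v @ u1) = length s" by (simp add: ss)
    show thesis
    proof (rule right[of u2 u3 "v @ u1"])
      show "suffix u2 B" using \<open>u2 = B\<close> by simp
      show "prefix u3 (A1 @ A2)" unfolding u3_def using take_is_prefix prefix_prefix by blast
      show "u2 @ u3 @ v @ u1 \<in> symmetrized R" using r2 by simp
      show "c * real (length (u2 @ u3 @ v @ u1)) \<le> real (length u2)"
        unfolding l using cs u2_big by linarith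
      show "c * real (length (u2 @ u3 @ v @ u1)) \<le> real (length u3)"
        unfolding l using cs u3_big by linarith
    qed
  qed
qed

text \<open>Non-geodesic words are shortened and fixed letters are stripped from either end, by
  induction on the length. The geometric argument enters only for a geodesic with both end letters
  moved, where no cancellation occurs at the two junctions.\<close>

lemma fixed_class:
  assumes \<sigma>: "\<And>a. \<sigma> (inv_letter a) = inv_letter (\<sigma> a)"
    and \<sigma>Z: "\<And>a. fst a \<in> Z \<Longrightarrow> fst (\<sigma> a) \<in> Z"
    and sym: "\<And>s. s \<in> symmetrized R \<Longrightarrow> map \<sigma> s \<in> symmetrized R"
    and noinv: "\<And>s. s \<in> symmetrized R \<Longrightarrow> map \<sigma> (inv_word s) \<noteq> s"
    and cong: "\<And>u v. u \<in> words_over Z \<Longrightarrow> v \<in> words_over Z \<Longrightarrow> cls u = cls v \<Longrightarrow> cls (map \<sigma> u) = cls (map \<sigma> v)"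
    and w: "w \<in> words_over Z" "cls (map \<sigma> w) = cls w"
  obtains u where "u \<in> words_over Z" "cls u = cls w" "\<And>a. a \<in> set u \<Longrightarrow> \<sigma> a = a"
  using w
proof (induction "length w" arbitrary: w thesis rule: less_induct)
  case less
  interpret group G by (rule G_group)
  have \<sigma>w: "map \<sigma> x \<in> words_over Z" if "x \<in> words_over Z" for x
    using that \<sigma>Z by (induction x) auto
  have inv\<sigma>: "inv_word (map \<sigma> x) = map \<sigma> (inv_word x)" for x
    using \<sigma> by (simp add: inv_word_def rev_map)
  consider "\<not> geodesic w" | "geodesic w" "w = []"
    | "geodesic w" "w \<noteq> []" "\<sigma> (hd w) = hd w" | "geodesic w" "w \<noteq> []" "\<sigma> (last w) = last w"
    | "geodesic w" "w \<noteq> []" "\<sigma> (hd w) \<noteq> hd w" "\<sigma> (last w) \<noteq> last w" by blast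
  then show ?case
  proof cases
    case 1
    then obtain w' where w': "w' \<in> words_over Z" "cls w' = cls w" "length w' < length w"
      using less.prems(2) unfolding geodesic_def by (metis not_le)
    have "cls (map \<sigma> w') = cls (map \<sigma> w)" using cong w' less.prems(2) by blast
    then show ?thesis using less.hyps[OF w'(3)] w' less.prems by metis
  next
    case 2
    then show ?thesis using less.prems(1)[of "[]"] by simp
  next
    case 3
    then obtain a y where y: "w = a # y" "\<sigma> a = a" by (cases w) auto
    have ay: "[a] \<in> words_over Z" "y \<in> words_over Z" using less.prems(2) y by auto
    have "cls (map \<sigma> y) = cls y"
      using cls_append_cancel[of "[a]" "map \<sigma> y" y] less.prems(3) y ay \<sigma>w by simp
    then obtain u where "u \<in> words_over Z" "cls u = cls y" "\<And>a. a \<in> set u \<Longrightarrow> \<sigma> a = a"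
      using less.hyps[of y] y ay by auto
    then show ?thesis
      using less.prems(1)[of "a # u"] cls_cong_append[of "[a]" "[a]" u y] ay y by auto
  next
    case 4
    then obtain a y where y: "w = y @ [a]" "\<sigma> a = a" by (cases w rule: rev_cases) auto
    have ay: "[a] \<in> words_over Z" "y \<in> words_over Z" using less.prems(2) y by auto
    have "cls (map \<sigma> y) = cls y"
      using cls_append_cancel_right[of "map \<sigma> y" "[a]" y] less.prems(3) y ay \<sigma>w by simp
    then obtain u where "u \<in> words_over Z" "cls u = cls y" "\<And>a. a \<in> set u \<Longrightarrow> \<sigma> a = a"
      using less.hyps[of y] y ay by auto
    then show ?thesis
      using less.prems(1)[of "u @ [a]"] cls_cong_append[of u y "[a]" "[a]"] ay y by auto
  next
    case 5
    let ?A = "inv_word w" and ?B = "map \<sigma> w"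
    have geoA: "geodesic ?A" using geodesic_inv_word 5(1) .
    have geoB: "geodesic ?B"
      using 5(1) less.prems(3) \<sigma>w by (simp add: geodesic_def)
    have "cyclically_reduced (?A @ ?B)"
      using geodesic_reduced[OF geoA] geodesic_reduced[OF geoB] 5
      by (auto simp: cyclically_reduced_def reduced_append hd_inv_word last_inv_word hd_map last_map inv_letter_inject)
    moreover have "cls (?A @ ?B) = \<one>\<^bsub>G\<^esub>"
      using cls_eq_iff[of w ?B] less.prems \<sigma>w by simp
    moreover have "?A @ ?B \<in> words_over Z" "?A @ ?B \<noteq> []" using less.prems(2) \<sigma>w 5 by auto
    ultimately obtain k s t where s: "s \<in> symmetrized R" "0 < t" "t \<le> length s" "t \<le> length (?A @ ?B)"
      "3 * real (length s) \<le> 4 * real t" "take t (rotate k (?A @ ?B)) = take t s"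
      using long_relator_part by blast
    have J1: False if "suffix p ?A" "prefix q ?B" "p @ q @ z \<in> symmetrized R"
      "c * real (length (p @ q @ z)) \<le> real (length p)" "c * real (length (p @ q @ z)) \<le> real (length q)" for p q z
    proof -
      have "prefix (inv_word p) w"
        using that(1) by (auto simp: suffix_def prefix_def) (metis inv_word_append inv_word_inv_word)
      then show False
        using no_symmetric_junction[OF \<sigma> sym noinv, of "inv_word p" w q z] that by simp
    qed
    \<comment> \<open>The junction of \<open>map \<sigma> w\<close> with \<open>inv_word w\<close>
      is the first kind of junction for the word \<open>inv_word w\<close> and the inverse
      relator.\<close>
    have J2: False if "suffix p ?B" "prefix q ?A" "p @ q @ z \<in> symmetrized R"
      "c * real (length (p @ q @ z)) \<le> real (length p)" "c * real (length (p @ q @ z)) \<le> real (length q)" for p q z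
    proof -
      have "prefix (inv_word p) (map \<sigma> ?A)"
        using that(1) unfolding inv\<sigma>[symmetric] by (auto simp: suffix_def prefix_def)
      moreover have "inv_word q @ inv_word p @ inv_word z \<in> symmetrized R"
        using symmetrized_swap[of "inv_word z" "inv_word q @ inv_word p"] symmetrized_inv_word[OF that(3)] by simp
      ultimately show False
        using no_symmetric_junction[OF \<sigma> sym noinv, of q ?A "inv_word p" "inv_word z"] that
        by (simp add: add_ac)
    qed
    obtain C1 C2 where C: "?A @ ?B = C1 @ C2" "rotate k (?A @ ?B) = C2 @ C1" using rotate_split .
    have tl: "t \<le> length (C2 @ C1)" using s(4) C(1) by (metis add.commute length_append)
    \<comment> \<open>The rotation starts inside \<open>?A\<close> or inside \<open>?B\<close>, and
      the two geodesics exchange their roles accordingly.\<close>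
    from C(1) consider (a) y where "?A = C1 @ y" "C2 = y @ ?B" | (b) y where "C1 = ?A @ y" "?B = y @ C2"
      by (auto simp: append_eq_append_conv2)
    then show ?thesis
    proof cases
      case a
      have len: "length (C1 @ y) = length ?B" using arg_cong[OF a(1), of length] by simp
      have t1: "take t (y @ ?B @ C1) = take t s" "t \<le> length (y @ ?B @ C1)"
        using s(6) tl unfolding C(2) a(2) by simp_all
      show ?thesis
        by (rule straddle[OF geoA[unfolded a(1)] geoB len s(1-3,5) t1])
          (use J1[unfolded a(1)] J2[unfolded a(1)] in blast)+
    next
      case b
      have len: "length (y @ C2) = length ?A" using arg_cong[OF b(2), of length] by simp
      have t1: "take t (C2 @ ?A @ y) = take t s" "t \<le> length (C2 @ ?A @ y)"
        using s(6) tl unfolding C(2) b(1) by simp_all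
      show ?thesis
        by (rule straddle[OF geoB[unfolded b(2)] geoA len s(1-3,5) t1])
          (use J1[unfolded b(2)] J2[unfolded b(2)] in blast)+
    qed
  qed
qed

end

section \<open>Relators with blocks of pairwise distinct lengths\<close>

definition blocks :: "'x \<Rightarrow> 'x \<Rightarrow> nat list \<Rightarrow> 'x list" where
  "blocks x y as = concat (map (\<lambda>a. x # replicate a y) as)"

text \<open>A power enclosed by \<open>x\<close> on both sides, so that its exponent can be read off
  inside a longer word.\<close>

definition block_pattern :: "'x \<Rightarrow> 'x \<Rightarrow> nat \<Rightarrow> 'x list" where
  "block_pattern x y a = x # replicate a y @ [x]"

lemma blocks_simps [simp]:
  "blocks x y [] = []" "blocks x y (a # as) = x # replicate a y @ blocks x y as"
  "blocks x y (as @ bs) = blocks x y as @ blocks x y bs"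
  by (simp_all add: blocks_def)

lemma length_block_pattern [simp]: "length (block_pattern x y a) = a + 2"
  by (simp add: block_pattern_def)

lemma set_blocks: "set (blocks x y as) \<subseteq> {x, y}"
  by (induction as) auto

lemma blocks_Cons_Cons: "prefix (block_pattern x y a) (blocks x y (a # a' # as))"
  by (simp add: block_pattern_def prefix_def)

lemma replicate_append_Cons_inj:
  assumes "replicate a y @ x # v = replicate b y @ w" "x \<noteq> y" "w = [] \<or> hd w \<noteq> y"
  shows "a = b"
  using assms
proof (induction a arbitrary: b)
  case 0
  then show ?case by (cases b) auto
next
  case (Suc a)
  then show ?case
  proof (cases b)
    case 0
    then show ?thesis using Suc.prems by (cases w) auto
  qed (use Suc in auto)
qed

lemma hd_blocks: "blocks x y as = [] \<or> hd (blocks x y as) = x"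
  by (cases as) auto

text \<open>For \<open>a \<ge> 2\<close> the pattern contains a repeated letter. As no exponent is
  0, only \<open>y\<close> is ever repeated in a block word, so the letters are determined before
  exponents are compared.\<close>

lemma block_pattern_occurrence:
  assumes "blocks x y as = u @ block_pattern x' y' a @ v" "x \<noteq> y" "x' \<noteq> y'" "2 \<le> a" "0 \<notin> set as"
  shows "x' = x \<and> y' = y \<and> (\<exists>as1 as2. as = as1 @ a # as2 \<and> u = blocks x y as1)"
  using assms(1,5)
proof (induction as arbitrary: u)
  case Nil
  then show ?case by (simp add: block_pattern_def)
next
  case (Cons a0 as)
  obtain a1 where a1: "a0 = Suc a1" using Cons.prems(2) by (cases a0) auto
  obtain d where d: "a = Suc (Suc d)" using assms(4) by (cases a; cases "a - 1") auto
  show ?case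
  proof (cases u)
    case Nil
    have eq: "replicate a y' @ x' # v = replicate a0 y @ blocks x y as" and x: "x' = x"
      using Cons.prems(1) Nil by (auto simp: block_pattern_def)
    have "y' = y" using arg_cong[OF eq, of hd] by (simp add: a1 d)
    then have "a = a0"
      using replicate_append_Cons_inj[of a y x' v a0 "blocks x y as"] eq x assms(2) hd_blocks[of x y as] by auto
    then show ?thesis using x \<open>y' = y\<close> Nil
      by (intro conjI exI[of _ "[]"] exI[of _ as]) simp_all
  next
    case (Cons z u')
    have z: "z = x" and eq: "replicate a0 y @ blocks x y as = u' @ block_pattern x' y' a @ v"
      using Cons.prems(1) Cons by auto
    from eq obtain w where "replicate a0 y = u' @ w \<and> w @ blocks x y as = block_pattern x' y' a @ v \<or>
        replicate a0 y @ w = u' \<and> blocks x y as = w @ block_pattern x' y' a @ v"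
      by (auto simp: append_eq_append_conv2)
    then consider (longer) u'' where "u' = replicate a0 y @ u''" "blocks x y as = u'' @ block_pattern x' y' a @ v"
      | (shorter) w where "replicate a0 y = u' @ w" "w \<noteq> []" "w @ blocks x y as = block_pattern x' y' a @ v"
      by (cases "w = []") auto
    then show ?thesis
    proof cases
      case longer
      then obtain as1 as2 where "x' = x" "y' = y" "as = as1 @ a # as2" "u'' = blocks x y as1"
        using Cons.IH Cons.prems(2) by auto
      then show ?thesis using longer Cons z
        by (intro conjI exI[of _ "a0 # as1"] exI[of _ as2]) auto
    next
      case shorter
      have "set w \<subseteq> {y}" using shorter(1) by (metis set_append set_replicate_conv_if Un_subset_iff subset_singleton_iff order_refl)
      obtain w' where w': "w = y # w'" using shorter(2) \<open>set w \<subseteq> {y}\<close> by (cases w) auto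
      then have x': "x' = y" using shorter(3) by (simp add: block_pattern_def)
      have rest: "w' @ blocks x y as = replicate a y' @ x' # v"
        using shorter(3) unfolding w' by (auto simp: block_pattern_def)
      show ?thesis
      proof (cases w')
        case Nil
        then obtain a2 bs where as: "as = a2 # bs" using rest by (cases as) (auto simp: d)
        then obtain a3 where "a2 = Suc a3" using Cons.prems(2) by (cases a2) auto
        then have "y' = x" "y' = y" using rest Nil as by (auto simp: d)
        then show ?thesis using assms(2) by simp
      next
        case (Cons z' w'')
        then have "z' = y" using \<open>set w \<subseteq> {y}\<close> w' by simp
        then have "y' = y" using rest Cons by (simp add: d)
        then show ?thesis using assms(3) x' by simp
      qed
    qed
  qed
qed

text \<open>A cut damages at most one block, \<open>as0\<close>, and leaves only a power of
  \<open>y\<close> of it on the right.\<close>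

lemma blocks_cut:
  assumes "n \<le> length (blocks x y as)" and "\<And>a. a \<in> set as \<Longrightarrow> a \<le> K"
  obtains as1 as0 as2 e z where "as = as1 @ as0 @ as2" "length as0 \<le> 1" "e \<le> K"
    "take n (blocks x y as) = blocks x y as1 @ z" "drop n (blocks x y as) = replicate e y @ blocks x y as2"
  using assms
proof (induction as arbitrary: n thesis)
  case Nil
  then show ?case using Nil(1)[of "[]" "[]" "[]" 0 "[]"] by simp
next
  case (Cons a as)
  show ?case
  proof (cases "n = 0")
    case True
    then show ?thesis using Cons.prems(1)[of "[]" "[]" "a # as" 0 "[]"] by simp
  next
    case False
    then obtain n' where n': "n = Suc n'" by (cases n) auto
    show ?thesis
    proof (cases "n' \<le> a")
      case True
      have "drop n (blocks x y (a # as)) = replicate (a - n') y @ blocks x y as"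
        using True by (simp add: n')
      then show ?thesis
        using Cons.prems(1)[of "[]" "[a]" as "a - n'" "take n (blocks x y (a # as))"] Cons.prems(3)[of a] by simp
    next
      case False
      have "n' - a \<le> length (blocks x y as)" using Cons.prems(2) by (simp add: n')
      then obtain as1 as0 as2 e z where *: "as = as1 @ as0 @ as2" "length as0 \<le> 1" "e \<le> K"
        "take (n' - a) (blocks x y as) = blocks x y as1 @ z" "drop (n' - a) (blocks x y as) = replicate e y @ blocks x y as2"
        using Cons.IH Cons.prems(3) by (metis list.set_intros(2))
      show ?thesis
        using Cons.prems(1)[of "a # as1" as0 as2 e z] * False by (simp add: n')
    qed
  qed
qed

lemma rotate_mod_eq: "rotate j (rotate n w) = rotate ((j + n) mod length w) w"
  by (metis rotate_conv_mod rotate_rotate)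

lemma prefix_drop_rotate:
  assumes "prefix u (drop j w)" "u \<noteq> []"
  shows "prefix u (rotate j w)"
proof -
  have "j < length w" using assms by (cases "j < length w") auto
  then show ?thesis using assms(1) by (simp add: rotate_drop_take prefix_append)
qed

lemma mod_add_left_cancel:
  fixes j n n' l :: nat
  assumes "(j + n) mod l = (j + n') mod l" "0 < l"
  shows "n mod l = n' mod l"
proof -
  \<comment> \<open>Adding \<open>(l - 1) * j\<close> turns the summand \<open>j\<close> into a
    multiple of \<open>l\<close>, in place of a subtraction.\<close>
  have "((l - 1) * j + (j + n)) mod l = ((l - 1) * j + (j + n')) mod l"
    using assms(1) by (metis mod_add_right_eq)
  moreover have "(l - 1) * j + (j + k) = k + l * j" for k using assms(2) by (cases l) auto
  ultimately have "(n + l * j) mod l = (n' + l * j) mod l" by (simp only:)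
  then show ?thesis by simp
qed

text \<open>Exponents above \<open>L\<close> make a pattern longer than any base \<open>b i\<close>,
  whose end letters lie outside \<open>T\<close>. Four blocks ensure that after any cut two
  consecutive ones survive on one side. Disjoint exponents are asked for equal \<open>q\<close>
  because a pattern already reveals \<open>q\<close>.\<close>

locale block_relators =
  fixes I :: "'i set" and b :: "'i \<Rightarrow> 'a word" and p q :: "'i \<Rightarrow> 'a" and as :: "'i \<Rightarrow> nat list"
    and T :: "'a set" and L K :: nat and c :: real
  assumes b: "\<And>i. i \<in> I \<Longrightarrow> b i \<noteq> []" "\<And>i. i \<in> I \<Longrightarrow> length (b i) \<le> L" "\<And>i. i \<in> I \<Longrightarrow> reduced (b i)"
      "\<And>i. i \<in> I \<Longrightarrow> fst (hd (b i)) \<notin> T" "\<And>i. i \<in> I \<Longrightarrow> fst (last (b i)) \<notin> T"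
    and pq: "\<And>i. i \<in> I \<Longrightarrow> p i \<in> T" "\<And>i. i \<in> I \<Longrightarrow> q i \<in> T" "\<And>i. i \<in> I \<Longrightarrow> p i \<noteq> q i"
    and as: "\<And>i. i \<in> I \<Longrightarrow> distinct (as i)" "\<And>i. i \<in> I \<Longrightarrow> 4 \<le> length (as i)"
      "\<And>i a. i \<in> I \<Longrightarrow> a \<in> set (as i) \<Longrightarrow> L < a" "\<And>i a. i \<in> I \<Longrightarrow> a \<in> set (as i) \<Longrightarrow> a \<le> K"
    and as_disjoint: "\<And>i j. i \<in> I \<Longrightarrow> j \<in> I \<Longrightarrow> i \<noteq> j \<Longrightarrow> q i = q j \<Longrightarrow> set (as i) \<inter> set (as j) = {}"
    and long: "\<And>i. i \<in> I \<Longrightarrow>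
      real (3 * K + L + 5) \<le> c * real (length (b i @ blocks (p i, True) (q i, True) (as i)))"
    and c_le_1: "c \<le> 1"
begin

definition tail_part :: "'i \<Rightarrow> 'a word" where
  "tail_part i = blocks (p i, True) (q i, True) (as i)"

definition rel :: "'i \<Rightarrow> 'a word" where
  "rel i = b i @ tail_part i"

text \<open>A window of this length in a cyclic relator always contains a pattern: at worst it
  passes a damaged tail end of at most \<open>2 * K + 1\<close> letters, then the base, then a
  pattern of at most \<open>K + 2\<close>.\<close>

abbreviation "m \<equiv> 3 * K + L + 5"

lemma L_pos: "i \<in> I \<Longrightarrow> 0 < L"
  using b(1,2)[of i] by (cases "b i") auto

lemma tail_part_set: "set (tail_part i) \<subseteq> {(p i, True), (q i, True)}"
  unfolding tail_part_def by (rule set_blocks)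

lemma tail_part_ne: "i \<in> I \<Longrightarrow> tail_part i \<noteq> []"
  using as(2)[of i] by (cases "as i") (auto simp: tail_part_def)

lemma rel_long:
  assumes "i \<in> I"
  shows "real m \<le> c * real (length (rel i))" "m \<le> length (rel i)"
proof -
  show *: "real m \<le> c * real (length (rel i))" using long[OF assms] by (simp add: rel_def tail_part_def)
  have "c * real (length (rel i)) \<le> 1 * real (length (rel i))"
    using c_le_1 by (intro mult_right_mono) auto
  then show "m \<le> length (rel i)" using * by linarith
qed

lemma rel_cyclically_reduced:
  assumes i: "i \<in> I"
  shows "cyclically_reduced (rel i)"
proof -
  have "successively (\<lambda>a b. b \<noteq> inv_letter a) w" if "set w \<subseteq> {(p i, True), (q i, True)}" for w
    using that by (induction w rule: induct_list012) (auto simp: inv_letter_def)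
  then have "reduced (tail_part i)" using tail_part_set by (simp add: reduced_def)
  moreover have "fst (hd (tail_part i)) \<in> T" "fst (last (tail_part i)) \<in> T"
    using tail_part_set[of i] hd_in_set[OF tail_part_ne[OF i]] last_in_set[OF tail_part_ne[OF i]] pq[OF i] by auto
  ultimately show ?thesis
    using b[OF i] tail_part_ne[OF i]
    by (auto simp: rel_def cyclically_reduced_def reduced_append inv_letter_def)
qed

text \<open>A pattern starting in the base would reach the last letter of the base, and one running
  beyond the tail would meet its first letter; neither belongs to \<open>T\<close>. So the pattern
  lies in the tail.\<close>

lemma pattern_unique:
  assumes i: "i \<in> I" and n: "n < length (rel i)" and a: "L < a" and pq': "p' \<in> T" "q' \<in> T" "p' \<noteq> q'"
    and pre: "prefix (block_pattern (p', True) (q', True) a) (rotate n (rel i))"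
  obtains as1 as2 where "q' = q i" "as i = as1 @ a # as2"
    "n = length (b i) + length (blocks (p i, True) (q i, True) as1)"
proof -
  let ?\<pi> = "block_pattern (p', True) (q', True) a"
  have \<pi>T: "fst z \<in> T" if "z \<in> set ?\<pi>" for z using that pq' by (auto simp: block_pattern_def split: if_splits)
  have rot: "rotate n (rel i) = drop n (rel i) @ take n (rel i)" using n by (simp add: rotate_drop_take)
  obtain v where v: "rotate n (rel i) = ?\<pi> @ v" using pre by (auto simp: prefix_def)
  have nth: "fst (rotate n (rel i) ! j) \<in> T" if "j < a + 2" for j
  proof -
    have "rotate n (rel i) ! j = ?\<pi> ! j" using that unfolding v by (simp add: nth_append)
    then show ?thesis using \<pi>T[of "?\<pi> ! j"] that by simp
  qed
  have "length (b i) \<le> n"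
  proof (rule ccontr)
    assume nb: "\<not> length (b i) \<le> n"
    let ?j = "length (b i) - 1 - n"
    have "rotate n (rel i) ! ?j = last (b i)"
      using nb unfolding rot by (simp add: rel_def nth_append last_conv_nth b(1)[OF i])
    moreover have "?j < a + 2" using b(2)[OF i] a by linarith
    ultimately show False using nth[of ?j] b(5)[OF i] by simp
  qed
  then obtain n' where n': "n = length (b i) + n'" by (metis le_add_diff_inverse)
  have n'l: "n' < length (tail_part i)" using n by (simp add: rel_def n')
  have rot': "rotate n (rel i) = drop n' (tail_part i) @ b i @ take n' (tail_part i)"
    unfolding rot by (simp add: rel_def n')
  have "a + 2 \<le> length (drop n' (tail_part i))"
  proof (rule ccontr)
    let ?j = "length (drop n' (tail_part i))"
    assume "\<not> a + 2 \<le> ?j"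
    then have "fst (rotate n (rel i) ! ?j) \<in> T" using nth by simp
    moreover have "rotate n (rel i) ! ?j = hd (b i)"
      unfolding rot' using b(1)[OF i] by (simp add: nth_append hd_conv_nth)
    ultimately show False using b(4)[OF i] by simp
  qed
  then have "take (a + 2) (?\<pi> @ v) = take (a + 2) (drop n' (tail_part i))"
    unfolding v[symmetric] rot' by simp
  then have "drop n' (tail_part i) = ?\<pi> @ drop (a + 2) (drop n' (tail_part i))"
    by (metis append_take_drop_id append_eq_conv_conj length_block_pattern)
  then have "blocks (p i, True) (q i, True) (as i) = take n' (tail_part i) @ ?\<pi> @ drop (a + 2) (drop n' (tail_part i))"
    unfolding tail_part_def by (metis append_take_drop_id)
  moreover have "(0::nat) \<notin> set (as i)" using as(3)[OF i, of 0] by auto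
  moreover have "2 \<le> a" using a L_pos[OF i] by simp
  ultimately obtain as1 as2 where *: "(q', True) = (q i, True)" "as i = as1 @ a # as2"
    "take n' (tail_part i) = blocks (p i, True) (q i, True) as1"
    using block_pattern_occurrence[of "(p i, True)" "(q i, True)" "as i" "take n' (tail_part i)" "(p', True)" "(q', True)" a]
      pq(3)[OF i] pq'(3) by blast
  have "n' = length (take n' (tail_part i))" using n'l by simp
  then show thesis using that[OF _ *(2)] *(1,3) n' by simp
qed

lemma pattern_exists:
  assumes i: "i \<in> I"
  obtains j a where "a \<in> set (as i)" "j + a + 2 \<le> m"
    "prefix (block_pattern (p i, True) (q i, True) a) (drop j (rotate n (rel i)))"
proof -
  let ?x = "(p i, True)" and ?y = "(q i, True)"
  define n0 where "n0 = n mod length (rel i)"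
  have "0 < length (rel i)" using b(1)[OF i] by (simp add: rel_def)
  then have n0: "n0 < length (rel i)" by (simp add: n0_def)
  have rot: "rotate n (rel i) = drop n0 (rel i) @ take n0 (rel i)"
    by (simp add: rotate_drop_take n0_def)
  have "Suc (Suc 0) \<le> length (as i)" using as(2)[OF i] by linarith
  then obtain a0 a1 as' where asi: "as i = a0 # a1 # as'"
    by (auto simp: Suc_le_length_iff)
  have aK: "a \<le> K" if "a \<in> set (as i)" for a using as(4)[OF i that] .
  show thesis
  proof (cases "n0 \<le> length (b i)")
    case True
    have "rotate n (rel i) = drop n0 (b i) @ tail_part i @ take n0 (b i)"
      unfolding rot using True by (simp add: rel_def)
    then have "drop (length (b i) - n0) (rotate n (rel i)) = tail_part i @ take n0 (b i)"
      using True by simp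
    moreover have "prefix (block_pattern ?x ?y a0) (tail_part i)"
      unfolding tail_part_def asi by (rule blocks_Cons_Cons)
    ultimately show thesis
      using that[of a0 "length (b i) - n0"] aK[of a0] b(2)[OF i] asi by (simp add: prefix_append)
  next
    case False
    then obtain n' where n': "n0 = length (b i) + n'" by (metis le_add_diff_inverse nat_le_linear)
    have n'l: "n' \<le> length (tail_part i)" using n0 by (simp add: rel_def n')
    have rot': "rotate n (rel i) = drop n' (tail_part i) @ b i @ take n' (tail_part i)"
      unfolding rot by (simp add: rel_def n')
    obtain as1 as0 as2 e z where cut: "as i = as1 @ as0 @ as2" "length as0 \<le> 1" "e \<le> K"
      "take n' (tail_part i) = blocks ?x ?y as1 @ z" "drop n' (tail_part i) = replicate e ?y @ blocks ?x ?y as2"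
      using blocks_cut[OF n'l[unfolded tail_part_def] aK] unfolding tail_part_def by metis
    show thesis
    proof (cases "2 \<le> length as2")
      case True
      then obtain d d' as2' where as2: "as2 = d # d' # as2'"
        by (auto simp: Suc_le_length_iff numeral_2_eq_2)
      have "drop e (rotate n (rel i)) = blocks ?x ?y as2 @ b i @ take n' (tail_part i)"
        unfolding rot' cut(5) by simp
      moreover have "d \<in> set (as i)" using cut(1) as2 by simp
      moreover have "prefix (block_pattern ?x ?y d) (blocks ?x ?y as2)"
        unfolding as2 by (rule blocks_Cons_Cons)
      ultimately show thesis
        using that[of d e] aK[of d] cut(3) prefix_prefix by simp
    next
      \<comment> \<open>At most one block remains behind the cut and at most one is damaged, so two
        lie before it. They are reached through the rest of the tail and the base.\<close>
      case False
      have "length (as i) = length as1 + length as0 + length as2" unfolding cut(1) by simp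
      then have "2 \<le> length as1" using False cut(2) as(2)[OF i] by linarith
      then obtain d d' as1' where as1: "as1 = d # d' # as1'"
        by (auto simp: Suc_le_length_iff numeral_2_eq_2)
      let ?j = "length (drop n' (tail_part i)) + length (b i)"
      have "length (blocks ?x ?y as2) \<le> K + 1"
        using False aK cut(1) by (cases as2; cases "tl as2") auto
      then have "length (drop n' (tail_part i)) \<le> 2 * K + 1" unfolding cut(5) using cut(3) by simp
      then have "?j \<le> 2 * K + 1 + L" using b(2)[OF i] by linarith
      moreover have "drop ?j (rotate n (rel i)) = blocks ?x ?y as1 @ z"
        unfolding rot' cut(4) by simp
      moreover have "d \<in> set (as i)" using cut(1) as1 by simp
      moreover have "prefix (block_pattern ?x ?y d) (blocks ?x ?y as1)"
        unfolding as1 by (rule blocks_Cons_Cons)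
      ultimately show thesis
        using that[of d ?j] aK[of d] prefix_prefix by simp
    qed
  qed
qed

text \<open>The second letter of the pattern and its exponent identify the relator, and since
  exponents do not repeat within a relator, they also identify the position.\<close>

lemma rotations_determined:
  assumes i: "i \<in> I" and i': "i' \<in> I" and eq: "take m (rotate n (rel i)) = take m (rotate n' (rel i'))"
  shows "i = i'" "n mod length (rel i) = n' mod length (rel i)"
proof -
  obtain j a where ja: "a \<in> set (as i)" "j + a + 2 \<le> m"
    "prefix (block_pattern (p i, True) (q i, True) a) (drop j (rotate n (rel i)))"
    using pattern_exists[OF i] .
  let ?\<pi> = "block_pattern (p i, True) (q i, True) a"
  have "?\<pi> = take (a + 2) (drop j (rotate n (rel i)))"
    using ja(3) by (auto simp: prefix_def)
  also have "\<dots> = drop j (take (j + a + 2) (take m (rotate n (rel i))))"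
    using ja(2) by (simp add: drop_take min_absorb1 add.assoc)
  also have "\<dots> = take (a + 2) (drop j (rotate n' (rel i')))"
    unfolding eq using ja(2) by (simp add: drop_take min_absorb1 add.assoc)
  finally have "prefix ?\<pi> (drop j (rotate n' (rel i')))" by (metis take_is_prefix)
  then have 2: "prefix ?\<pi> (rotate ((j + n') mod length (rel i')) (rel i'))"
    unfolding rotate_mod_eq[symmetric] by (rule prefix_drop_rotate) (simp add: block_pattern_def)
  have 1: "prefix ?\<pi> (rotate ((j + n) mod length (rel i)) (rel i))"
    unfolding rotate_mod_eq[symmetric] by (rule prefix_drop_rotate[OF ja(3)]) (simp add: block_pattern_def)
  have pos: "0 < length (rel k)" if "k \<in> I" for k using rel_long(2)[OF that] by linarith
  have La: "L < a" using as(3)[OF i ja(1)] .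
  obtain as1 as2 where 11: "as i = as1 @ a # as2"
    "(j + n) mod length (rel i) = length (b i) + length (blocks (p i, True) (q i, True) as1)"
    using pattern_unique[OF i mod_less_divisor[OF pos[OF i]] La pq[OF i] 1] by metis
  obtain bs1 bs2 where 22: "q i = q i'" "as i' = bs1 @ a # bs2"
    "(j + n') mod length (rel i') = length (b i') + length (blocks (p i', True) (q i', True) bs1)"
    using pattern_unique[OF i' mod_less_divisor[OF pos[OF i']] La pq[OF i] 2] by metis
  have "a \<in> set (as i) \<inter> set (as i')" using 11 22 by simp
  then show "i = i'" using as_disjoint[OF i i'] 22(1) by auto
  have "a \<notin> set as1" "a \<notin> set as2"
    using as(1)[OF i] 11(1) by auto
  moreover have "as1 @ a # as2 = bs1 @ a # bs2" using 11(1) 22(2) \<open>i = i'\<close> by simp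
  ultimately have "as1 = bs1" using append_Cons_eq_iff by metis
  then have "(j + n) mod length (rel i) = (j + n') mod length (rel i)"
    using 11 22 \<open>i = i'\<close> by simp
  then show "n mod length (rel i) = n' mod length (rel i)"
    by (rule mod_add_left_cancel) (rule pos[OF i])
qed

abbreviation "R \<equiv> rel ` I"

text \<open>A rotation of an inverse is the inverse of a rotation, so two shapes suffice.\<close>

lemma symmetrized_cases:
  assumes "s \<in> symmetrized R"
  obtains (pos) i n where "i \<in> I" "s = rotate n (rel i)"
    | (neg) i n where "i \<in> I" "s = inv_word (rotate n (rel i))"
proof -
  obtain n r where r: "r \<in> R \<union> inv_word ` R" "s = rotate n r"
    using assms unfolding symmetrized_def by blast
  show thesis
  proof (cases "r \<in> R")
    case True
    then show thesis using pos r(2) by blast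
  next
    case False
    then obtain i where i: "i \<in> I" "r = inv_word (rel i)" using r(1) by blast
    obtain u v where uv: "r = u @ v" "rotate n r = v @ u" using rotate_split .
    have "rel i = inv_word r" using i(2) by simp
    then have "rel i = inv_word v @ inv_word u" using uv by simp
    then have "rotate (length (inv_word v)) (rel i) = inv_word u @ inv_word v" by (simp only: rotate_append)
    then have "s = inv_word (rotate (length (inv_word v)) (rel i))"
      using r(2) uv(2) by simp
    then show thesis using neg i(1) by blast
  qed
qed

lemma symmetrized_long:
  assumes "s \<in> symmetrized R"
  shows "m \<le> length s" "real m \<le> c * real (length s)"
  using assms by (cases rule: symmetrized_cases; use rel_long in force)+

section \<open>Counting the letters of \<open>T\<close> by sign\<close>

definition num_letters :: "bool \<Rightarrow> 'a word \<Rightarrow> nat" where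
  "num_letters s w = length (filter (\<lambda>x. fst x \<in> T \<and> snd x = s) w)"

lemma num_letters_append: "num_letters s (u @ v) = num_letters s u + num_letters s v"
  by (simp add: num_letters_def)

lemma num_letters_rotate: "num_letters s (rotate n w) = num_letters s w"
  by (rule rotate_split[of w n]) (simp add: num_letters_append)

lemma num_letters_inv_word: "num_letters s (inv_word w) = num_letters (\<not> s) w"
  by (induction w) (auto simp: num_letters_def inv_word_Cons inv_letter_def)

lemma num_letters_le: "num_letters s w \<le> length w"
  by (simp add: num_letters_def)

lemma num_letters_positive:
  assumes "set w \<subseteq> T \<times> {True}"
  shows "num_letters True w = length w" "num_letters False w = 0"
  using assms by (induction w) (auto simp: num_letters_def)

lemma tail_part_letters:
  assumes "i \<in> I"
  shows "num_letters True (tail_part i) = length (tail_part i)" "num_letters False (tail_part i) = 0"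
  using num_letters_positive[of "tail_part i"] tail_part_set[of i] pq[OF assms] by auto

lemma rel_negative_letters: "i \<in> I \<Longrightarrow> num_letters False (rel i) \<le> L"
  using num_letters_le[of False "b i"] b(2)[of i] tail_part_letters[of i]
  by (simp add: rel_def num_letters_append)

lemma rel_positive_letters:
  assumes i: "i \<in> I"
  shows "L < num_letters True (rel i)"
proof -
  have "hd (as i) \<in> set (as i)" using as(2)[OF i] by (cases "as i") auto
  then have "L \<le> K" using as(3,4)[OF i] by fastforce
  then have "L < length (tail_part i)" using rel_long(2)[OF i] b(2)[OF i] by (simp add: rel_def)
  then show ?thesis using tail_part_letters[OF i] by (simp add: rel_def num_letters_append)
qed

text \<open>The pattern in the window already has more than \<open>L\<close> positive letters of
  \<open>T\<close>, whereas an inverse relator has them only in its inverted base.\<close>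

lemma take_rotation_neq_inverse:
  assumes i: "i \<in> I" "i' \<in> I"
  shows "take m (rotate n (rel i)) \<noteq> take m (inv_word (rotate n' (rel i')))"
proof
  assume eq: "take m (rotate n (rel i)) = take m (inv_word (rotate n' (rel i')))"
  obtain j a where ja: "a \<in> set (as i)" "j + a + 2 \<le> m"
    "prefix (block_pattern (p i, True) (q i, True) a) (drop j (rotate n (rel i)))"
    using pattern_exists[OF i(1)] .
  let ?\<pi> = "block_pattern (p i, True) (q i, True) a"
  obtain v where v: "drop j (rotate n (rel i)) = ?\<pi> @ v" using ja(3) by (auto simp: prefix_def)
  have "rotate n (rel i) = take j (rotate n (rel i)) @ ?\<pi> @ v"
    using v by (metis append_take_drop_id)
  moreover have "length (take j (rotate n (rel i))) \<le> j" by simp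
  ultimately obtain u where u: "rotate n (rel i) = u @ ?\<pi> @ v" "length u \<le> j" by blast
  have "set ?\<pi> \<subseteq> T \<times> {True}" using pq[OF i(1)] by (auto simp: block_pattern_def)
  then have "a + 2 = num_letters True ?\<pi>" using num_letters_positive(1) by simp
  also have "\<dots> \<le> num_letters True (take m (rotate n (rel i)))"
    unfolding u(1) using u(2) ja(2) by (simp add: num_letters_append)
  also have "\<dots> \<le> num_letters True (inv_word (rotate n' (rel i')))"
    unfolding eq
    using num_letters_append[of True "take m (inv_word (rotate n' (rel i')))" "drop m (inv_word (rotate n' (rel i')))"]
    by simp
  also have "\<dots> \<le> L" using rel_negative_letters[OF i(2)] by (simp add: num_letters_inv_word num_letters_rotate)
  finally show False using as(3)[OF i(1) ja(1)] by simp
qed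

lemma take_determines:
  assumes s: "s \<in> symmetrized R" "s' \<in> symmetrized R" and eq: "take m s = take m s'"
  shows "s = s'"
  using s(1)
proof (cases rule: symmetrized_cases)
  case 1: (pos i n)
  show ?thesis using s(2)
  proof (cases rule: symmetrized_cases)
    case (pos i' n')
    have "i = i'" "n mod length (rel i) = n' mod length (rel i)"
      using rotations_determined[OF 1(1) pos(1) eq[unfolded 1(2) pos(2)]] .
    then show ?thesis unfolding 1 pos
      using rotate_conv_mod[of n "rel i"] rotate_conv_mod[of n' "rel i"] by metis
  next
    case (neg i' n')
    then show ?thesis using take_rotation_neq_inverse 1 eq by metis
  qed
next
  case 1: (neg i n)
  show ?thesis using s(2)
  proof (cases rule: symmetrized_cases)
    case (pos i' n')
    then show ?thesis using take_rotation_neq_inverse 1 eq by metis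
  next
    case (neg i' n')
    \<comment> \<open>The first \<open>m\<close> letters of an inverse are the inverted last
      \<open>m\<close> letters, and a rotation brings these to the front.\<close>
    have take_inv: "take m (inv_word w) = inv_word (take m (rotate (length w - m) w))" if "m \<le> length w" for w :: "'a word"
    proof -
      have w: "w = take (length w - m) w @ drop (length w - m) w" by simp
      have "take m (inv_word w) = inv_word (drop (length w - m) w)"
        by (subst w, subst inv_word_append) (use that in simp)
      moreover have "rotate (length w - m) w = drop (length w - m) w @ take (length w - m) w"
        using rotate_append[of "take (length w - m) w" "drop (length w - m) w"] by simp
      ultimately show ?thesis using that by simp
    qed
    let ?w = "rotate n (rel i)" and ?w' = "rotate n' (rel i')"
    have "inv_word (take m (rotate (length ?w - m) ?w)) = inv_word (take m (rotate (length ?w' - m) ?w'))"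
      using eq take_inv[of ?w] take_inv[of ?w'] rel_long(2)[OF 1(1)] rel_long(2)[OF neg(1)]
      unfolding 1(2) neg(2) by simp
    then have t: "take m (rotate (length ?w - m) ?w) = take m (rotate (length ?w' - m) ?w')"
      by (metis inv_word_inv_word)
    note det = rotations_determined[OF 1(1) neg(1) t[unfolded rotate_rotate]]
    have "i = i'" by (rule det(1))
    have l: "length ?w = length (rel i)" "length ?w' = length (rel i)" using \<open>i = i'\<close> by simp_all
    have "n mod length (rel i) = n' mod length (rel i)"
      by (rule mod_add_left_cancel[OF det(2)[unfolded l]]) (use rel_long(2)[OF 1(1)] in linarith)
    then show ?thesis unfolding 1 neg \<open>i = i'\<close>
      using rotate_conv_mod[of n "rel i'"] rotate_conv_mod[of n' "rel i'"] \<open>i = i'\<close> by metis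
  qed
qed

theorem metric_small_cancellation_R: "metric_small_cancellation c R"
  unfolding metric_small_cancellation_def
proof (intro conjI ballI allI impI)
  show "cyclically_reduced r" if "r \<in> R" for r using that rel_cyclically_reduced by auto
  show "real (length B) < c * real (length r)" if B: "piece R B" and r: "r \<in> symmetrized R" for B r
  proof -
    obtain s s' where s: "s \<in> symmetrized R" "s' \<in> symmetrized R" "s \<noteq> s'" "prefix B s" "prefix B s'"
      using B by (auto simp: piece_def)
    have "length B < m"
    proof (rule ccontr)
      assume "\<not> length B < m"
      then have "take m s = take m B" "take m s' = take m B" using s(4,5) by (auto simp: prefix_def)
      then show False using take_determines[OF s(1,2)] s(3) by simp
    qed
    then show ?thesis using symmetrized_long(2)[OF r] by linarith
  qed
qed

text \<open>A relator fixed by a proper rotation would show the same pattern at two different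
  positions.\<close>

lemma no_proper_power:
  assumes s: "s \<in> symmetrized R" and l: "0 < l" "l < length s"
  shows "rotate l s \<noteq> s"
proof
  have fixed: False if i: "i \<in> I" and eq: "rotate k (rotate n (rel i)) = rotate n (rel i)" and k: "0 < k" "k < length (rel i)" for i n k
  proof -
    have "(k + n) mod length (rel i) = n mod length (rel i)"
      by (rule rotations_determined(2)[OF i i]) (use eq in \<open>simp only: rotate_rotate\<close>)
    then have "(n + k) mod length (rel i) = (n + 0) mod length (rel i)" by (simp add: add.commute)
    then have "k mod length (rel i) = 0 mod length (rel i)"
      by (rule mod_add_left_cancel) (use k in linarith)
    then show False using k by simp
  qed
  assume eq: "rotate l s = s"
  show False using s
  proof (cases rule: symmetrized_cases)
    case (pos i n)
    then show False using fixed[OF pos(1), of l n] pos(2) eq l by simp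
  next
    case (neg i n)
    let ?w = "rotate n (rel i)"
    have "inv_word (rotate l s) = rotate (length s - l) (inv_word s)"
    proof -
      have "rotate l s = drop l s @ take l s" using l by (simp add: rotate_drop_take)
      moreover have "inv_word s = inv_word (drop l s) @ inv_word (take l s)"
        by (metis append_take_drop_id inv_word_append)
      moreover have "length (inv_word (drop l s)) = length s - l" by simp
      ultimately show ?thesis by (metis inv_word_append rotate_append)
    qed
    then have "rotate (length s - l) ?w = ?w" using eq neg by simp
    moreover have "0 < length (rel i) - l" "length (rel i) - l < length (rel i)"
      using neg(2) l by simp_all
    ultimately show False using fixed[OF neg(1), of "length s - l" n] neg(2) by simp
  qed
qed

lemma symmetrized_num_letters_neq:
  assumes "s \<in> symmetrized R"
  shows "num_letters True s \<noteq> num_letters False s"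
  using assms
  by (cases rule: symmetrized_cases)
    (use rel_negative_letters rel_positive_letters in \<open>force simp: num_letters_inv_word num_letters_rotate\<close>)+

lemma no_symmetric_relator:
  assumes \<sigma>: "\<And>a. snd (\<sigma> a) = snd a" "\<And>a. a \<in> set (inv_word s) \<Longrightarrow> fst (\<sigma> a) \<in> T \<longleftrightarrow> fst a \<in> T"
    and s: "s \<in> symmetrized R"
  shows "map \<sigma> (inv_word s) \<noteq> s"
proof
  assume eq: "map \<sigma> (inv_word s) = s"
  have "num_letters b (map \<sigma> w) = num_letters b w" if "set w \<subseteq> set (inv_word s)" for b w
    using that \<sigma>(2) by (induction w) (auto simp: num_letters_def \<sigma>(1))
  from this[of "inv_word s" True] have "num_letters True s = num_letters True (inv_word s)" using eq by simp
  then show False using symmetrized_num_letters_neq[OF s] by (simp add: num_letters_inv_word)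
qed

end

section \<open>The Rips construction with a cyclic symmetry\<close>

datatype gen = GY nat | GX nat nat | GT nat

text \<open>Presentations are required to have natural numbers as generators. The residue modulo 3
  keeps the three kinds apart.\<close>

fun enc :: "gen \<Rightarrow> nat" where
  "enc (GY j) = 3 * j"
| "enc (GT s) = 3 * s + 1"
| "enc (GX i s) = 3 * prod_encode (i, s) + 2"

lemma inj_enc: "inj enc"
proof (rule injI)
  fix g h assume "enc g = enc h"
  then show "g = h" by (cases g; cases h) (simp_all, presburger+)
qed

definition dec :: "nat \<Rightarrow> gen" where
  "dec = inv_into UNIV enc"

lemma dec_enc [simp]: "dec (enc g) = g"
  by (simp add: dec_def inj_enc)

declare enc.simps [simp del]

fun shift :: "nat \<Rightarrow> nat \<Rightarrow> gen \<Rightarrow> gen" where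
  "shift k n (GY j) = GY j"
| "shift k n (GX i s) = GX i ((s + n) mod k)"
| "shift k n (GT s) = GT ((s + n) mod k)"

lemma shift_shift: "shift k n (shift k n' g) = shift k (n + n') g"
  by (cases g) (simp_all add: mod_simps ac_simps)

lemma shift_mod: "shift k (n mod k) g = shift k n g"
  by (cases g) (simp_all add: mod_simps)

text \<open>Outside the range of \<open>enc\<close> the value of \<open>dec\<close> is arbitrary, but words over the generators
  only contain encoded letters.\<close>

definition shift_letter :: "nat \<Rightarrow> nat \<Rightarrow> nat letter \<Rightarrow> nat letter" where
  "shift_letter k n a = (enc (shift k n (dec (fst a))), snd a)"

lemma shift_letter_inv: "shift_letter k n (inv_letter a) = inv_letter (shift_letter k n a)"
  by (simp add: shift_letter_def inv_letter_def)

lemma shift_letter_shift_letter: "shift_letter k n (shift_letter k n' a) = shift_letter k (n + n') a"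
  by (simp add: shift_letter_def shift_shift)

lemma map_inv_word:
  "(\<And>a. \<sigma> (inv_letter a) = inv_letter (\<sigma> a)) \<Longrightarrow> map \<sigma> (inv_word w) = inv_word (map \<sigma> w)"
  by (simp add: inv_word_def rev_map)

definition gT :: "nat \<Rightarrow> nat" where "gT s = enc (GT s)"
definition gX :: "nat \<Rightarrow> nat \<Rightarrow> nat" where "gX i s = enc (GX i s)"
definition gY :: "nat \<Rightarrow> nat" where "gY j = enc (GY j)"

lemma gen_inject [simp]:
  "gT s = gT s' \<longleftrightarrow> s = s'" "gX i s = gX i' s' \<longleftrightarrow> i = i' \<and> s = s'" "gY j = gY j' \<longleftrightarrow> j = j'"
  "gT s \<noteq> gX i s'" "gT s \<noteq> gY j" "gX i s \<noteq> gY j" "gX i s' \<noteq> gT s" "gY j \<noteq> gT s" "gY j \<noteq> gX i s"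
  unfolding gT_def gX_def gY_def by (auto simp: inj_eq[OF inj_enc])

lemma dec_gen [simp]: "dec (gT s) = GT s" "dec (gX i s) = GX i s" "dec (gY j) = GY j"
  by (simp_all add: gT_def gX_def gY_def)

lemma shift_letter_gen [simp]:
  "shift_letter k n (gT s, z) = (gT ((s + n) mod k), z)"
  "shift_letter k n (gX i s, z) = (gX i ((s + n) mod k), z)"
  "shift_letter k n (gY j, z) = (gY j, z)"
  by (simp_all add: shift_letter_def, simp_all add: gT_def gX_def gY_def)

lemma symmetrized_map:
  assumes \<sigma>: "\<And>a. \<sigma> (inv_letter a) = inv_letter (\<sigma> a)" and R: "\<And>r. r \<in> R \<Longrightarrow> map \<sigma> r \<in> R"
    and s: "s \<in> symmetrized R"
  shows "map \<sigma> s \<in> symmetrized R"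
proof -
  obtain n r where r: "r \<in> R \<union> inv_word ` R" "s = rotate n r"
    using s unfolding symmetrized_def by blast
  have "map \<sigma> (inv_word w) = inv_word (map \<sigma> w)" for w
    by (rule map_inv_word) (rule \<sigma>)
  then have "map \<sigma> r \<in> R \<union> inv_word ` R" using r(1) R by auto
  then show ?thesis unfolding r(2) rotate_map[symmetric]
    using symmetrized_rotate[OF symmetrized_base] by blast
qed

locale rips_construction = P: group P + P0: presentation Z0 R0
  for P :: "('p, 'm) monoid_scheme" (structure) and Z0 :: "nat set" and R0 :: "nat word set" +
  fixes \<theta> :: "nat word set \<Rightarrow> 'p" and qs :: "nat word list" and k :: nat and c :: real
  assumes finite0: "finite Z0" "finite R0" and \<theta>: "\<theta> \<in> iso (presented_group Z0 R0) P"
    and qs: "\<And>w. w \<in> set qs \<Longrightarrow> w \<in> words_over Z0 \<and> reduced w"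
    and k: "2 \<le> k" and c: "0 < c" "c \<le> 1/20"
begin

section \<open>Evaluation of words in \<open>P\<close>, and the choice of relators\<close>

definition \<pi> :: "nat word \<Rightarrow> 'p" where
  "\<pi> w = \<theta> (P0.cls w)"

text \<open>The images of the generators: all copies of a generator of \<open>P\<close> agree and
  the \<open>t\<close> vanish, so the evaluation does not see the shift.\<close>

definition sub :: "nat \<Rightarrow> nat word" where
  "sub z = (case dec z of GY j \<Rightarrow> qs ! j | GX i s \<Rightarrow> [(i, True)] | GT s \<Rightarrow> [])"

definition sub_letter :: "nat letter \<Rightarrow> nat word" where
  "sub_letter a = (if snd a then sub (fst a) else inv_word (sub (fst a)))"

definition sub_word :: "nat word \<Rightarrow> nat word" where
  "sub_word w = concat (map sub_letter w)"

definition ev :: "nat word \<Rightarrow> 'p" where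
  "ev w = \<pi> (sub_word w)"

definition Tg :: "nat set" where "Tg = gT ` {..<k}"

definition Z :: "nat set" where
  "Z = gY ` {..<length qs} \<union> (\<lambda>(i, s). gX i s) ` (Z0 \<times> {..<k}) \<union> Tg"

text \<open>Room for every relation that will be required: 3 for a conjugate of some
  \<open>t\<close> by a letter, the length of each relator of \<open>P\<close>, and one more than
  the length of each word in \<open>qs\<close>.\<close>

definition L :: nat where
  "L = 3 + (\<Sum>r\<in>R0. length r) + (\<Sum>w\<leftarrow>qs. length w + 1)"

text \<open>The short words that are trivial in \<open>P\<close>: prescribing each of them to be a word in the kernel
  generators covers all relations that are needed, and this choice is automatically invariant
  under the symmetry.\<close>

definition bases :: "nat word set" where
  "bases = {b \<in> words_over Z. reduced b \<and> b \<noteq> [] \<and> length b \<le> L \<and>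
     fst (hd b) \<notin> Tg \<and> fst (last b) \<notin> Tg \<and> ev b = \<one>}"

definition idx :: "nat word \<Rightarrow> nat" where
  "idx = (SOME f. bij_betw f bases {0..<card bases})"

text \<open>With \<open>N\<close> bases, \<open>3 * K + L + 5\<close> equals
  \<open>M * (3 * N + 1)\<close>, while \<open>M\<close> blocks have length at least
  \<open>M * (A + 1)\<close>. Small cancellation therefore asks for
  \<open>c * (A + 1) \<ge> 3 * N + 1\<close>, and \<open>L + 1\<close> lifts the exponents above
  \<open>L\<close>.\<close>

definition A :: nat where "A = L + 1 + nat \<lceil>(3 * real (card bases) + 1) / c\<rceil>"
definition M :: nat where "M = 3 * A + L + 5"
definition K :: nat where "K = A + card bases * M"

definition exps :: "nat word \<Rightarrow> nat list" where
  "exps b = [A + idx b * M ..< A + (idx b + 1) * M]"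

definition Ix :: "(nat word \<times> nat) set" where
  "Ix = bases \<times> {..<k}"

lemma k_pos: "0 < k" using k by simp

lemma gT_Z: "s < k \<Longrightarrow> gT s \<in> Z" "s < k \<Longrightarrow> gT s \<in> Tg"
  by (simp_all add: Z_def Tg_def)

lemma gX_Z: "i \<in> Z0 \<Longrightarrow> s < k \<Longrightarrow> gX i s \<in> Z" "gX i s \<notin> Tg"
  by (auto simp: Z_def Tg_def)

lemma gY_Z: "j < length qs \<Longrightarrow> gY j \<in> Z" "gY j \<notin> Tg"
  by (auto simp: Z_def Tg_def)

lemma Z_cases:
  assumes "z \<in> Z"
  obtains (Y) j where "z = gY j" "j < length qs" | (X) i s where "z = gX i s" "i \<in> Z0" "s < k"
    | (T) s where "z = gT s" "s < k"
  using assms by (auto simp: Z_def Tg_def)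

lemma finite_Z: "finite Z"
  using finite0(1) by (simp add: Z_def Tg_def)

lemma shift_letter_Z: "fst a \<in> Z \<Longrightarrow> fst (shift_letter k n a) \<in> Z"
  using k_pos by (cases a) (auto elim!: Z_cases simp: gT_Z gX_Z gY_Z)

lemma shift_letter_Tg: "fst a \<in> Z \<Longrightarrow> fst (shift_letter k n a) \<in> Tg \<longleftrightarrow> fst a \<in> Tg"
  using k_pos by (cases a) (auto elim!: Z_cases simp: gT_Z gX_Z gY_Z)

lemma words_over_mem: "w \<in> words_over Y \<Longrightarrow> a \<in> set w \<Longrightarrow> fst a \<in> Y"
  by (auto simp: words_over_def in_lists_conv_set)

lemma shift_hd_last_Tg:
  assumes "w \<in> words_over Z" "w \<noteq> []"
  shows "fst (shift_letter k n (hd w)) \<in> Tg \<longleftrightarrow> fst (hd w) \<in> Tg"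
    "fst (shift_letter k n (last w)) \<in> Tg \<longleftrightarrow> fst (last w) \<in> Tg"
  using assms by (auto intro!: shift_letter_Tg words_over_mem)

lemma Suc_mod_neq: "s < k \<Longrightarrow> s \<noteq> Suc s mod k"
  using k by (cases "Suc s = k") auto

lemma shift_letter_k: "fst a \<in> Z \<Longrightarrow> k dvd n \<Longrightarrow> shift_letter k n a = a"
  by (cases a) (auto elim!: Z_cases elim!: dvdE)

lemma shift_letter_mod: "shift_letter k (n mod k) a = shift_letter k n a"
  by (simp add: shift_letter_def shift_mod)

lemma shift_letter_inj:
  assumes "fst a \<in> Z" "fst a' \<in> Z" "shift_letter k n a = shift_letter k n a'"
  shows "a = a'"
proof -
  have "shift_letter k (k * n) a = shift_letter k (k * n) a'"
    using arg_cong[OF assms(3), of "shift_letter k (k * n - n)"] k_pos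
    by (simp add: shift_letter_shift_letter)
  then show ?thesis using shift_letter_k[OF assms(1), of "k * n"] shift_letter_k[OF assms(2), of "k * n"] by simp
qed

lemma shift_words: "w \<in> words_over Z \<Longrightarrow> map (shift_letter k n) w \<in> words_over Z"
  by (induction w) (auto simp: shift_letter_Z)

lemma shift_reduced:
  assumes "w \<in> words_over Z" "reduced w"
  shows "reduced (map (shift_letter k n) w)"
  using assms
proof (induction w)
  case (Cons a w)
  show ?case
  proof (cases w)
    case (Cons b w')
    have "b \<noteq> inv_letter a" "fst a \<in> Z" "fst b \<in> Z" using Cons.prems Cons by (auto simp: reduced_Cons)
    moreover have "fst (inv_letter a) \<in> Z" using \<open>fst a \<in> Z\<close> by (simp add: inv_letter_def)
    ultimately have "shift_letter k n b \<noteq> inv_letter (shift_letter k n a)"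
      using shift_letter_inj[of b "inv_letter a"] by (auto simp: shift_letter_inv)
    then show ?thesis using Cons.IH Cons.prems Cons by (simp add: reduced_Cons)
  qed (simp add: reduced_Cons)
qed simp

lemma sub_shift: "sub (fst (shift_letter k n a)) = sub (fst a)"
  by (cases "dec (fst a)") (simp_all add: shift_letter_def sub_def)

lemma sub_word_shift: "sub_word (map (shift_letter k n) w) = sub_word w"
  by (induction w) (auto simp: sub_word_def sub_letter_def sub_shift, simp_all add: shift_letter_def)

lemma ev_shift: "ev (map (shift_letter k n) w) = ev w"
  by (simp add: ev_def sub_word_shift)

lemma \<theta>_hom: "\<theta> \<in> hom P0.G P" and \<theta>_bij: "bij_betw \<theta> (carrier P0.G) (carrier P)"
  using \<theta> by (auto simp: iso_def)

lemma \<theta>_group_hom: "group_hom P0.G P \<theta>"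
  using P0.G_group \<theta>_hom P.is_group by (simp add: group_hom_def group_hom_axioms_def)

lemma \<pi>_closed [simp]: "w \<in> words_over Z0 \<Longrightarrow> \<pi> w \<in> carrier P"
  using group_hom.hom_closed[OF \<theta>_group_hom] by (simp add: \<pi>_def)

lemma \<pi>_append: "u \<in> words_over Z0 \<Longrightarrow> v \<in> words_over Z0 \<Longrightarrow> \<pi> (u @ v) = \<pi> u \<otimes> \<pi> v"
  using hom_mult[OF \<theta>_hom, of "P0.cls u" "P0.cls v"] by (simp add: \<pi>_def P0.cls_mult)

lemma \<pi>_Nil: "\<pi> [] = \<one>"
  using group_hom.hom_one[OF \<theta>_group_hom] by (simp add: \<pi>_def P0.cls_Nil)

lemma \<pi>_cong: "reduce u = reduce v \<Longrightarrow> \<pi> u = \<pi> v"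
  unfolding \<pi>_def by (rule arg_cong[OF P0.cls_cong])

lemma \<pi>_eq_one_iff:
  assumes "w \<in> words_over Z0"
  shows "\<pi> w = \<one> \<longleftrightarrow> P0.cls w = \<one>\<^bsub>P0.G\<^esub>"
proof -
  have "inj_on \<theta> (carrier P0.G)" using \<theta>_bij by (simp add: bij_betw_def)
  then have "\<theta> (P0.cls w) = \<theta> (P0.cls []) \<longleftrightarrow> P0.cls w = P0.cls []"
    by (rule inj_on_eq_iff) (use assms in \<open>simp_all add: P0.cls_mem\<close>)
  moreover have "\<theta> (P0.cls []) = \<one>" using \<pi>_Nil by (simp only: \<pi>_def)
  ultimately show ?thesis by (simp only: \<pi>_def P0.cls_Nil)
qed

lemma \<pi>_inv_word: "w \<in> words_over Z0 \<Longrightarrow> \<pi> (inv_word w) = inv (\<pi> w)"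
  using \<pi>_append[of "inv_word w" w] \<pi>_cong[of "inv_word w @ w" "[]"] \<pi>_Nil
  by (simp add: P.inv_equality)

lemma \<pi>_surj: "x \<in> carrier P \<Longrightarrow> \<exists>w \<in> words_over Z0. \<pi> w = x"
  using \<theta>_bij unfolding bij_betw_def P0.carrier_G \<pi>_def by (metis (no_types, lifting) image_iff)

lemma sub_words: "z \<in> Z \<Longrightarrow> sub z \<in> words_over Z0"
  by (auto elim!: Z_cases simp: sub_def qs)

lemma sub_letter_words: "fst a \<in> Z \<Longrightarrow> sub_letter a \<in> words_over Z0"
  by (simp add: sub_letter_def sub_words)

lemma sub_word_words: "w \<in> words_over Z \<Longrightarrow> sub_word w \<in> words_over Z0"
  by (induction w) (auto simp: sub_word_def sub_letter_words)

lemma sub_word_append: "sub_word (u @ v) = sub_word u @ sub_word v"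
  by (simp add: sub_word_def)

lemma ev_closed [simp]: "w \<in> words_over Z \<Longrightarrow> ev w \<in> carrier P"
  by (simp add: ev_def sub_word_words)

lemma ev_append: "u \<in> words_over Z \<Longrightarrow> v \<in> words_over Z \<Longrightarrow> ev (u @ v) = ev u \<otimes> ev v"
  by (simp add: ev_def sub_word_append \<pi>_append sub_word_words)

lemma ev_Nil: "ev [] = \<one>"
  by (simp add: ev_def sub_word_def \<pi>_Nil)

lemma ev_cancel: "ev [a, inv_letter a] = \<one>"
proof -
  have "sub_letter (inv_letter a) = inv_word (sub_letter a)"
    by (simp add: sub_letter_def inv_letter_def)
  then have "sub_word [a, inv_letter a] = sub_letter a @ inv_word (sub_letter a)"
    by (simp add: sub_word_def)
  then show ?thesis using \<pi>_cong[of "sub_letter a @ inv_word (sub_letter a)" "[]"] by (simp add: ev_def \<pi>_Nil)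
qed

lemma sub_word_T: "set w \<subseteq> Tg \<times> UNIV \<Longrightarrow> sub_word w = []"
  by (induction w) (auto simp: sub_word_def sub_letter_def sub_def Tg_def)

lemma finite_bases: "finite bases"
proof -
  have "bases \<subseteq> {w. set w \<subseteq> Z \<times> UNIV \<and> length w \<le> L}"
    by (auto simp: bases_def words_over_def in_lists_conv_set)
  moreover have "finite {w. set w \<subseteq> Z \<times> (UNIV :: bool set) \<and> length w \<le> L}"
    using finite_Z by (intro finite_lists_length_le) simp
  ultimately show ?thesis by (rule finite_subset)
qed

lemma bij_idx: "bij_betw idx bases {0..<card bases}"
  unfolding idx_def using ex_bij_betw_finite_nat[OF finite_bases] by (rule someI_ex)

lemma bases_words: "b \<in> bases \<Longrightarrow> b \<in> words_over Z"
  by (simp add: bases_def)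

lemma exps_bounds: "b \<in> bases \<Longrightarrow> a \<in> set (exps b) \<Longrightarrow> A \<le> a \<and> a < K"
proof -
  assume b: "b \<in> bases" and a: "a \<in> set (exps b)"
  have "idx b < card bases" using bij_idx b by (auto simp: bij_betw_def)
  then have "(idx b + 1) * M \<le> card bases * M" by (intro mult_right_mono) auto
  then show ?thesis using a by (auto simp: exps_def K_def)
qed

lemma exps_disjoint: "b \<in> bases \<Longrightarrow> b' \<in> bases \<Longrightarrow> b \<noteq> b' \<Longrightarrow> set (exps b) \<inter> set (exps b') = {}"
proof -
  assume b: "b \<in> bases" "b' \<in> bases" "b \<noteq> b'"
  then have ne: "idx b \<noteq> idx b'" using bij_idx by (auto simp: bij_betw_def inj_on_def)
  have M: "0 < M" by (simp add: M_def)
  have id: "(a - A) div M = idx d" if a: "a \<in> set (exps d)" for a d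
  proof -
    have "idx d * M \<le> a - A" "a - A < Suc (idx d) * M" using a by (auto simp: exps_def)
    then show ?thesis using div_nat_eqI[of M "idx d" "a - A"] by (simp add: mult.commute)
  qed
  show ?thesis using id[of _ b] id[of _ b'] ne by (metis disjoint_iff)
qed

lemma length_blocks_ge:
  assumes "\<And>a. a \<in> set as \<Longrightarrow> A \<le> a"
  shows "length as * (A + 1) \<le> length (blocks x y as)"
  using assms by (induction as) fastforce+

lemma length_exps: "length (exps b) = M"
  by (simp add: exps_def)

lemma A_bound: "3 * real (card bases) + 1 \<le> c * (real A + 1)"
proof -
  have "(3 * real (card bases) + 1) / c \<le> real (nat \<lceil>(3 * real (card bases) + 1) / c\<rceil>)"
    by (rule real_nat_ceiling_ge)
  also have "\<dots> \<le> real A + 1" by (simp add: A_def)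
  finally show ?thesis using c(1) by (simp add: field_simps)
qed

text \<open>One relator for each base and each shift. Its tail uses the letter \<open>t\<close> of
  index \<open>s\<close> and its cyclic successor, so the shift permutes the relators.\<close>

sublocale BR: block_relators Ix "\<lambda>(b, s). map (shift_letter k s) b" "\<lambda>(b, s). gT s" "\<lambda>(b, s). gT (Suc s mod k)"
  "\<lambda>(b, s). exps b" Tg L K c
proof (unfold_locales, goal_cases)
  case (11 i a)
  then show ?case using exps_bounds by (force simp: Ix_def A_def)
next
  case (12 i a)
  then show ?case using exps_bounds by (force simp: Ix_def)
next
  \<comment> \<open>Equal second letters force equal shifts. So the bases differ, and their
    exponents come from disjoint intervals.\<close>
  case (13 i j)
  then obtain b s b' s' where ij: "i = (b, s)" "j = (b', s')" "b \<in> bases" "b' \<in> bases" "s < k" "s' < k"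
    by (auto simp: Ix_def)
  have "s = s'"
  proof -
    have "(1 + s) mod k = (1 + s') mod k" using 13(4) ij by simp
    then have "s mod k = s' mod k" by (rule mod_add_left_cancel) (rule k_pos)
    then show ?thesis using ij by simp
  qed
  then show ?case using 13(3) ij exps_disjoint by auto
next
  case (14 i)
  then obtain b s where i: "i = (b, s)" "b \<in> bases" by (auto simp: Ix_def)
  \<comment> \<open>This factorization is the reason for the value of \<open>M\<close>.\<close>
  have "real (3 * K + L + 5) = real M * (3 * real (card bases) + 1)"
    by (simp add: K_def M_def algebra_simps)
  also have "\<dots> \<le> real M * (c * (real A + 1))"
    using A_bound by (rule mult_left_mono) simp
  also have "\<dots> = c * real (M * (A + 1))" by (simp add: algebra_simps)
  also have "\<dots> \<le> c * real (length (map (shift_letter k s) b @ blocks (gT s, True) (gT (Suc s mod k), True) (exps b)))"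
  proof -
    have "M * (A + 1) \<le> length (blocks (gT s, True) (gT (Suc s mod k), True) (exps b))"
      using length_blocks_ge[of "exps b"] exps_bounds[OF i(2)] by (simp add: length_exps)
    then have "M * (A + 1) \<le> length (map (shift_letter k s) b @ blocks (gT s, True) (gT (Suc s mod k), True) (exps b))"
      by simp
    then show ?thesis using c(1) by (intro mult_left_mono) (simp_all only: of_nat_le_iff less_imp_le)
  qed
  finally show ?case by (simp add: i)
next
  case 15
  show ?case using c(2) by simp
qed (use k_pos in \<open>auto simp: Ix_def bases_def shift_reduced gT_Z exps_def M_def hd_map last_map shift_hd_last_Tg
    dest: Suc_mod_neq\<close>)

end

context rips_construction
begin

section \<open>The group \<open>F\<close>, its automorphism and the epimorphism to
  \<open>P\<close>\<close>

abbreviation "tail b s \<equiv> blocks (gT s, True) (gT (Suc s mod k), True) (exps b)"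

lemma rel_eq: "BR.rel (b, s) = map (shift_letter k s) b @ tail b s"
  by (simp add: BR.rel_def BR.tail_part_def)

lemma T_words: "set w \<subseteq> Tg \<times> UNIV \<Longrightarrow> w \<in> words_over Z"
  by (induction w) (auto simp: Z_def)

lemma tail_T: "s < k \<Longrightarrow> set (tail b s) \<subseteq> Tg \<times> UNIV"
  using set_blocks[of "(gT s, True)" "(gT (Suc s mod k), True)" "exps b"] gT_Z(2)[of s] gT_Z(2)[of "Suc s mod k"] k_pos
  by auto

lemma rel_words: "i \<in> Ix \<Longrightarrow> BR.rel i \<in> words_over Z"
  using T_words[OF tail_T] bases_words by (cases i) (auto simp: rel_eq Ix_def intro: shift_words)

lemma R_carrier: "BR.R \<subseteq> carrier (free_group Z)"
  using rel_words BR.rel_cyclically_reduced by (auto simp: carrier_free_group cyclically_reduced_def)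

sublocale SC: small_cancellation Z BR.R c
  by unfold_locales (use R_carrier BR.metric_small_cancellation_R c in auto)

abbreviation "F \<equiv> presented_group Z BR.R"
abbreviation "\<sigma>l \<equiv> shift_letter k 1"

lemma group_F: "group F"
  by (rule SC.G_group)

lemma map_blocks: "map h (blocks x y as) = blocks (h x) (h y) as"
  by (induction as) auto

lemma rel_shift:
  assumes "s < k"
  shows "map \<sigma>l (BR.rel (b, s)) = BR.rel (b, Suc s mod k)"
proof -
  have "shift_letter k (Suc s mod k) a = shift_letter k 1 (shift_letter k s a)" for a
    by (simp add: shift_letter_mod shift_letter_shift_letter)
  then show ?thesis by (simp add: rel_eq map_blocks)
qed

lemma R_shift: "r \<in> BR.R \<Longrightarrow> map \<sigma>l r \<in> BR.R"
  using rel_shift k_pos by (force simp: Ix_def)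

lemma shift_symmetrized: "s \<in> symmetrized BR.R \<Longrightarrow> map \<sigma>l s \<in> symmetrized BR.R"
  by (rule symmetrized_map[OF shift_letter_inv R_shift])

lemma shift_cong:
  assumes "u \<in> words_over Z" "v \<in> words_over Z" "SC.cls u = SC.cls v"
  shows "SC.cls (map \<sigma>l u) = SC.cls (map \<sigma>l v)"
proof (rule SC.cls_eq_imp_eq[OF group_F _ _ _ _ assms, of "\<lambda>w. SC.cls (map \<sigma>l w)"])
  show "SC.cls (map \<sigma>l w) \<in> carrier F" if "w \<in> words_over Z" for w
    using that by (simp add: shift_words)
  show "SC.cls (map \<sigma>l (x @ y)) = SC.cls (map \<sigma>l x) \<otimes>\<^bsub>F\<^esub> SC.cls (map \<sigma>l y)"
    if "x \<in> words_over Z" "y \<in> words_over Z" for x y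
    using that by (simp add: shift_words SC.cls_mult)
  show "SC.cls (map \<sigma>l [a, inv_letter a]) = \<one>\<^bsub>F\<^esub>" for a
    using SC.cls_cancel_pair[of "[]" "\<sigma>l a" "[]"] by (simp add: shift_letter_inv SC.cls_Nil)
  show "SC.cls (map \<sigma>l r) = \<one>\<^bsub>F\<^esub>" if "r \<in> BR.R" for r
    by (rule SC.cls_relator[OF R_shift[OF that]])
qed

lemma ev_rel: "i \<in> Ix \<Longrightarrow> ev (BR.rel i) = \<one>"
proof -
  assume "i \<in> Ix"
  then obtain b s where i: "i = (b, s)" "b \<in> bases" "s < k" by (auto simp: Ix_def)
  have "sub_word (BR.rel i) = sub_word b"
    using sub_word_T[OF tail_T[OF i(3)]] by (simp add: i(1) rel_eq sub_word_append sub_word_shift)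
  then show ?thesis using i(2) by (simp add: ev_def bases_def)
qed

lemma ev_cong:
  assumes "u \<in> words_over Z" "v \<in> words_over Z" "SC.cls u = SC.cls v"
  shows "ev u = ev v"
  by (rule SC.cls_eq_imp_eq[OF P.is_group ev_closed ev_append ev_cancel _ assms]) (auto simp: ev_rel)

definition repr :: "nat word set \<Rightarrow> nat word" where
  "repr x = (SOME w. w \<in> words_over Z \<and> SC.cls w = x)"

lemma repr: "w \<in> words_over Z \<Longrightarrow> repr (SC.cls w) \<in> words_over Z \<and> SC.cls (repr (SC.cls w)) = SC.cls w"
  unfolding repr_def by (rule someI) blast

text \<open>Restricted to the carrier, as \<open>auto\<close> admits only extensional
  functions.\<close>

definition \<sigma> :: "nat word set \<Rightarrow> nat word set" where
  "\<sigma> = (\<lambda>x \<in> carrier F. SC.cls (map \<sigma>l (repr x)))"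

definition \<psi> :: "nat word set \<Rightarrow> 'p" where
  "\<psi> x = ev (repr x)"

lemma \<sigma>_cls: "w \<in> words_over Z \<Longrightarrow> \<sigma> (SC.cls w) = SC.cls (map \<sigma>l w)"
  using shift_cong[of "repr (SC.cls w)" w] repr[of w] by (simp add: \<sigma>_def)

lemma \<psi>_cls: "w \<in> words_over Z \<Longrightarrow> \<psi> (SC.cls w) = ev w"
  using ev_cong[of "repr (SC.cls w)" w] repr[of w] by (simp add: \<psi>_def)

lemma carrier_F_cases:
  assumes "x \<in> carrier F"
  obtains w where "w \<in> words_over Z" "x = SC.cls w"
  using assms by (auto simp: SC.carrier_G)

lemma \<psi>_hom: "\<psi> \<in> hom F P"
proof (rule homI)
  show "\<psi> x \<in> carrier P" if "x \<in> carrier F" for x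
    using that by (auto elim!: carrier_F_cases simp: \<psi>_cls)
  show "\<psi> (x \<otimes>\<^bsub>F\<^esub> y) = \<psi> x \<otimes> \<psi> y" if "x \<in> carrier F" "y \<in> carrier F" for x y
    using that by (auto elim!: carrier_F_cases simp: \<psi>_cls SC.cls_mult ev_append)
qed

text \<open>A section of \<open>sub_word\<close> that uses the copies with index 0.\<close>

definition lift0 :: "nat word \<Rightarrow> nat word" where
  "lift0 w = map (\<lambda>(i, z). (gX i 0, z)) w"

lemma lift0_words: "w \<in> words_over Z0 \<Longrightarrow> lift0 w \<in> words_over Z"
  using k_pos by (induction w) (auto simp: lift0_def gX_Z)

lemma sub_word_lift0: "sub_word (lift0 w) = w"
  by (induction w) (auto simp: lift0_def sub_word_def sub_letter_def sub_def inv_word_def inv_letter_def)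

lemma \<psi>_surj: "\<psi> ` carrier F = carrier P"
proof
  show "carrier P \<subseteq> \<psi> ` carrier F"
  proof
    fix x assume "x \<in> carrier P"
    then obtain w where w: "w \<in> words_over Z0" "\<pi> w = x" using \<pi>_surj by blast
    then have "\<psi> (SC.cls (lift0 w)) = x" by (simp add: \<psi>_cls lift0_words ev_def sub_word_lift0)
    then show "x \<in> \<psi> ` carrier F" using w lift0_words by force
  qed
qed (use hom_in_carrier[OF \<psi>_hom] in blast)

lemma \<psi>_\<sigma>: "x \<in> carrier F \<Longrightarrow> \<psi> (\<sigma> x) = \<psi> x"
  by (auto elim!: carrier_F_cases simp: \<sigma>_cls \<psi>_cls shift_words ev_shift)

subsection \<open>The kernel\<close>

definition Ts :: "nat word set set" where
  "Ts = (\<lambda>s. SC.cls [(gT s, True)]) ` {..<k}"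

abbreviation "NT \<equiv> generate F Ts"

lemma Ts_carrier: "Ts \<subseteq> carrier F"
  by (auto simp: Ts_def gT_Z)

lemma NT_subgroup: "subgroup NT F"
  using group.generate_is_subgroup[OF group_F Ts_carrier] .

lemma NT_one: "\<one>\<^bsub>F\<^esub> \<in> NT" and NT_mult: "x \<in> NT \<Longrightarrow> y \<in> NT \<Longrightarrow> x \<otimes>\<^bsub>F\<^esub> y \<in> NT"
  and NT_inv: "x \<in> NT \<Longrightarrow> inv\<^bsub>F\<^esub> x \<in> NT"
  using NT_subgroup by (auto simp: subgroup_def)

lemma cls_Cons: "a # w \<in> words_over Z \<Longrightarrow> SC.cls (a # w) = SC.cls [a] \<otimes>\<^bsub>F\<^esub> SC.cls w"
  using SC.cls_mult[of "[a]" w] by simp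

lemma inv_word_single: "inv_word [a] = [inv_letter a]"
  by (simp add: inv_word_def)

lemma T_word_NT: "set w \<subseteq> Tg \<times> UNIV \<Longrightarrow> SC.cls w \<in> NT"
proof (induction w)
  case (Cons a w)
  obtain s z where a: "a = (gT s, z)" "s < k" using Cons.prems by (auto simp: Tg_def)
  have t: "SC.cls [(gT s, True)] \<in> NT" using a(2) by (intro generate.incl) (auto simp: Ts_def)
  have "SC.cls [a] \<in> NT"
  proof (cases z)
    case False
    then have "[a] = inv_word [(gT s, True)]" by (simp add: a inv_word_single inv_letter_def)
    then show ?thesis using NT_inv[OF t] SC.cls_inv[of "[(gT s, True)]"] gT_Z(1)[OF a(2)] by simp
  qed (use t a in simp)
  then show ?case using Cons T_words[OF Cons.prems] by (simp add: cls_Cons[OF T_words[OF Cons.prems]] NT_mult)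
qed (simp add: SC.cls_Nil NT_one)

text \<open>The unshifted relator of \<open>b\<close> equates \<open>b\<close> with the inverse of a
  word in the \<open>t\<close>.\<close>

lemma base_NT:
  assumes b: "b \<in> bases"
  shows "SC.cls b \<in> NT"
proof -
  interpret F: group F by (rule group_F)
  have "map (shift_letter k 0) b = b"
    using bases_words[OF b] words_over_mem by (intro map_idI shift_letter_k) auto
  then have "b @ tail b 0 = BR.rel (b, 0)" by (simp add: rel_eq)
  moreover have "(b, 0) \<in> Ix" using b k_pos by (simp add: Ix_def)
  ultimately have "SC.cls (b @ tail b 0) = \<one>\<^bsub>F\<^esub>" using SC.cls_relator[of "BR.rel (b, 0)"] by simp
  then have "SC.cls b \<otimes>\<^bsub>F\<^esub> SC.cls (tail b 0) = \<one>\<^bsub>F\<^esub>"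
    using bases_words[OF b] T_words[OF tail_T[OF k_pos]] by (simp add: SC.cls_mult)
  then have "inv\<^bsub>F\<^esub> (SC.cls (tail b 0)) = SC.cls b"
    using bases_words[OF b] T_words[OF tail_T[OF k_pos]] by (intro F.inv_equality) auto
  then show ?thesis using NT_inv[OF T_word_NT[OF tail_T[OF k_pos]]] by metis
qed

text \<open>For a letter \<open>a\<close> outside \<open>Tg\<close>, conjugating some
  \<open>t\<close> by \<open>a\<close> gives a reduced word of length 3 that is trivial in
  \<open>P\<close>, hence a base. As \<open>a\<close> may have either sign, inverse generators are
  covered as well.\<close>

lemma letter_conj_NT:
  assumes a: "fst a \<in> Z" and h: "h \<in> NT"
  shows "SC.cls [a] \<otimes>\<^bsub>F\<^esub> h \<otimes>\<^bsub>F\<^esub> inv\<^bsub>F\<^esub> (SC.cls [a]) \<in> NT"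
proof -
  interpret F: group F by (rule group_F)
  let ?a = "SC.cls [a]"
  have aF: "?a \<in> carrier F" using a by simp
  have NTF: "x \<in> carrier F" if "x \<in> NT" for x using that subgroup.subset[OF NT_subgroup] by blast
  have ia: "inv\<^bsub>F\<^esub> ?a = SC.cls [inv_letter a]" using a by (simp add: SC.cls_inv inv_word_single)
  have iaZ: "fst (inv_letter a) \<in> Z" using a by (simp add: inv_letter_def)
  show ?thesis
  proof (cases "fst a \<in> Tg")
    case True
    then have "?a \<in> NT" by (intro T_word_NT) (cases a, auto)
    then show ?thesis using h by (intro NT_mult NT_inv)
  next
    case aT: False
    have conj: "?a \<otimes>\<^bsub>F\<^esub> SC.cls [(gT s, True)] \<otimes>\<^bsub>F\<^esub> inv\<^bsub>F\<^esub> ?a \<in> NT" if s: "s < k" for s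
    proof -
      let ?w = "[a, (gT s, True), inv_letter a]"
      have "sub_word ?w = sub_letter a @ inv_word (sub_letter a)"
        by (simp add: sub_word_def sub_letter_def sub_def inv_letter_def)
      then have "ev ?w = \<one>"
        using \<pi>_cong[of "sub_letter a @ inv_word (sub_letter a)" "[]"] by (simp add: ev_def \<pi>_Nil)
      moreover have "fst a \<noteq> gT s" using aT gT_Z(2)[OF s] by auto
      ultimately have "?w \<in> bases"
        using a aT iaZ gT_Z(1)[OF s] by (auto simp: bases_def reduced_Cons L_def inv_letter_def)
      then have "SC.cls ?w \<in> NT" by (rule base_NT)
      moreover have "SC.cls ?w = ?a \<otimes>\<^bsub>F\<^esub> SC.cls [(gT s, True)] \<otimes>\<^bsub>F\<^esub> inv\<^bsub>F\<^esub> ?a"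
        unfolding ia using a iaZ gT_Z(1)[OF s] by (simp add: SC.cls_mult)
      ultimately show ?thesis by simp
    qed
    show ?thesis using h
    proof (induction rule: generate.induct)
      case one
      then show ?case using aF NT_one by simp
    next
      case (incl h)
      then show ?case using conj by (auto simp: Ts_def)
    next
      case (inv h)
      then obtain s where s: "s < k" "h = SC.cls [(gT s, True)]" by (auto simp: Ts_def)
      have "h \<in> carrier F" using s gT_Z by simp
      then show ?case using NT_inv[OF conj[OF s(1)]] aF s(2) by (simp add: F.inv_mult_group F.m_assoc)
    next
      case (eng h1 h2)
      have "?a \<otimes>\<^bsub>F\<^esub> (h1 \<otimes>\<^bsub>F\<^esub> h2) \<otimes>\<^bsub>F\<^esub> inv\<^bsub>F\<^esub> ?a =
          (?a \<otimes>\<^bsub>F\<^esub> h1 \<otimes>\<^bsub>F\<^esub> inv\<^bsub>F\<^esub> ?a) \<otimes>\<^bsub>F\<^esub> (?a \<otimes>\<^bsub>F\<^esub> h2 \<otimes>\<^bsub>F\<^esub> inv\<^bsub>F\<^esub> ?a)"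
        using aF NTF[OF eng(1)] NTF[OF eng(2)] by (simp add: F.m_assoc F.inv_solve_left)
      then show ?case using NT_mult[OF eng(3,4)] by simp
    qed
  qed
qed

lemma NT_normal: "NT \<lhd> F"
proof -
  interpret F: group F by (rule group_F)
  have NTF: "x \<in> carrier F" if "x \<in> NT" for x using that subgroup.subset[OF NT_subgroup] by blast
  have conj: "SC.cls w \<otimes>\<^bsub>F\<^esub> h \<otimes>\<^bsub>F\<^esub> inv\<^bsub>F\<^esub> (SC.cls w) \<in> NT" if "w \<in> words_over Z" "h \<in> NT" for w h
    using that
  proof (induction w)
    case Nil
    then show ?case using NTF by (simp add: SC.cls_Nil)
  next
    case (Cons a w)
    have w: "fst a \<in> Z" "w \<in> words_over Z" using Cons.prems by auto
    have "SC.cls (a # w) \<otimes>\<^bsub>F\<^esub> h \<otimes>\<^bsub>F\<^esub> inv\<^bsub>F\<^esub> (SC.cls (a # w)) =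
        SC.cls [a] \<otimes>\<^bsub>F\<^esub> (SC.cls w \<otimes>\<^bsub>F\<^esub> h \<otimes>\<^bsub>F\<^esub> inv\<^bsub>F\<^esub> (SC.cls w)) \<otimes>\<^bsub>F\<^esub> inv\<^bsub>F\<^esub> (SC.cls [a])"
      unfolding cls_Cons[OF Cons.prems(1)] using w NTF[OF Cons.prems(2)]
      by (simp add: F.inv_mult_group F.m_assoc)
    then show ?case using letter_conj_NT[OF w(1) Cons.IH[OF w(2) Cons.prems(2)]] by simp
  qed
  show ?thesis
    unfolding F.normal_inv_iff using NT_subgroup conj by (auto elim!: carrier_F_cases)
qed

lemma reduced_lift0: "reduced w \<Longrightarrow> reduced (lift0 w)"
proof (induction w)
  case (Cons a w)
  then show ?case
    by (cases a; cases w) (auto simp: lift0_def reduced_Cons inv_letter_def)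
qed (simp add: lift0_def)

lemma length_lift0 [simp]: "length (lift0 w) = length w" "lift0 w = [] \<longleftrightarrow> w = []"
  by (simp_all add: lift0_def)

lemma lift0_append: "lift0 (u @ v) = lift0 u @ lift0 v"
  by (simp add: lift0_def)

lemma lift0_inv_word: "lift0 (inv_word w) = inv_word (lift0 w)"
  by (auto simp: lift0_def inv_word_def rev_map inv_letter_def)

lemma fst_lift0: "a \<in> set (lift0 w) \<Longrightarrow> \<exists>i. fst a = gX i 0"
  by (auto simp: lift0_def)

lemma lift0_ends:
  assumes "w \<noteq> []"
  shows "fst (hd (lift0 w)) \<notin> Tg" "fst (last (lift0 w)) \<notin> Tg"
proof -
  have "lift0 w \<noteq> []" using assms by simp
  then show "fst (hd (lift0 w)) \<notin> Tg" "fst (last (lift0 w)) \<notin> Tg"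
    using fst_lift0[OF hd_in_set] fst_lift0[OF last_in_set] gX_Z(2) by metis+
qed

lemma relator_base:
  assumes "r \<in> R0" "r \<noteq> []"
  shows "lift0 r \<in> bases"
proof -
  have "length r \<le> (\<Sum>r\<in>R0. length r)" using assms finite0(2) by (intro member_le_sum) auto
  then have "length r \<le> L" by (simp add: L_def)
  moreover have "ev (lift0 r) = \<one>"
    using P0.cls_relator[OF assms(1)] \<pi>_eq_one_iff[OF P0.relator_words(1)[OF assms(1)]]
    by (simp add: ev_def sub_word_lift0)
  ultimately show ?thesis
    using assms P0.relator_words[OF assms(1)] lift0_ends[OF assms(2)]
    by (simp add: bases_def lift0_words reduced_lift0)
qed

text \<open>Modulo the \<open>t\<close> this identifies the extra generator with the lift of the
  corresponding word of \<open>qs\<close>.\<close>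

lemma Y_base:
  assumes j: "j < length qs"
  shows "(gY j, True) # inv_word (lift0 (qs ! j)) \<in> bases"
proof -
  let ?w = "(gY j, True) # inv_word (lift0 (qs ! j))"
  have q: "qs ! j \<in> words_over Z0" "reduced (qs ! j)" using qs j by auto
  have "length (qs ! j) + 1 \<in> set (map (\<lambda>w. length w + 1) qs)" using j by auto
  then have "length (qs ! j) + 1 \<le> (\<Sum>w\<leftarrow>qs. length w + 1)" by (rule member_le_sum_list) simp
  then have len: "length ?w \<le> L" by (simp add: L_def)
  have "sub_word ?w = qs ! j @ inv_word (qs ! j)"
  proof -
    have "sub_word (inv_word (lift0 (qs ! j))) = inv_word (qs ! j)"
      unfolding lift0_inv_word[symmetric] by (rule sub_word_lift0)
    then show ?thesis by (simp add: sub_word_def sub_letter_def sub_def)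
  qed
  then have ev: "ev ?w = \<one>"
    using \<pi>_cong[of "qs ! j @ inv_word (qs ! j)" "[]"] by (simp add: ev_def \<pi>_Nil)
  have red: "reduced ?w"
  proof -
    have "hd (inv_word (lift0 (qs ! j))) \<noteq> inv_letter (gY j, True)" if "qs ! j \<noteq> []"
    proof -
      have "hd (inv_word (lift0 (qs ! j))) \<in> set (lift0 (inv_word (qs ! j)))"
        using that unfolding lift0_inv_word by (intro hd_in_set) simp
      from fst_lift0[OF this] obtain i where "fst (hd (inv_word (lift0 (qs ! j)))) = gX i 0" by blast
      then show ?thesis by (metis fst_conv gen_inject(6) inv_letter_def)
    qed
    then show ?thesis using reduced_lift0[OF q(2)] by (simp add: reduced_Cons reduced_inv_word)
  qed
  have "fst (last ?w) \<notin> Tg"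
  proof (cases "qs ! j = []")
    case True
    then show ?thesis using gY_Z(2) by (simp add: lift0_def)
  next
    case False
    then show ?thesis using lift0_ends(2)[of "inv_word (qs ! j)"] by (simp add: lift0_inv_word)
  qed
  then show ?thesis
    using len ev red q j gY_Z by (simp add: bases_def lift0_words)
qed

text \<open>Modulo the \<open>t\<close> these bases identify all copies of a generator of
  \<open>P\<close>.\<close>

lemma X_base:
  assumes "i \<in> Z0" "s < k" "s \<noteq> 0"
  shows "[(gX i s, True), (gX i 0, False)] \<in> bases"
proof -
  have "ev [(gX i s, True), (gX i 0, False)] = \<one>"
    using \<pi>_cong[of "[(i, True), inv_letter (i, True)]" "[]"] reduce_cancel_inv_word[of "[(i, True)]"]
    by (simp add: ev_def sub_word_def sub_letter_def sub_def inv_word_single \<pi>_Nil)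
  then show ?thesis
    using assms k_pos gX_Z by (auto simp: bases_def reduced_Cons inv_letter_def L_def)
qed

text \<open>Modulo the \<open>k\<close> kernel generators every word equals the lift of its image, so a word is
  trivial modulo them as soon as it is trivial in \<open>P\<close>.\<close>

lemma kernel_le:
  assumes w: "w \<in> words_over Z" and ew: "ev w = \<one>"
  shows "SC.cls w \<in> NT"
proof -
  interpret F: group F by (rule group_F)
  interpret NT: normal NT F by (rule NT_normal)
  define H where "H = F Mod NT"
  have H: "group H" unfolding H_def by (rule NT.factorgroup_is_group)
  interpret H: group H by (rule H)
  define q where "q w = NT #>\<^bsub>F\<^esub> SC.cls w" for w
  have hom: "(\<lambda>x. NT #>\<^bsub>F\<^esub> x) \<in> hom F H" unfolding H_def by (rule NT.r_coset_hom_Mod)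
  have q_closed: "q u \<in> carrier H" if "u \<in> words_over Z" for u
    using hom_in_carrier[OF hom] that by (simp add: q_def)
  have q_app: "q (u @ v) = q u \<otimes>\<^bsub>H\<^esub> q v" if "u \<in> words_over Z" "v \<in> words_over Z" for u v
    using hom_mult[OF hom, of "SC.cls u" "SC.cls v"] that by (simp add: q_def SC.cls_mult)
  have one_H: "\<one>\<^bsub>H\<^esub> = NT" by (simp add: H_def FactGroup_def)
  have q_one: "q u = \<one>\<^bsub>H\<^esub> \<longleftrightarrow> SC.cls u \<in> NT" if "u \<in> words_over Z" for u
    using F.coset_join1[of NT "SC.cls u"] F.coset_join2[of "SC.cls u" NT] NT_subgroup that
      subgroup.subset[OF NT_subgroup] unfolding q_def one_H by auto
  have q_cancel: "q (u @ inv_word u) = \<one>\<^bsub>H\<^esub>" if "u \<in> words_over Z" for u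
    using SC.cls_cong[of "u @ inv_word u" "[]"] q_one that NT_one by (simp add: SC.cls_Nil)
  have q_eq: "q u = q v" if "u \<in> words_over Z" "v \<in> words_over Z" "SC.cls (u @ inv_word v) \<in> NT" for u v
  proof -
    have "q u \<otimes>\<^bsub>H\<^esub> q (inv_word v) = \<one>\<^bsub>H\<^esub>" using q_one[of "u @ inv_word v"] q_app that by simp
    moreover have "q v \<otimes>\<^bsub>H\<^esub> q (inv_word v) = \<one>\<^bsub>H\<^esub>" using q_cancel[of v] q_app that by simp
    ultimately show ?thesis using H.r_cancel[of "q u" "q (inv_word v)" "q v"] q_closed that by simp
  qed
  \<comment> \<open>Lifting is well defined modulo \<open>NT\<close>, because the lifted nonempty
    relators of \<open>P\<close> are bases.\<close>
  have lift_T: "q (lift0 u) = q (lift0 v)" if "u \<in> words_over Z0" "v \<in> words_over Z0" "P0.cls u = P0.cls v" for u v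
  proof (rule P0.cls_eq_imp_eq[OF H _ _ _ _ that, of "\<lambda>w. q (lift0 w)"])
    show "q (lift0 (x @ y)) = q (lift0 x) \<otimes>\<^bsub>H\<^esub> q (lift0 y)" if "x \<in> words_over Z0" "y \<in> words_over Z0" for x y
      using that by (simp add: lift0_append q_app lift0_words)
    show "q (lift0 [a, inv_letter a]) = \<one>\<^bsub>H\<^esub>" if "fst a \<in> Z0" for a
    proof -
      have "lift0 [a, inv_letter a] = lift0 [a] @ inv_word (lift0 [a])"
        unfolding lift0_inv_word[symmetric] lift0_append[symmetric] by (simp add: inv_word_single)
      then show ?thesis using q_cancel[OF lift0_words[of "[a]"]] that by simp
    qed
    show "q (lift0 r) = \<one>\<^bsub>H\<^esub>" if "r \<in> R0" for r
    proof (cases "r = []")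
      case True
      then show ?thesis using q_one[of "[]"] NT_one by (simp add: lift0_def SC.cls_Nil)
    next
      case False
      then show ?thesis
        using q_one[OF lift0_words] P0.relator_words(1)[OF that] base_NT[OF relator_base[OF that False]] by simp
    qed
  qed (simp add: q_closed lift0_words)
  have gen: "q [(z, True)] = q (lift0 (sub z))" if z: "z \<in> Z" for z
    using z
  proof (cases rule: Z_cases)
    case (Y j)
    have "SC.cls ([(z, True)] @ inv_word (lift0 (qs ! j))) \<in> NT"
      using base_NT[OF Y_base[OF Y(2)]] Y(1) by simp
    then show ?thesis
      using q_eq[of "[(z, True)]" "lift0 (qs ! j)"] z Y qs[of "qs ! j"] by (simp add: lift0_words sub_def)
  next
    case (X i s)
    show ?thesis
    proof (cases "s = 0")
      case True
      then show ?thesis using X by (simp add: sub_def lift0_def)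
    next
      case False
      have "SC.cls ([(z, True)] @ inv_word [(gX i 0, True)]) \<in> NT"
        using base_NT[OF X_base[OF X(2,3) False]] X(1) by (simp add: inv_word_single inv_letter_def)
      then show ?thesis
        using q_eq[of "[(z, True)]" "[(gX i 0, True)]"] z X gX_Z(1)[OF X(2) k_pos]
        by (simp add: sub_def lift0_def)
    qed
  next
    case (T s)
    have "q [(z, True)] = \<one>\<^bsub>H\<^esub>"
      using q_one[of "[(z, True)]"] z T_word_NT[of "[(z, True)]"] T gT_Z(2) by simp
    moreover have "q [] = \<one>\<^bsub>H\<^esub>" using q_one[of "[]"] NT_one by (simp add: SC.cls_Nil)
    ultimately show ?thesis using T by (simp add: sub_def lift0_def)
  qed
  have letter: "q [a] = q (lift0 (sub_letter a))" if a: "fst a \<in> Z" for a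
  proof (cases "snd a")
    case True
    then show ?thesis using gen[OF a] by (cases a) (simp add: sub_letter_def)
  next
    case False
    let ?u = "lift0 (sub (fst a))"
    have u: "?u \<in> words_over Z" using a by (simp add: lift0_words sub_words)
    have a': "a = inv_letter (fst a, True)" using False by (cases a) (simp add: inv_letter_def)
    have "q [(fst a, True)] \<otimes>\<^bsub>H\<^esub> q [a] = \<one>\<^bsub>H\<^esub>"
      using q_cancel[of "[(fst a, True)]"] q_app[of "[(fst a, True)]" "[a]"] a a'
      by (simp add: inv_word_single)
    moreover have "q ?u \<otimes>\<^bsub>H\<^esub> q (inv_word ?u) = \<one>\<^bsub>H\<^esub>"
      using q_cancel[OF u] q_app[of ?u "inv_word ?u"] u by simp
    ultimately have "q [a] = q (inv_word ?u)"
      using H.l_cancel[of "q ?u" "q [a]" "q (inv_word ?u)"] gen[OF a] q_closed u a by simp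
    then show ?thesis using False by (simp add: sub_letter_def lift0_inv_word)
  qed
  have "q u = q (lift0 (sub_word u))" if "u \<in> words_over Z" for u
    using that
  proof (induction u)
    case (Cons a u)
    then show ?case
      using letter[of a] q_app[of "[a]" u] q_app[of "lift0 (sub_letter a)" "lift0 (sub_word u)"]
      by (simp add: sub_word_def lift0_append lift0_words sub_letter_words sub_word_words[unfolded sub_word_def])
  qed (simp add: sub_word_def lift0_def)
  then have "q w = q (lift0 (sub_word w))" using w by blast
  also have "\<dots> = q (lift0 [])"
    using ew w \<pi>_eq_one_iff[OF sub_word_words[OF w]]
    by (intro lift_T) (simp_all add: ev_def sub_word_words P0.cls_Nil)
  also have "\<dots> = \<one>\<^bsub>H\<^esub>" using q_one[of "[]"] NT_one by (simp add: lift0_def SC.cls_Nil)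
  finally show ?thesis using q_one[OF w] by simp
qed

lemma kernel_eq: "generate F Ts = kernel F P \<psi>"
proof
  interpret F: group F by (rule group_F)
  interpret \<psi>: group_hom F P \<psi>
    using group_F P.is_group \<psi>_hom by (simp add: group_hom_def group_hom_axioms_def)
  have "\<psi> x = \<one>" if "x \<in> Ts" for x
    using that gT_Z by (auto simp: Ts_def \<psi>_cls ev_def sub_word_def sub_letter_def sub_def \<pi>_Nil)
  then have "Ts \<subseteq> kernel F P \<psi>" using Ts_carrier by (auto simp: kernel_def)
  then show "generate F Ts \<subseteq> kernel F P \<psi>"
    by (rule F.generate_subgroup_incl) (rule \<psi>.subgroup_kernel)
  show "kernel F P \<psi> \<subseteq> generate F Ts"
    using kernel_le by (auto simp: kernel_def \<psi>_cls elim!: carrier_F_cases)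
qed

text \<open>Otherwise a word of two letters would contain three quarters of a relator, and relators
  have at least 5 letters. This gives exactly \<open>k\<close> kernel generators and the exact order
  of \<open>\<sigma>\<close>.\<close>

lemma cls_T_inject:
  assumes s: "s < k" "s' < k" and eq: "SC.cls [(gT s, True)] = SC.cls [(gT s', True)]"
  shows "s = s'"
proof (rule ccontr)
  assume ne: "s \<noteq> s'"
  let ?w = "[(gT s, False), (gT s', True)]"
  have w: "?w \<in> words_over Z" using s by (simp add: gT_Z)
  have "SC.cls ?w = \<one>\<^bsub>F\<^esub>"
    using SC.cls_eq_iff[of "[(gT s, True)]" "[(gT s', True)]"] eq s
    by (simp add: gT_Z inv_word_single inv_letter_def)
  moreover have "cyclically_reduced ?w"
    using ne by (auto simp: cyclically_reduced_def reduced_Cons inv_letter_def)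
  ultimately obtain s0 t where "s0 \<in> symmetrized BR.R" "t \<le> length ?w" "3 * real (length s0) \<le> 4 * real t"
    using SC.long_relator_part[OF w] by blast
  moreover from this have "5 \<le> length s0" using BR.symmetrized_long(1)[of s0] by linarith
  ultimately show False by simp
qed

lemma card_Ts: "card Ts = k"
  using cls_T_inject by (auto simp: Ts_def inj_on_def intro!: card_image[THEN trans])

section \<open>Order of the automorphism\<close>

lemma funpow_\<sigma>: "w \<in> words_over Z \<Longrightarrow> (\<sigma> ^^ n) (SC.cls w) = SC.cls (map (shift_letter k n) w)"
proof (induction n)
  case 0
  then have "map (shift_letter k 0) w = w"
    using words_over_mem by (intro map_idI shift_letter_k) auto
  then show ?case by simp
next
  case (Suc n)
  then show ?case
    by (simp add: \<sigma>_cls shift_words shift_letter_shift_letter comp_def)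
qed

lemma funpow_\<sigma>_dvd:
  assumes "k dvd n" "x \<in> carrier F"
  shows "(\<sigma> ^^ n) x = x"
proof -
  obtain w where w: "w \<in> words_over Z" "x = SC.cls w" using carrier_F_cases[OF assms(2)] .
  have "map (shift_letter k n) w = w"
    using words_over_mem[OF w(1)] assms(1) by (intro map_idI shift_letter_k) auto
  then show ?thesis using w by (simp add: funpow_\<sigma>)
qed

lemma funpow_\<sigma>_closed: "x \<in> carrier F \<Longrightarrow> (\<sigma> ^^ n) x \<in> carrier F"
  by (auto elim!: carrier_F_cases simp: funpow_\<sigma> shift_words)

lemma \<sigma>_auto: "\<sigma> \<in> auto F"
proof -
  have closed: "\<sigma> x \<in> carrier F" if "x \<in> carrier F" for x
    using funpow_\<sigma>_closed[OF that, of 1] by simp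
  have "\<sigma> \<in> hom F F"
    using closed by (intro homI) (auto elim!: carrier_F_cases simp: \<sigma>_cls SC.cls_mult shift_words)
  moreover have "bij_betw \<sigma> (carrier F) (carrier F)"
  proof (rule bij_betwI[where g = "\<sigma> ^^ (k - 1)"])
    have k1: "Suc (k - 1) = k" using k_pos by simp
    show "(\<sigma> ^^ (k - 1)) (\<sigma> x) = x" if "x \<in> carrier F" for x
      using funpow_\<sigma>_dvd[OF dvd_refl that] by (metis k1 comp_apply funpow_Suc_right)
    show "\<sigma> ((\<sigma> ^^ (k - 1)) x) = x" if "x \<in> carrier F" for x
      using funpow_\<sigma>_dvd[OF dvd_refl that] by (metis k1 comp_apply funpow.simps(2))
  qed (use closed funpow_\<sigma>_closed in auto)
  ultimately show ?thesis by (simp add: auto_def Bij_def \<sigma>_def)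
qed

lemma pow_\<sigma>: "\<sigma> [^]\<^bsub>AutoGroup F\<^esub> n = restrict (\<sigma> ^^ n) (carrier F)"
proof (induction n)
  case 0
  then show ?case by (auto simp: AutoGroup_def BijGroup_def)
next
  case (Suc n)
  interpret A: group "AutoGroup F" by (rule group.AutoGroup[OF group_F])
  have \<sigma>A: "\<sigma> \<in> carrier (AutoGroup F)" using \<sigma>_auto by (simp add: AutoGroup_def)
  have mem: "restrict (\<sigma> ^^ n) (carrier F) \<in> Bij (carrier F)" "\<sigma> \<in> Bij (carrier F)"
    using A.nat_pow_closed[OF \<sigma>A, of n] \<sigma>_auto unfolding Suc by (simp_all add: AutoGroup_def auto_def)
  have "\<sigma> [^]\<^bsub>AutoGroup F\<^esub> Suc n = restrict (\<sigma> ^^ n) (carrier F) \<otimes>\<^bsub>AutoGroup F\<^esub> \<sigma>"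
    by (simp only: A.nat_pow_Suc Suc)
  also have "\<dots> = compose (carrier F) (restrict (\<sigma> ^^ n) (carrier F)) \<sigma>"
    using mem by (simp add: AutoGroup_def BijGroup_def)
  also have "\<dots> = restrict (\<sigma> ^^ Suc n) (carrier F)"
  proof (rule ext)
    fix x
    show "compose (carrier F) (restrict (\<sigma> ^^ n) (carrier F)) \<sigma> x = restrict (\<sigma> ^^ Suc n) (carrier F) x"
    proof (cases "x \<in> carrier F")
      case True
      then have "\<sigma> x \<in> carrier F" using funpow_\<sigma>_closed[of x 1] by simp
      then show ?thesis using True by (simp add: compose_def funpow_swap1)
    qed (simp add: compose_def)
  qed
  finally show ?case .
qed

lemma ord_\<sigma>: "group.ord (AutoGroup F) \<sigma> = k"
proof -
  interpret A: group "AutoGroup F" by (rule group.AutoGroup[OF group_F])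
  have \<sigma>A: "\<sigma> \<in> carrier (AutoGroup F)" using \<sigma>_auto by (simp add: AutoGroup_def)
  have one: "\<one>\<^bsub>AutoGroup F\<^esub> = restrict id (carrier F)"
    by (auto simp: AutoGroup_def BijGroup_def fun_eq_iff)
  have "\<sigma> [^]\<^bsub>AutoGroup F\<^esub> n = \<one>\<^bsub>AutoGroup F\<^esub> \<longleftrightarrow> k dvd n" for n :: nat
  proof
    assume "k dvd n"
    then show "\<sigma> [^]\<^bsub>AutoGroup F\<^esub> n = \<one>\<^bsub>AutoGroup F\<^esub>"
      unfolding pow_\<sigma> one by (auto simp: funpow_\<sigma>_dvd intro!: restrict_ext)
  next
    assume eq: "\<sigma> [^]\<^bsub>AutoGroup F\<^esub> n = \<one>\<^bsub>AutoGroup F\<^esub>"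
    \<comment> \<open>The class of the letter \<open>t\<close> with index 0 detects the order, since
      its first \<open>k\<close> translates are distinct.\<close>
    let ?t = "[(gT 0, True)]"
    have t: "?t \<in> words_over Z" using k_pos by (simp add: gT_Z)
    have "(\<sigma> ^^ n) (SC.cls ?t) = SC.cls ?t"
      using fun_cong[OF eq[unfolded pow_\<sigma> one], of "SC.cls ?t"] t by simp
    then have "SC.cls [(gT (n mod k), True)] = SC.cls ?t" using funpow_\<sigma>[OF t, of n] by simp
    then have "n mod k = 0" using k_pos by (intro cls_T_inject) auto
    then show "k dvd n" by auto
  qed
  then show ?thesis using A.ord_unique[OF \<sigma>A] by blast
qed

subsection \<open>Fixed points\<close>

lemma Y_word:
  assumes "set u \<subseteq> gY ` {..<length qs} \<times> UNIV"
  shows "u \<in> words_over Z" "map \<sigma>l u = u" "ev u \<in> generate P (\<pi> ` set qs)"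
proof -
  have "u \<in> words_over Z \<and> map \<sigma>l u = u \<and> ev u \<in> generate P (\<pi> ` set qs)"
    using assms
  proof (induction u)
    case (Cons a u)
    obtain j z where a: "a = (gY j, z)" "j < length qs" using Cons.prems by auto
    have u: "u \<in> words_over Z" "map \<sigma>l u = u" "ev u \<in> generate P (\<pi> ` set qs)" using Cons by auto
    have q: "qs ! j \<in> words_over Z0" using qs a by simp
    have "ev [a] \<in> generate P (\<pi> ` set qs)"
      using a(2) by (cases z) (auto simp: a ev_def sub_word_def sub_letter_def sub_def \<pi>_inv_word[OF q]
          intro!: generate.incl generate.inv)
    moreover have "ev (a # u) = ev [a] \<otimes> ev u"
      using ev_append[of "[a]" u] u(1) a gY_Z by simp
    ultimately show ?case using u a gY_Z by (simp add: generate.eng)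
  qed (auto simp: ev_Nil generate.one)
  then show "u \<in> words_over Z" "map \<sigma>l u = u" "ev u \<in> generate P (\<pi> ` set qs)" by auto
qed

lemma generate_Y_word:
  assumes "x \<in> generate P (\<pi> ` set qs)"
  shows "\<exists>u. set u \<subseteq> gY ` {..<length qs} \<times> UNIV \<and> ev u = x"
  using assms
proof (induction rule: generate.induct)
  case one
  then show ?case by (intro exI[of _ "[]"]) (simp add: ev_Nil)
next
  case (incl h)
  then obtain j where "j < length qs" "h = \<pi> (qs ! j)" by (auto simp: in_set_conv_nth)
  then show ?case
    by (intro exI[of _ "[(gY j, True)]"]) (simp add: ev_def sub_word_def sub_letter_def sub_def)
next
  case (inv h)
  then obtain j where j: "j < length qs" "h = \<pi> (qs ! j)" by (auto simp: in_set_conv_nth)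
  then have "\<pi> (inv_word (qs ! j)) = inv h" using qs by (simp add: \<pi>_inv_word)
  then show ?case using j
    by (intro exI[of _ "[(gY j, False)]"]) (simp add: ev_def sub_word_def sub_letter_def sub_def)
next
  case (eng h1 h2)
  then obtain u1 u2 where "set u1 \<subseteq> gY ` {..<length qs} \<times> UNIV" "ev u1 = h1"
    "set u2 \<subseteq> gY ` {..<length qs} \<times> UNIV" "ev u2 = h2" by blast
  then show ?case
    using Y_word(1)[of u1] Y_word(1)[of u2] by (intro exI[of _ "u1 @ u2"]) (simp add: ev_append)
qed

text \<open>For \<open>k \<ge> 2\<close> the shift moves every \<open>t\<close> and every copy of a
  generator of \<open>P\<close>.\<close>

lemma fixed_letter:
  assumes "fst a \<in> Z" "\<sigma>l a = a"
  shows "a \<in> gY ` {..<length qs} \<times> UNIV"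
  using assms Suc_mod_neq by (cases a) (fastforce elim!: Z_cases)

lemma image_fixed_subgroup: "\<psi> ` fixed_subgroup F \<sigma> = generate P (\<pi> ` set qs)"
proof
  show "\<psi> ` fixed_subgroup F \<sigma> \<subseteq> generate P (\<pi> ` set qs)"
  proof
    fix y assume "y \<in> \<psi> ` fixed_subgroup F \<sigma>"
    then obtain x where x: "x \<in> carrier F" "\<sigma> x = x" "y = \<psi> x" by (auto simp: fixed_subgroup_def)
    obtain w where w: "w \<in> words_over Z" "x = SC.cls w" using carrier_F_cases[OF x(1)] .
    have noinv: "map \<sigma>l (inv_word s) \<noteq> s" if "s \<in> symmetrized BR.R" for s
    proof (rule BR.no_symmetric_relator[OF _ _ that])
      show "snd (\<sigma>l a) = snd a" for a by (simp add: shift_letter_def)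
      show "fst (\<sigma>l a) \<in> Tg \<longleftrightarrow> fst a \<in> Tg" if "a \<in> set (inv_word s)" for a
        using words_over_mem[OF _ that, of Z] SC.symmetrized_words[OF \<open>s \<in> symmetrized BR.R\<close>]
        by (intro shift_letter_Tg) simp
    qed
    have "SC.cls (map \<sigma>l w) = SC.cls w" using x(2) w by (simp add: \<sigma>_cls)
    then obtain u where u: "u \<in> words_over Z" "SC.cls u = SC.cls w" "\<And>a. a \<in> set u \<Longrightarrow> \<sigma>l a = a"
      using SC.fixed_class[OF shift_letter_inv shift_letter_Z shift_symmetrized noinv shift_cong w(1)] by blast
    have "set u \<subseteq> gY ` {..<length qs} \<times> UNIV"
      using fixed_letter words_over_mem[OF u(1)] u(3) by blast
    moreover have "y = ev u" using x(3) w u \<psi>_cls by metis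
    ultimately show "y \<in> generate P (\<pi> ` set qs)" using Y_word(3) by blast
  qed
  show "generate P (\<pi> ` set qs) \<subseteq> \<psi> ` fixed_subgroup F \<sigma>"
  proof
    fix y assume "y \<in> generate P (\<pi> ` set qs)"
    then obtain u where u: "set u \<subseteq> gY ` {..<length qs} \<times> UNIV" "ev u = y" using generate_Y_word by blast
    then have "\<psi> (SC.cls u) = y" "SC.cls u \<in> fixed_subgroup F \<sigma>"
      using Y_word[OF u(1)] by (simp_all add: \<psi>_cls fixed_subgroup_def \<sigma>_cls)
    then show "y \<in> \<psi> ` fixed_subgroup F \<sigma>" by blast
  qed
qed

lemma \<sigma>_kernel: "\<sigma> ` kernel F P \<psi> = kernel F P \<psi>"
proof -
  have bij: "\<sigma> ` carrier F = carrier F"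
    using \<sigma>_auto by (auto simp: auto_def Bij_def bij_betw_def)
  show ?thesis
  proof
    show "\<sigma> ` kernel F P \<psi> \<subseteq> kernel F P \<psi>"
      using bij \<psi>_\<sigma> by (auto simp: kernel_def)
    show "kernel F P \<psi> \<subseteq> \<sigma> ` kernel F P \<psi>"
    proof
      fix x assume x: "x \<in> kernel F P \<psi>"
      then obtain y where "y \<in> carrier F" "x = \<sigma> y" using bij by (auto simp: kernel_def)
      then show "x \<in> \<sigma> ` kernel F P \<psi>" using x \<psi>_\<sigma> by (auto simp: kernel_def)
    qed
  qed
qed

lemma torsion_free_F: "torsion_free F"
  by (rule SC.torsion_free_presented_group) (rule BR.no_proper_power)

lemma small_cancellation_F:
  assumes "c \<le> c'"
  shows "has_finite_small_cancellation_presentation c' F"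
proof -
  have "finite BR.R" using finite_bases by (simp add: Ix_def)
  then have "finite_presentation Z BR.R" using finite_Z R_carrier by (simp add: finite_presentation_def)
  moreover have "metric_small_cancellation c' BR.R"
  proof -
    have "c * real n \<le> c' * real n" for n using assms by (intro mult_right_mono) auto
    then show ?thesis
      using BR.metric_small_cancellation_R unfolding metric_small_cancellation_def by (meson order_less_le_trans)
  qed
  ultimately show ?thesis
    unfolding has_finite_small_cancellation_presentation_def using iso_refl by blast
qed

end

theorem proposition5p5:
  fixes P :: "('p, 'm) monoid_scheme"
    and Q :: "'p set"
    and c :: real
    and k :: nat
  assumes "group P" and "finitely_presented P"
    and "subgroup Q P" and "\<exists>S. finite S \<and> S \<subseteq> Q \<and> generate P S = Q"
    and "c > 0" and "k \<ge> 2"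
  shows "\<exists>(F :: nat word set monoid) \<sigma> \<psi>.
    group F \<and> torsion_free F \<and> has_finite_small_cancellation_presentation c F \<and>
    \<sigma> \<in> auto F \<and> \<psi> \<in> epi F P \<and>
    (\<exists>S. S \<subseteq> carrier F \<and> finite S \<and> card S = k \<and> generate F S = kernel F P \<psi>) \<and>
    group.ord (AutoGroup F) \<sigma> = k \<and>
    \<psi> ` fixed_subgroup F \<sigma> = Q \<and>
    \<sigma> ` kernel F P \<psi> = kernel F P \<psi> \<and>
    (\<forall>f \<in> carrier F. \<psi> (\<sigma> f) = \<psi> f)"
proof -
  obtain Z0 :: "nat set" and R0 \<theta> where fp: "finite_presentation Z0 R0" and \<theta>: "\<theta> \<in> iso (presented_group Z0 R0) P"
    using assms(2) by (auto simp: finitely_presented_def is_iso_def)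
  interpret P0: presentation Z0 R0
    using fp by unfold_locales (simp add: finite_presentation_def)
  obtain S where S: "finite S" "S \<subseteq> Q" "generate P S = Q" using assms(4) by blast
  have "S \<subseteq> carrier P" using S(2) assms(3) subgroup.subset by blast
  have ex: "\<exists>w. w \<in> words_over Z0 \<and> reduced w \<and> \<theta> (P0.cls w) = x" if "x \<in> S" for x
  proof -
    have "x \<in> \<theta> ` carrier (presented_group Z0 R0)"
      using that \<open>S \<subseteq> carrier P\<close> \<theta> by (auto simp: iso_def bij_betw_def)
    then obtain w where "w \<in> words_over Z0" "x = \<theta> (P0.cls w)" by (auto simp: P0.carrier_G)
    then show ?thesis
      \<comment> \<open>The words are taken reduced because the bases formed from them in
        \<open>Y_base\<close> must be reduced.\<close>
      by (intro exI[of _ "reduce w"]) (simp add: reduced_reduce reduce_words_over)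
  qed
  then obtain h where h: "\<And>x. x \<in> S \<Longrightarrow> h x \<in> words_over Z0 \<and> reduced (h x) \<and> \<theta> (P0.cls (h x)) = x"
    by metis
  obtain xs where xs: "set xs = S" using finite_list[OF S(1)] by blast
  \<comment> \<open>The construction runs with a constant of at most 1/20; the condition it yields
    is at least as strong as the one for \<open>c\<close>.\<close>
  have "min c (1/20) * 20 \<le> 1" by (simp add: min_def)
  moreover have "w \<in> words_over Z0 \<and> reduced w" if "w \<in> h ` S" for w using h that by auto
  ultimately interpret rips_construction P Z0 R0 \<theta> "map h xs" k "min c (1/20)"
    using assms(1,5,6) fp \<theta> xs
    by (simp add: rips_construction_def rips_construction_axioms_def P0.presentation_axioms finite_presentation_def)
  have "\<pi> ` set (map h xs) = S" using h xs by (force simp: \<pi>_def)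
  then have "\<psi> ` fixed_subgroup F \<sigma> = Q" using image_fixed_subgroup S(3) by simp
  moreover have "\<psi> \<in> epi F P" using \<psi>_hom \<psi>_surj by (simp add: epi_def)
  moreover have "finite Ts" by (simp add: Ts_def)
  ultimately show ?thesis
    using group_F torsion_free_F small_cancellation_F[of c] \<sigma>_auto Ts_carrier card_Ts kernel_eq ord_\<sigma> \<sigma>_kernel \<psi>_\<sigma>
    by (intro exI[of _ F] exI[of _ \<sigma>] exI[of _ \<psi>]) (auto intro: exI[of _ Ts])
qed


end
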